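(* Let $n\geq 2$ be an integer, $k$ be a PAC field of characteristic $p\geq 0$ not dividing $n$ and $M(Y)\in k[Y]$ be a degree $n$ Morse polynomial. Then every degree $n$ extension $E/k$ can be realized by a polynomial $M(Y)+b$ for some $b\in k$.
   Context: A field $k$ is PAC if every non-empty geometrically irreducible $k$-variety has a Zariski-dense set of $k$-rational points. A degree $n$ polynomial $M(Y)\in k[Y]$ (with the characteristic of $k$ not dividing $n$) is a Morse polynomial if the zeroes $\beta_1,\ldots,\beta_{n-1}$ (in an algebraic closure of $k$) of the derivative $M'$ are simple and $M(\beta_i)\neq M(\beta_j)$ for $i\neq j$. A field extension $E/k$ can be realized by a polynomial $Q(Y)\in k[Y]$ if $Q(Y)$ is the irreducible polynomial over $k$ of some primitive element of $E/k$. *)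

theory Defs
  imports
    "HOL-Algebra.Algebraic_Closure_Type"
    "HOL-Library.Poly_Mapping"
    "Subresultants.More_Homomorphisms"
begin

section \<open>Polynomials in the variables \<open>X\<^sub>0, \<dots>, X\<^sub>N\<^sub>-\<^sub>1\<close>\<close>

text \<open>
  A monomial is a finitely supported exponent vector, a polynomial a finitely supported map from
  monomials to coefficients. The ring structure is the convolution structure of
  \<^theory>\<open>HOL-Library.Poly_Mapping\<close>.
\<close>

type_synonym 'a mpoly = "(nat \<Rightarrow>\<^sub>0 nat) \<Rightarrow>\<^sub>0 'a"

definition poly_ring :: "nat \<Rightarrow> 'a::zero mpoly set" where
  "poly_ring N = {P. \<forall>m \<in> Poly_Mapping.keys P. Poly_Mapping.keys m \<subseteq> {..<N}}"

definition eval_mpoly :: "'a::comm_semiring_1 mpoly \<Rightarrow> (nat \<Rightarrow> 'a) \<Rightarrow> 'a" where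
  "eval_mpoly P x =
     (\<Sum>m \<in> Poly_Mapping.keys P. Poly_Mapping.lookup P m *
        (\<Prod>i \<in> Poly_Mapping.keys m. x i ^ Poly_Mapping.lookup m i))"

definition ideal_generated :: "nat \<Rightarrow> 'a::comm_semiring_1 mpoly set \<Rightarrow> 'a mpoly set" where
  "ideal_generated N B =
     {(\<Sum>P\<in>G. Q P * P) | G Q. finite G \<and> G \<subseteq> B \<and> (\<forall>P\<in>G. Q P \<in> poly_ring N)}"

section \<open>Affine varieties and PAC fields\<close>

text \<open>A point of affine \<open>N\<close>-space is a sequence that vanishes from index \<open>N\<close> on.\<close>

definition affine_space :: "nat \<Rightarrow> (nat \<Rightarrow> 'a::zero) set" where
  "affine_space N = {x. \<forall>i\<ge>N. x i = 0}"

definition zero_locus :: "nat \<Rightarrow> 'a::comm_semiring_1 mpoly set \<Rightarrow> (nat \<Rightarrow> 'a) set" where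
  "zero_locus N B = {x \<in> affine_space N. \<forall>P\<in>B. eval_mpoly P x = 0}"

definition zariski_closed :: "nat \<Rightarrow> (nat \<Rightarrow> 'a::comm_semiring_1) set \<Rightarrow> bool" where
  "zariski_closed N V \<longleftrightarrow> (\<exists>B \<subseteq> poly_ring N. V = zero_locus N B)"

definition vanishing_ideal :: "nat \<Rightarrow> (nat \<Rightarrow> 'a::comm_semiring_1) set \<Rightarrow> 'a mpoly set" where
  "vanishing_ideal N V = {P \<in> poly_ring N. \<forall>x\<in>V. eval_mpoly P x = 0}"

definition zariski_irreducible :: "nat \<Rightarrow> (nat \<Rightarrow> 'a::comm_semiring_1) set \<Rightarrow> bool" where
  "zariski_irreducible N V \<longleftrightarrow>
     (\<forall>A B. zariski_closed N A \<and> zariski_closed N B \<and> V = A \<union> B \<longrightarrow> V = A \<or> V = B)"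

text \<open>
  An affine \<open>k\<close>-variety is identified with its set \<open>V\<close> of geometric points, i.e. points over the
  algebraic closure. To be a \<open>k\<close>-variety means more than being the zero locus of polynomials over
  \<open>k\<close>: the whole vanishing ideal of \<open>V\<close> must be generated by polynomials over \<open>k\<close>. Over
  imperfect fields this is the classical ``defined over \<open>k\<close>'', it is equivalent to geometric
  reducedness of the corresponding scheme, and without it the geometric point \<open>a\<^bsup>1/p\<^esup>\<close> would be
  a geometrically irreducible variety over \<open>k\<close> without rational points.
\<close>

definition affine_variety :: "nat \<Rightarrow> (nat \<Rightarrow> 'k::field alg_closure) set \<Rightarrow> bool" where
  "affine_variety N V \<longleftrightarrow> zariski_closed N V \<and>
     (\<exists>B \<subseteq> (poly_ring N :: 'k mpoly set).
        vanishing_ideal N V = ideal_generated N (Poly_Mapping.map to_ac ` B))"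

text \<open>
  Since \<open>V\<close> consists of its geometric points, \<open>V\<close> is geometrically irreducible as a \<open>k\<close>-variety
  iff it is irreducible in the Zariski topology over the algebraic closure.
\<close>

definition geometrically_irreducible :: "nat \<Rightarrow> (nat \<Rightarrow> 'k::field alg_closure) set \<Rightarrow> bool" where
  "geometrically_irreducible N V \<longleftrightarrow> zariski_irreducible N V"

definition rational_points :: "(nat \<Rightarrow> 'k::field alg_closure) set \<Rightarrow> (nat \<Rightarrow> 'k alg_closure) set" where
  "rational_points V = {x \<in> V. \<forall>i. x i \<in> range to_ac}"

text \<open>
  Affine varieties suffice for the PAC property: every non-empty irreducible variety has a non-empty
  affine open subset, which is dense. In the definition below, \<open>hull\<close> is Zariski closure.
\<close>

definition pac_field :: "'k::field itself \<Rightarrow> bool" where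
  "pac_field _ \<longleftrightarrow>
     (\<forall>N. \<forall>V :: (nat \<Rightarrow> 'k alg_closure) set.
        affine_variety N V \<and> V \<noteq> {} \<and> geometrically_irreducible N V \<longrightarrow>
        zariski_closed N hull rational_points V = V)"

section \<open>Morse polynomials\<close>

definition morse_poly :: "'k::field poly \<Rightarrow> bool" where
  "morse_poly M \<longleftrightarrow>
     \<not> CHAR('k) dvd Polynomial.degree M \<and>
     (let zeros = {\<beta>. poly (map_poly to_ac (pderiv M)) \<beta> = 0} in
        (\<forall>\<beta>\<in>zeros. order \<beta> (map_poly to_ac (pderiv M)) = 1) \<and>
        inj_on (poly (map_poly to_ac M)) zeros)"

section \<open>Field extensions\<close>

text \<open>
  An extension \<open>E/k\<close> is given by an embedding \<open>\<iota> :: 'k \<Rightarrow> 'e\<close> with \<^term>\<open>field_hom \<iota>\<close>. Infinite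
  extensions get degree \<open>0\<close>.
\<close>

definition ext_degree :: "('k::field \<Rightarrow> 'e::field) \<Rightarrow> nat" where
  "ext_degree \<iota> = vector_space.dim (\<lambda>c x. \<iota> c * x) UNIV"

definition is_subfield :: "'e::field set \<Rightarrow> bool" where
  "is_subfield F \<longleftrightarrow> 1 \<in> F \<and>
     (\<forall>x\<in>F. \<forall>y\<in>F. x - y \<in> F \<and> x * y \<in> F) \<and> (\<forall>x\<in>F. inverse x \<in> F)"

definition primitive_element :: "('k::field \<Rightarrow> 'e::field) \<Rightarrow> 'e \<Rightarrow> bool" where
  "primitive_element \<iota> \<theta> \<longleftrightarrow> is_subfield hull insert \<theta> (range \<iota>) = UNIV"

text \<open>
  The irreducible polynomial of an element is taken up to a nonzero constant factor: \<open>Q\<close> need not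
  be monic.
\<close>

definition realized_by :: "('k::field \<Rightarrow> 'e::field) \<Rightarrow> 'k poly \<Rightarrow> bool" where
  "realized_by \<iota> Q \<longleftrightarrow>
     Factorial_Ring.irreducible Q \<and>
     (\<exists>\<theta>. primitive_element \<iota> \<theta> \<and> poly (map_poly \<iota> Q) \<theta> = 0)"

end

theory Submission
  imports Defs "HOL-Library.Function_Algebras"
begin

text \<open>
  Over the algebraic closure \<open>K\<close> of \<open>k\<close> consider the curve \<open>C\<close> of ordered roots: its points are the
  \<open>(s, y)\<close> with \<open>M - s = \<Prod>(Y - y\<^sub>i)\<close>. The coordinate ring of \<open>C\<close> is free over \<open>K[s]\<close> on the
  Artin monomials. If \<open>C\<close> were reducible, a nontrivial function on \<open>C\<close> would satisfy \<open>z\<^sup>2 = g(s) z\<close>.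
  If \<open>g(t) = 0\<close>, a trace argument gives \<open>s - t | \<Delta> z\<close>, where \<open>\<Delta>\<close> is the product of all differences
  \<open>y\<^sub>i - y\<^sub>j\<close>, and since the Morse condition makes each locus \<open>y\<^sub>i = y\<^sub>j\<close> on \<open>C\<close> reduced, the factors of
  \<open>\<Delta>\<close> can be cancelled one by one. So one may assume \<open>g = 1\<close>. But \<open>C\<close> is reduced at infinity, because
  \<open>Y\<^sup>n - 1\<close> is separable; hence the leading form of an idempotent squares to \<open>0\<close> unless it is constant.
  This replaces the usual computation of the Galois group of \<open>M - s\<close> by ramification theory.

  As \<open>p\<close> does not divide \<open>n\<close>, \<open>E = k(\<theta>)\<close> is separable. Twisting \<open>C\<close> by \<open>E\<close> gives a variety over \<open>k\<close> whose
  rational points are the primitive elements \<open>\<eta>\<close> of \<open>E\<close> with \<open>M(\<eta>) \<in> k\<close>; to obtain a closed affine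
  variety, a polynomial \<open>U\<close> with \<open>U(\<eta>) = \<theta>\<close> is made part of the data.
\<close>

text \<open>Knowing the points of the twisted curve is not enough: its whole vanishing ideal must be
  generated by polynomials over \<open>k\<close>. So reduction to Artin monomials is carried out
  modulo an arbitrary ideal and used twice: for functions on \<open>C\<close>, modulo those
  vanishing on all fibres, and for polynomials in the twisted coordinates, modulo the ideal
  \<open>J\<close> of the equations. The function \<open>z\<close> comes from a pair
  \<open>F G = 0\<close> on \<open>C\<close>. The characteristic polynomial of \<open>F\<close>
  under permutations of the roots has coefficients in \<open>K[s]\<close>. Remove the power of the
  indeterminate dividing it and insert \<open>F\<close>: the result is \<open>0\<close> where
  \<open>F\<close> is nonzero, and the lowest nonzero coefficient \<open>g\<close> where
  \<open>F = 0\<close>. Besides giving a closed variety, \<open>U\<close> makes the differences of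
  the conjugates of \<open>\<eta>\<close> units modulo \<open>J\<close>. Over \<open>K\<close> the
  twisted curve is therefore the part of \<open>C\<close> where the coordinates are distinct, and
  functions pass between the two up to powers of the discriminant. The choice of
  \<open>\<theta>\<close> requires \<open>k\<close> to be infinite, which follows from the PAC
  property.\<close>

hide_const (open) Poly_Mapping.degree

section \<open>Subrings and ideals\<close>

definition is_subring :: "'r::comm_ring_1 set \<Rightarrow> bool" where
  "is_subring R \<longleftrightarrow> 1 \<in> R \<and> (\<forall>x\<in>R. \<forall>y\<in>R. x - y \<in> R \<and> x * y \<in> R)"

text \<open>Relative to a subring \<open>P\<close>, so that the same lemmas serve functions, with
  \<open>P = UNIV\<close>, and polynomials in \<open>N\<close> variables, with
  \<open>P = poly_ring N\<close>.\<close>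

definition is_ideal :: "'r::comm_ring_1 set \<Rightarrow> 'r set \<Rightarrow> bool" where
  "is_ideal P J \<longleftrightarrow> 0 \<in> J \<and> (\<forall>x\<in>J. \<forall>y\<in>J. x + y \<in> J) \<and> (\<forall>a\<in>P. \<forall>x\<in>J. a * x \<in> J)"

inductive_set rgen :: "'r::comm_ring_1 set \<Rightarrow> 'r set" for S where
  base: "x \<in> S \<Longrightarrow> x \<in> rgen S"
| one: "1 \<in> rgen S"
| diff: "x \<in> rgen S \<Longrightarrow> y \<in> rgen S \<Longrightarrow> x - y \<in> rgen S"
| mult: "x \<in> rgen S \<Longrightarrow> y \<in> rgen S \<Longrightarrow> x * y \<in> rgen S"

lemma subring_rgen: "is_subring (rgen S)"
  unfolding is_subring_def by (auto intro: rgen.intros)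

context
  fixes R :: "'r::comm_ring_1 set"
  assumes R: "is_subring R"
begin

lemma subring_one: "1 \<in> R"
  and subring_diff: "x \<in> R \<Longrightarrow> y \<in> R \<Longrightarrow> x - y \<in> R"
  and subring_mult: "x \<in> R \<Longrightarrow> y \<in> R \<Longrightarrow> x * y \<in> R"
  using R unfolding is_subring_def by auto

lemma subring_zero: "0 \<in> R"
  using subring_diff[OF subring_one subring_one] by simp

lemma subring_uminus: "x \<in> R \<Longrightarrow> - x \<in> R"
  using subring_diff[OF subring_zero] by simp

lemma subring_add: "x \<in> R \<Longrightarrow> y \<in> R \<Longrightarrow> x + y \<in> R"
  using subring_diff[of x "- y"] subring_uminus by simp

lemma subring_power: "x \<in> R \<Longrightarrow> x ^ k \<in> R"
  by (induction k) (auto intro: subring_one subring_mult)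

lemma subring_sum: "(\<And>i. i \<in> I \<Longrightarrow> f i \<in> R) \<Longrightarrow> sum f I \<in> R"
  by (induction I rule: infinite_finite_induct) (auto intro: subring_zero subring_add)

lemma subring_prod: "(\<And>i. i \<in> I \<Longrightarrow> f i \<in> R) \<Longrightarrow> prod f I \<in> R"
  by (induction I rule: infinite_finite_induct) (auto intro: subring_one subring_mult)

lemma rgen_least: "S \<subseteq> R \<Longrightarrow> rgen S \<subseteq> R"
proof
  fix x assume "S \<subseteq> R" "x \<in> rgen S"
  from this(2,1) show "x \<in> R"
    by (induction rule: rgen.induct) (auto intro: subring_one subring_diff subring_mult)
qed

lemmas subring_intros = subring_one subring_zero subring_diff subring_mult subring_uminus subring_add
  subring_power subring_sum subring_prod

end

lemmas rgen_intros = subring_intros[OF subring_rgen]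

lemma rgen_mono: "S \<subseteq> T \<Longrightarrow> rgen S \<subseteq> rgen T"
  by (rule rgen_least[OF subring_rgen]) (auto intro: rgen.base)

lemma rgen_trans: "S \<subseteq> rgen T \<Longrightarrow> rgen S \<subseteq> rgen T"
  by (rule rgen_least[OF subring_rgen])

context
  fixes P J :: "'r::comm_ring_1 set"
  assumes P: "is_subring P" and J: "is_ideal P J"
begin

lemma ideal_zero: "0 \<in> J" and ideal_add: "x \<in> J \<Longrightarrow> y \<in> J \<Longrightarrow> x + y \<in> J"
  and ideal_mult: "a \<in> P \<Longrightarrow> x \<in> J \<Longrightarrow> a * x \<in> J"
  using J unfolding is_ideal_def by auto

lemma ideal_mult_right: "x \<in> J \<Longrightarrow> a \<in> P \<Longrightarrow> x * a \<in> J"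
  using ideal_mult[of a x] by (simp add: mult.commute)

lemma ideal_uminus: "x \<in> J \<Longrightarrow> - x \<in> J"
  using ideal_mult[OF subring_uminus[OF P subring_one[OF P]], of x] by simp

lemma ideal_diff: "x \<in> J \<Longrightarrow> y \<in> J \<Longrightarrow> x - y \<in> J"
  using ideal_add[OF _ ideal_uminus, of x y] by simp

lemma ideal_sum: "(\<And>i. i \<in> I \<Longrightarrow> f i \<in> J) \<Longrightarrow> sum f I \<in> J"
  by (induction I rule: infinite_finite_induct) (auto intro: ideal_zero ideal_add)

lemma ideal_trans: "x - y \<in> J \<Longrightarrow> y - z \<in> J \<Longrightarrow> x - z \<in> J"
  using ideal_add[of "x - y" "y - z"] by simp

lemma ideal_cong_diff: "x - x' \<in> J \<Longrightarrow> y - y' \<in> J \<Longrightarrow> (x - y) - (x' - y') \<in> J"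
  using ideal_diff[of "x - x'" "y - y'"] by (simp add: algebra_simps)

lemma ideal_cong_add: "x - x' \<in> J \<Longrightarrow> y - y' \<in> J \<Longrightarrow> (x + y) - (x' + y') \<in> J"
  using ideal_add[of "x - x'" "y - y'"] by (simp add: algebra_simps)

lemma ideal_cong_mult:
  assumes "x - x' \<in> J" "y - y' \<in> J" "x \<in> P" "y' \<in> P"
  shows "x * y - x' * y' \<in> J"
proof -
  have "x * (y - y') + y' * (x - x') \<in> J"
    by (intro ideal_add ideal_mult assms)
  thus ?thesis by (simp add: algebra_simps)
qed

lemma ideal_cong_sum: "(\<And>i. i \<in> I \<Longrightarrow> f i - g i \<in> J) \<Longrightarrow> sum f I - sum g I \<in> J"
  using ideal_sum[of I "\<lambda>i. f i - g i"] by (simp add: sum_subtractf)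

end

section \<open>The Artin basis\<close>

text \<open>
  The monomials with exponents in \<open>artin n\<close> are a basis of the universal splitting algebra of a monic
  polynomial of degree \<open>n\<close>.
\<close>

fun artin :: "nat \<Rightarrow> nat list set" where
  "artin 0 = {[]}"
| "artin (Suc r) = (\<lambda>(k, ms). k # ms) ` ({..r} \<times> artin r)"

fun monval :: "nat list \<Rightarrow> 'r::comm_ring_1 list \<Rightarrow> 'r" where
  "monval (k # ms) (y # ys) = y ^ k * monval ms ys"
| "monval _ _ = 1"

lemma finite_artin [simp]: "finite (artin r)"
  by (induction r) auto

lemma sum_artin_Suc: "(\<Sum>ms\<in>artin (Suc r). f ms) = (\<Sum>ms\<in>artin r. \<Sum>k\<le>r. f (k # ms))"
proof -
  have "(\<Sum>ms\<in>artin (Suc r). f ms) = (\<Sum>(k, ms)\<in>{..r} \<times> artin r. f (k # ms))"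
    by (simp, subst sum.reindex) (auto simp: inj_on_def case_prod_unfold)
  also have "\<dots> = (\<Sum>k\<le>r. \<Sum>ms\<in>artin r. f (k # ms))"
    by (simp add: sum.cartesian_product)
  also have "\<dots> = (\<Sum>ms\<in>artin r. \<Sum>k\<le>r. f (k # ms))"
    by (rule sum.swap)
  finally show ?thesis .
qed

lemma mon_in_subring: "is_subring R \<Longrightarrow> set ys \<subseteq> R \<Longrightarrow> monval ms ys \<in> R"
  by (induction ms ys rule: monval.induct) (auto intro: subring_intros)

definition root_prod :: "'r::comm_ring_1 list \<Rightarrow> 'r poly" where
  "root_prod ys = (\<Prod>y\<leftarrow>ys. [:- y, 1:])"

lemma root_prod_Nil [simp]: "root_prod [] = 1"
  and root_prod_Cons: "root_prod (y # ys) = [:- y, 1:] * root_prod ys"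
  by (simp_all add: root_prod_def)

lemma degree_root_prod: "degree (root_prod ys) \<le> length ys"
  and coeff_root_prod_length: "coeff (root_prod ys) (length ys) = 1"
proof (induction ys)
  case (Cons y ys)
  { case 1
    show ?case using order.trans[OF degree_mult_le, of "[:-y,1:]" "root_prod ys" "Suc (length ys)"] Cons(1)
      by (simp add: degree_pCons_eq_if root_prod_Cons)
  next
    case 2
    show ?case using Cons by (simp add: coeff_pCons coeff_eq_0 root_prod_Cons)
  }
qed auto

lemma degree_root_prod_eq: "degree (root_prod ys) = length ys"
  using degree_root_prod[of ys] coeff_root_prod_length[of ys] by (intro antisym le_degree) simp_all

lemma poly_root_prod_eq_0: "y \<in> set ys \<Longrightarrow> poly (root_prod ys) y = 0"
  by (induction ys) (auto simp: root_prod_Cons)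

text \<open>Division by \<open>Y - y\<close> computes the coefficients of the quotient from
  \<open>y\<close> and those of the product, starting at the top. Thus once the first root is
  adjoined to the coefficient ring, the remaining roots again belong to a polynomial over that ring,
  as an induction on the list of roots requires.\<close>

lemma root_prod_tail_coeff:
  assumes P: "is_subring P" and J: "is_ideal P J" and R: "is_subring R" "R \<subseteq> P"
    and y: "y \<in> R" and ys: "set ys \<subseteq> P"
    and c: "\<And>k. \<exists>g\<in>R. coeff (root_prod (y # ys)) k - g \<in> J"
  shows "\<exists>g\<in>R. coeff (root_prod ys) k - g \<in> J"
proof (induction "Suc (length ys) - k" arbitrary: k rule: less_induct)
  case less
  show ?case
  proof (cases "k > length ys")
    case True
    hence "coeff (root_prod ys) k = 0"
      using degree_root_prod[of ys] by (intro coeff_eq_0) simp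
    thus ?thesis using subring_zero[OF R(1)] ideal_zero[OF P J]
      by (intro bexI[of _ 0]) simp_all
  next
    case False
    have "Suc (length ys) - Suc k < Suc (length ys) - k" using False by simp
    from less[OF this] obtain g where g: "g \<in> R" "coeff (root_prod ys) (Suc k) - g \<in> J"
      by auto
    from c obtain h where h: "h \<in> R" "coeff (root_prod (y # ys)) (Suc k) - h \<in> J" by auto
    have eq: "coeff (root_prod ys) k = coeff (root_prod (y # ys)) (Suc k) + y * coeff (root_prod ys) (Suc k)"
      by (simp add: root_prod_Cons)
    have "y * coeff (root_prod ys) (Suc k) - y * g \<in> J"
      using ideal_mult[OF P J, of y, OF _ g(2)] y R by (auto simp: algebra_simps)
    hence "coeff (root_prod ys) k - (h + y * g) \<in> J"
      unfolding eq using h by (intro ideal_cong_add[OF P J]) auto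
    moreover have "h + y * g \<in> R" using h g y by (auto intro: subring_intros[OF R(1)])
    ultimately show ?thesis by blast
  qed
qed

lemma one_variable_reduction:
  assumes P: "is_subring P" and J: "is_ideal P J" and R: "is_subring R" "R \<subseteq> P"
    and y: "y \<in> P" and a: "\<And>k. a k \<in> R" and rel: "y ^ Suc r - (\<Sum>k\<le>r. a k * y ^ k) \<in> J"
    and f: "f \<in> rgen (insert y R)"
  shows "\<exists>c. (\<forall>k. c k \<in> R) \<and> f - (\<Sum>k\<le>r. c k * y ^ k) \<in> J"
proof -
  note PI = subring_intros[OF P] and RI = subring_intros[OF R(1)]
  \<comment> \<open>\<open>T\<close> consists of the elements with a normal form. It is shown to be
    a subring; closure under products comes down to multiplication by \<open>y\<close>, where only
    the new top power \<open>y ^ Suc r\<close> calls for the relation \<open>rel\<close>.\<close>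
  define T where "T = {x \<in> P. \<exists>c. (\<forall>k. c k \<in> R) \<and> x - (\<Sum>k\<le>r. c k * y ^ k) \<in> J}"
  have TI: "x \<in> T" if "x \<in> P" "\<And>k. c k \<in> R" "x - (\<Sum>k\<le>r. c k * y ^ k) \<in> J" for x c
    using that unfolding T_def by blast
  have Rmult: "b * x \<in> T" if "b \<in> R" "x \<in> T" for b x
  proof -
    from that obtain c where c: "x \<in> P" "\<And>k. c k \<in> R" "x - (\<Sum>k\<le>r. c k * y ^ k) \<in> J"
      unfolding T_def by blast
    have "b * x - (\<Sum>k\<le>r. (b * c k) * y ^ k) = b * (x - (\<Sum>k\<le>r. c k * y ^ k))"
      by (simp add: right_diff_distrib sum_distrib_left mult.assoc)
    also have "\<dots> \<in> J" using ideal_mult[OF P J _ c(3)] that R by auto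
    finally show ?thesis
      using that c R by (intro TI[where c = "\<lambda>k. b * c k"]) (auto intro!: RI PI)
  qed
  have Tdiff: "x - z \<in> T" if "x \<in> T" "z \<in> T" for x z
  proof -
    from that obtain c where c: "x \<in> P" "\<And>k. c k \<in> R" "x - (\<Sum>k\<le>r. c k * y ^ k) \<in> J"
      unfolding T_def by blast
    from that obtain d where d: "z \<in> P" "\<And>k. d k \<in> R" "z - (\<Sum>k\<le>r. d k * y ^ k) \<in> J"
      unfolding T_def by blast
    have "x - z - (\<Sum>k\<le>r. (c k - d k) * y ^ k) \<in> J"
      using ideal_cong_diff[OF P J c(3) d(3)] by (simp add: left_diff_distrib sum_subtractf)
    thus ?thesis
      using c d by (intro TI[where c = "\<lambda>k. c k - d k"]) (auto intro!: RI PI)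
  qed
  have T0: "x \<in> T" if "x \<in> J" "x \<in> P" for x
    using that by (intro TI[where c = "\<lambda>k. 0"]) (auto intro: RI)
  have Tadd: "x + z \<in> T" if "x \<in> T" "z \<in> T" for x z
    using Tdiff[OF that(1) Tdiff[OF T0[OF ideal_zero[OF P J] subring_zero[OF P]] that(2)]] by simp
  have Tpow: "y ^ k \<in> T" if "k \<le> r" for k
  proof (rule TI[where c = "\<lambda>j. if j = k then 1 else 0"])
    show "y ^ k - (\<Sum>ka\<le>r. (if ka = k then 1 else 0) * y ^ ka) \<in> J"
      using that ideal_zero[OF P J] by (simp add: if_distrib[of "\<lambda>c. c * _"] cong: if_cong)
  qed (auto intro: RI PI y)
  have Tsum: "(\<Sum>k\<in>I. g k) \<in> T" if "\<And>k. k \<in> I \<Longrightarrow> g k \<in> T" for g :: "nat \<Rightarrow> 'a" and I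
    using that by (induction I rule: infinite_finite_induct)
      (auto intro: Tadd T0 ideal_zero[OF P J] subring_zero[OF P])
  have TJ: "x \<in> T" if "x - z \<in> J" "z \<in> T" "x \<in> P" for x z
    using Tadd[OF that(2) T0[OF that(1)]] that T_def PI by auto
  have Ty: "y * x \<in> T" if "x \<in> T" for x
  proof -
    from that obtain c where c: "x \<in> P" "\<And>k. c k \<in> R" "x - (\<Sum>k\<le>r. c k * y ^ k) \<in> J"
      unfolding T_def by blast
    have top: "y ^ Suc r \<in> T"
      by (rule TI[where c = a]) (use a rel y in \<open>auto intro!: PI simp del: power_Suc\<close>)
    have "y ^ Suc k \<in> T" if "k \<le> r" for k
      using Tpow[of "Suc k"] top that by (cases "k = r") (auto simp del: power_Suc)
    hence "(\<Sum>k\<le>r. c k * y ^ Suc k) \<in> T"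
      by (intro Tsum Rmult) (auto simp: c)
    moreover have "y * x - (\<Sum>k\<le>r. c k * y ^ Suc k) \<in> J"
      using ideal_mult[OF P J y c(3)] by (simp add: right_diff_distrib sum_distrib_left mult_ac)
    ultimately show ?thesis using TJ c y by (blast intro: PI)
  qed
  have Typow: "y ^ k * x \<in> T" if "x \<in> T" for x k
    using that by (induction k) (auto simp: mult.assoc intro: Ty)
  have Tmult: "x * z \<in> T" if "x \<in> T" "z \<in> T" for x z
  proof -
    from that obtain c where c: "x \<in> P" "\<And>k. c k \<in> R" "x - (\<Sum>k\<le>r. c k * y ^ k) \<in> J"
      unfolding T_def by blast
    have zP: "z \<in> P" using that T_def by simp
    have "(\<Sum>k\<le>r. c k * (y ^ k * z)) \<in> T"
      by (intro Tsum Rmult Typow that c)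
    moreover have "x * z - (\<Sum>k\<le>r. c k * (y ^ k * z)) \<in> J"
      using ideal_mult[OF P J zP c(3)] by (simp add: right_diff_distrib sum_distrib_left mult_ac)
    ultimately show ?thesis using TJ c zP by (blast intro: PI)
  qed
  have T1: "1 \<in> T" using Tpow[of 0] by simp
  have "f \<in> T" using f
  proof induction
    case (base x)
    then consider "x = y" | "x \<in> R" by auto
    thus ?case using Ty[OF T1] Rmult[OF _ T1] by cases auto
  qed (auto intro: T1 Tdiff Tmult)
  thus ?thesis by (simp add: T_def)
qed

text \<open>Spanning half of the Artin basis. With \<open>y\<close> adjoined to \<open>R\<close>,
  the induction hypothesis reduces the tail. Its coefficients lie in \<open>R[y]\<close> and are
  then brought to degree at most \<open>r\<close> in \<open>y\<close>, because \<open>y\<close> is a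
  root of the full monic product of degree \<open>r + 1\<close>, whose coefficients are in
  \<open>R\<close> modulo \<open>J\<close>.\<close>

theorem artin_reduction:
  assumes P: "is_subring P" and J: "is_ideal P J" and R: "is_subring R" "R \<subseteq> P"
    and ys: "set ys \<subseteq> P"
    and c: "\<And>k. \<exists>g\<in>R. coeff (root_prod ys) k - g \<in> J"
    and f: "f \<in> rgen (R \<union> set ys)"
  shows "\<exists>c. (\<forall>ms. c ms \<in> R) \<and> f - (\<Sum>ms\<in>artin (length ys). c ms * monval ms ys) \<in> J"
  using R ys c f
proof (induction ys arbitrary: R f)
  case Nil
  hence "f \<in> R" using rgen_least[OF Nil(1), of R] by auto
  thus ?case using ideal_zero[OF P J] by (intro exI[of _ "\<lambda>_. f"]) simp
next
  case (Cons y ys)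
  define r where "r = length ys"
  define R' where "R' = rgen (insert y R)"
  note R = Cons.prems(1,2)
  have yP: "y \<in> P" "set ys \<subseteq> P" using Cons.prems by auto
  have R': "is_subring R'" "R' \<subseteq> P"
    unfolding R'_def using rgen_least[OF P, of "insert y R"] R yP by (auto intro: subring_rgen)
  have RR': "R \<subseteq> R'" "y \<in> R'" unfolding R'_def by (auto intro: rgen.base)
  have "\<exists>c. (\<forall>ms. c ms \<in> R') \<and> f - (\<Sum>ms\<in>artin (length ys). c ms * monval ms ys) \<in> J"
  proof (rule Cons.IH[OF R' yP(2)])
    show "\<exists>g\<in>R'. coeff (root_prod ys) k - g \<in> J" for k
      using RR' Cons.prems(4) by (intro root_prod_tail_coeff[OF P J R' _ yP(2), of y]) blast+
    have "rgen (R \<union> set (y # ys)) \<subseteq> rgen (R' \<union> set ys)"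
      using RR' by (intro rgen_mono) auto
    thus "f \<in> rgen (R' \<union> set ys)" using Cons.prems by auto
  qed
  then obtain c where c: "\<And>ms. c ms \<in> R'" "f - (\<Sum>ms\<in>artin r. c ms * monval ms ys) \<in> J"
    unfolding r_def by auto
  obtain g where g: "\<And>k. g k \<in> R" "\<And>k. coeff (root_prod (y # ys)) k - g k \<in> J"
    using Cons.prems(4) by metis
  have deg: "degree (root_prod (y # ys)) = Suc r"
    by (simp add: degree_root_prod_eq r_def)
  have "(\<Sum>k\<le>Suc r. coeff (root_prod (y # ys)) k * y ^ k) = 0"
    using poly_root_prod_eq_0[of y "y # ys"] poly_altdef[of "root_prod (y # ys)" y] deg by simp
  hence *: "y ^ Suc r = - (\<Sum>k\<le>r. coeff (root_prod (y # ys)) k * y ^ k)"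
    using coeff_root_prod_length[of "y # ys"]
    by (simp add: r_def eq_neg_iff_add_eq_0 add.commute del: power_Suc)
  have "(\<Sum>k\<le>r. (- coeff (root_prod (y # ys)) k) * y ^ k - (- g k) * y ^ k) \<in> J"
  proof (rule ideal_sum[OF P J])
    fix k
    have "(- (y ^ k)) * (coeff (root_prod (y # ys)) k - g k) \<in> J"
      by (intro ideal_mult[OF P J] g subring_intros[OF P] yP)
    thus "(- coeff (root_prod (y # ys)) k) * y ^ k - (- g k) * y ^ k \<in> J"
      by (simp add: algebra_simps)
  qed
  hence rel: "y ^ Suc r - (\<Sum>k\<le>r. - g k * y ^ k) \<in> J"
    unfolding * by (simp only: sum_subtractf mult_minus_left sum_negf)
  have "\<exists>d. (\<forall>k. d k \<in> R) \<and> c ms - (\<Sum>k\<le>r. d k * y ^ k) \<in> J" for ms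
    by (rule one_variable_reduction[OF P J R yP(1) _ rel])
       (use g c in \<open>auto intro: subring_intros[OF R(1)] simp: R'_def\<close>)
  then obtain d where d: "\<And>ms k. d ms k \<in> R" "\<And>ms. c ms - (\<Sum>k\<le>r. d ms k * y ^ k) \<in> J"
    by metis
  have "(\<Sum>ms\<in>artin r. c ms * monval ms ys) - (\<Sum>ms\<in>artin r. (\<Sum>k\<le>r. d ms k * y ^ k) * monval ms ys) \<in> J"
  proof (rule ideal_cong_sum[OF P J])
    fix ms
    show "c ms * monval ms ys - (\<Sum>k\<le>r. d ms k * y ^ k) * monval ms ys \<in> J"
      using ideal_mult_right[OF P J d(2) mon_in_subring[OF P yP(2)]]
      by (simp add: left_diff_distrib)
  qed
  from ideal_trans[OF P J c(2) this]
  have "f - (\<Sum>ms\<in>artin r. (\<Sum>k\<le>r. d ms k * y ^ k) * monval ms ys) \<in> J" .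
  also have "(\<Sum>ms\<in>artin r. (\<Sum>k\<le>r. d ms k * y ^ k) * monval ms ys) =
     (\<Sum>ms\<in>artin (length (y # ys)). d (tl ms) (hd ms) * monval ms (y # ys))"
    by (simp only: length_Cons sum_artin_Suc r_def) (simp add: sum_distrib_right mult.assoc)
  finally show ?case using d by (intro exI[of _ "\<lambda>ms. d (tl ms) (hd ms)"]) simp
qed

text \<open>Independence half. Fix \<open>b\<close> as the first entry and vary the ordering of the
  others: by induction each coefficient of the tail vanishes, and this coefficient is a polynomial
  in \<open>b\<close> of degree at most \<open>r\<close> with the \<open>r + 1\<close> distinct
  roots in \<open>as\<close>.\<close>

lemma artin_unique:
  fixes c :: "nat list \<Rightarrow> 'a::field"
  assumes "distinct as"
    and "\<And>bs. mset bs = mset as \<Longrightarrow> (\<Sum>ms\<in>artin (length as). c ms * monval ms bs) = 0"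
    and "ms \<in> artin (length as)"
  shows "c ms = 0"
  using assms
proof (induction "length as" arbitrary: as c ms)
  case 0
  thus ?case using "0.prems"(2)[of "[]"] by simp
next
  case (Suc r)
  have len: "length as = Suc r" using Suc.hyps(2) by simp
  have root: "poly (\<Sum>k\<le>r. monom (c (k # ns)) k) b = 0" if b: "b \<in> set as" and ns: "ns \<in> artin r" for b ns
  proof -
    have l: "length (remove1 b as) = r" using b len by (simp add: length_remove1)
    have "(\<Sum>k\<le>r. c (k # ns) * b ^ k) = 0"
    proof (rule Suc.hyps(1)[of "remove1 b as" "\<lambda>ns. \<Sum>k\<le>r. c (k # ns) * b ^ k"])
      show "distinct (remove1 b as)" using Suc.prems(1) by simp
      fix bs assume "mset bs = mset (remove1 b as)"
      hence "mset (b # bs) = mset as" using b by simp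
      from Suc.prems(2)[OF this]
      have "(\<Sum>ms\<in>artin (Suc r). c ms * monval ms (b # bs)) = 0" by (simp only: len)
      thus "(\<Sum>ms\<in>artin (length (remove1 b as)). (\<Sum>k\<le>r. c (k # ms) * b ^ k) * monval ms bs) = 0"
        by (simp only: sum_artin_Suc l) (simp add: sum_distrib_right mult.assoc)
    next
      show "ns \<in> artin (length (remove1 b as))" using l ns by simp
    qed (simp add: l)
    thus ?thesis by (simp add: poly_sum poly_monom)
  qed
  have "ms \<in> artin (Suc r)" using Suc.prems(3) len by simp
  then obtain k ns where ms: "ms = k # ns" "k \<le> r" "ns \<in> artin r" by auto
  define p where "p = (\<Sum>k\<le>r. monom (c (k # ns)) k)"
  have "p = 0"
  proof (rule ccontr)
    assume p: "p \<noteq> 0"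
    have "set as \<subseteq> {x. poly p x = 0}"
      using root[OF _ ms(3)] unfolding p_def by blast
    hence "card (set as) \<le> card {x. poly p x = 0}"
      by (intro card_mono poly_roots_finite[OF p])
    also have "\<dots> \<le> degree p" using p by (rule card_poly_roots_bound)
    also have "\<dots> \<le> r" unfolding p_def
      by (intro degree_sum_le) (simp_all add: order.trans[OF degree_monom_le])
    finally have "card (set as) \<le> r" .
    thus False using distinct_card[OF Suc.prems(1)] len by simp
  qed
  moreover have "coeff p k = c ms"
    using ms unfolding p_def by (simp add: coeff_sum)
  ultimately show ?case by (metis coeff_0)
qed

section \<open>One-parameter families of polynomials and their ordered roots\<close>

lemma infinite_UNIV_alg_closed: "infinite (UNIV :: 'a::alg_closed_field set)"
proof
  assume fin: "finite (UNIV :: 'a set)"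
  define p where "p = (\<Prod>a\<in>(UNIV::'a set). [:- a, 1:]) + 1"
  have "degree (\<Prod>a\<in>(UNIV::'a set). [:- a, 1:]) = card (UNIV :: 'a set)"
    by (subst degree_prod_sum_eq) auto
  moreover have "card (UNIV :: 'a set) > 0" using fin by (simp add: card_gt_0_iff)
  ultimately have "degree p > 0"
    unfolding p_def by (subst degree_add_eq_left) auto
  then obtain x where "poly p x = 0" using alg_closed_imp_poly_has_root by blast
  moreover have "poly (\<Prod>a\<in>(UNIV::'a set). [:- a, 1:]) x = 0"
    using fin by (simp add: poly_prod)
  ultimately show False by (simp add: p_def)
qed

lemma poly_eq_0_if_cofinite_roots:
  fixes p :: "'a::alg_closed_field poly"
  assumes "finite S" "\<And>s. s \<notin> S \<Longrightarrow> poly p s = 0"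
  shows "p = 0"
proof (rule ccontr)
  assume "p \<noteq> 0"
  hence "finite ({x. poly p x = 0} \<union> S)" using poly_roots_finite assms by blast
  moreover have "{x. poly p x = 0} \<union> S = UNIV" using assms by blast
  ultimately show False using infinite_UNIV_alg_closed by metis
qed

lemma root_prod_mset_cong: "mset xs = mset ys \<Longrightarrow> root_prod xs = root_prod ys"
  unfolding root_prod_def by (metis mset_map prod_mset_prod_list)

lemma root_prod_exists:
  fixes p :: "'a::alg_closed_field poly"
  assumes "degree p = n" "lead_coeff p = 1"
  shows "\<exists>ys. length ys = n \<and> root_prod ys = p"
  using assms
proof (induction n arbitrary: p)
  case 0
  then obtain c where "p = [:c:]" using degree_eq_zeroE by blast
  thus ?case using 0 by (intro exI[of _ "[]"]) simp
next
  case (Suc n)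
  then obtain x where "poly p x = 0" using alg_closed_imp_poly_has_root[of p] by auto
  then obtain q where q: "p = [:- x, 1:] * q" by (meson dvdE poly_eq_0_iff_dvd)
  have q0: "q \<noteq> 0" using Suc q by auto
  have "degree p = 1 + degree q" unfolding q using q0
    by (subst degree_mult_eq) auto
  moreover have "lead_coeff p = lead_coeff q" unfolding q lead_coeff_mult by simp
  ultimately obtain ys where "length ys = n" "root_prod ys = q"
    using Suc.IH[of q] Suc.prems by auto
  thus ?case using q by (intro exI[of _ "x # ys"]) (simp add: root_prod_Cons)
qed

lemma coeff_root_prod_apply:
  fixes fs :: "('w \<Rightarrow> 'r::comm_ring_1) list"
  shows "coeff (root_prod fs) k w = coeff (root_prod (map (\<lambda>f. f w) fs)) k"
proof (induction fs arbitrary: k)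
  case Nil
  thus ?case by (cases k) simp_all
next
  case (Cons f fs)
  show ?case by (cases k) (simp_all add: root_prod_Cons Cons)
qed

lemma root_prod_inj_distinct:
  fixes xs ys :: "'a::idom list"
  assumes "root_prod xs = root_prod ys" "distinct xs" "distinct ys"
  shows "mset xs = mset ys"
proof -
  have *: "set xs = {x. poly (root_prod xs) x = 0}" for xs :: "'a list"
    by (induction xs) (auto simp: root_prod_Cons)
  have "set xs = set ys" by (subst (1 2) *) (simp add: assms(1))
  thus ?thesis using assms by (simp add: set_eq_iff_mset_eq_distinct)
qed

text \<open>The points \<open>w = (s, y)\<close> consist of a parameter \<open>s\<close> and the coordinates \<open>y\<^sub>0, y\<^sub>1, \<dots>\<close>.\<close>

definition polyfuns :: "nat \<Rightarrow> ('a::comm_ring_1 \<times> (nat \<Rightarrow> 'a) \<Rightarrow> 'a) set" where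
  "polyfuns n = rgen (range (\<lambda>c _. c) \<union> {fst} \<union> (\<lambda>i w. snd w i) ` {..<n})"

lemma subring_polyfuns: "is_subring (polyfuns n)"
  unfolding polyfuns_def by (rule subring_rgen)

lemmas polyfuns_ring = subring_intros[OF subring_polyfuns]

lemma polyfuns_const: "(\<lambda>_. c) \<in> polyfuns n"
  and polyfuns_fst: "fst \<in> polyfuns n"
  and polyfuns_coord: "i < n \<Longrightarrow> (\<lambda>w. snd w i) \<in> polyfuns n"
  unfolding polyfuns_def by (auto intro!: rgen.base)

lemma polyfuns_diff_fun: "f \<in> polyfuns n \<Longrightarrow> g \<in> polyfuns n \<Longrightarrow> (\<lambda>w. f w - g w) \<in> polyfuns n"
  and polyfuns_add_fun: "f \<in> polyfuns n \<Longrightarrow> g \<in> polyfuns n \<Longrightarrow> (\<lambda>w. f w + g w) \<in> polyfuns n"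
  and polyfuns_mult_fun: "f \<in> polyfuns n \<Longrightarrow> g \<in> polyfuns n \<Longrightarrow> (\<lambda>w. f w * g w) \<in> polyfuns n"
  using polyfuns_ring(3,4,6)[of f n g] by (simp_all add: fun_diff_def plus_fun_def times_fun_def)

lemma polyfuns_uminus_fun: "f \<in> polyfuns n \<Longrightarrow> (\<lambda>w. - f w) \<in> polyfuns n"
  using polyfuns_diff_fun[OF polyfuns_const[of 0]] by simp

lemma polyfuns_sum_fun: "(\<And>i. i \<in> I \<Longrightarrow> f i \<in> polyfuns n) \<Longrightarrow> (\<lambda>w. \<Sum>i\<in>I. f i w) \<in> polyfuns n"
  by (induction I rule: infinite_finite_induct) (auto intro: polyfuns_const polyfuns_add_fun)

lemma polyfuns_prod_fun: "(\<And>i. i \<in> I \<Longrightarrow> f i \<in> polyfuns n) \<Longrightarrow> (\<lambda>w. \<Prod>i\<in>I. f i w) \<in> polyfuns n"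
  by (induction I rule: infinite_finite_induct) (auto intro: polyfuns_const polyfuns_mult_fun)

lemma polyfuns_power_fun: "f \<in> polyfuns n \<Longrightarrow> (\<lambda>w. f w ^ k) \<in> polyfuns n"
  by (induction k) (auto intro: polyfuns_const polyfuns_mult_fun)

lemma polyfuns_poly_fun: "f \<in> polyfuns n \<Longrightarrow> (\<lambda>w. poly q (f w)) \<in> polyfuns n"
  by (simp add: poly_altdef) (auto intro!: polyfuns_sum_fun polyfuns_mult_fun polyfuns_const polyfuns_power_fun)

lemma polyfuns_monval_fun:
  "(\<And>i. i \<in> set is \<Longrightarrow> i < n) \<Longrightarrow>
    (\<lambda>w :: 'a::comm_ring_1 \<times> (nat \<Rightarrow> 'a). monval ms (map (snd w) is)) \<in> polyfuns n"
proof (induction ms arbitrary: "is")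
  case (Cons k ms js)
  show ?case
  proof (cases js)
    case js: (Cons i "is")
    have "(\<lambda>w :: 'a \<times> (nat \<Rightarrow> 'a). snd w i ^ k * monval ms (map (snd w) is)) \<in> polyfuns n"
      using js Cons.prems Cons.IH[of "is"] by (intro polyfuns_mult_fun polyfuns_power_fun polyfuns_coord) auto
    thus ?thesis by (simp add: js)
  qed (auto intro: polyfuns_const)
qed (auto intro: polyfuns_const)

lemmas polyfuns_intros = polyfuns_const polyfuns_fst polyfuns_coord polyfuns_diff_fun polyfuns_add_fun
  polyfuns_mult_fun polyfuns_uminus_fun polyfuns_sum_fun polyfuns_prod_fun polyfuns_power_fun polyfuns_poly_fun
  polyfuns_monval_fun

lemma polyfuns_induct [consumes 1, case_names const param coord diff mult]:
  assumes "f \<in> polyfuns n"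
    and "\<And>c. Q (\<lambda>_. c)" "Q fst" "\<And>i. i < n \<Longrightarrow> Q (\<lambda>w. snd w i)"
    and "\<And>f g. f \<in> polyfuns n \<Longrightarrow> g \<in> polyfuns n \<Longrightarrow> Q f \<Longrightarrow> Q g \<Longrightarrow> Q (\<lambda>w. f w - g w)"
    and "\<And>f g. f \<in> polyfuns n \<Longrightarrow> g \<in> polyfuns n \<Longrightarrow> Q f \<Longrightarrow> Q g \<Longrightarrow> Q (\<lambda>w. f w * g w)"
  shows "Q f"
  using assms(1) unfolding polyfuns_def
proof induction
  case one
  show ?case using assms(2)[of 1] by (simp add: one_fun_def)
next
  case (diff f g)
  thus ?case using assms(5)[of f g] by (simp add: polyfuns_def fun_diff_def)
next
  case (mult f g)
  thus ?case using assms(6)[of f g] by (simp add: polyfuns_def times_fun_def)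
qed (use assms in auto)

lemma polyfuns_mono: "m \<le> n \<Longrightarrow> polyfuns m \<subseteq> polyfuns n"
  unfolding polyfuns_def by (rule rgen_mono) auto

lemma polyfuns_0: "f \<in> polyfuns 0 \<Longrightarrow> \<exists>q. \<forall>w. f w = poly q (fst w)"
proof (induction rule: polyfuns_induct)
  case (const c)
  show ?case by (intro exI[of _ "[:c:]"]) simp
next
  case param
  show ?case by (intro exI[of _ "[:0, 1:]"]) simp
next
  case (diff f g)
  then obtain p q where "\<forall>w. f w = poly p (fst w)" "\<forall>w. g w = poly q (fst w)" by blast
  thus ?case by (intro exI[of _ "p - q"]) simp
next
  case (mult f g)
  then obtain p q where "\<forall>w. f w = poly p (fst w)" "\<forall>w. g w = poly q (fst w)" by blast
  thus ?case by (intro exI[of _ "p * q"]) simp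
qed auto

lemma polyfuns_split: "j \<le> n \<Longrightarrow> polyfuns n = rgen (polyfuns j \<union> set (map (\<lambda>i w. snd w i) [j..<n]))"
proof (rule antisym)
  assume "j \<le> n"
  show "polyfuns n \<subseteq> rgen (polyfuns j \<union> set (map (\<lambda>i w. snd w i) [j..<n]))"
    unfolding polyfuns_def[of n]
  proof (rule rgen_trans, safe)
    fix i assume "i < n"
    show "(\<lambda>w. snd w i) \<in> rgen (polyfuns j \<union> set (map (\<lambda>i w. snd w i) [j..<n]))"
      by (rule rgen.base) (use \<open>i < n\<close> polyfuns_coord[of i j] in \<open>cases "i < j"; auto\<close>)
  qed (auto intro!: rgen.base intro: polyfuns_const polyfuns_fst)
  show "rgen (polyfuns j \<union> set (map (\<lambda>i w. snd w i) [j..<n])) \<subseteq> polyfuns n"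
    using polyfuns_mono[OF \<open>j \<le> n\<close>] by (intro rgen_least subring_polyfuns) (auto intro: polyfuns_coord)
qed

text \<open>There are two instances, \<open>M - s\<close> and its rescaling near infinity. Finitely
  many inseparable members are allowed; identities are proved away from them and then
  extended.\<close>

locale root_family =
  fixes n :: nat and P :: "'a::alg_closed_field \<Rightarrow> 'a poly"
  assumes degree_P: "degree (P s) = n" and lead_coeff_P: "lead_coeff (P s) = 1"
    and coeff_P: "\<exists>q. \<forall>s. coeff (P s) k = poly q s"
    and separable_P: "finite {s. \<exists>ys. root_prod ys = P s \<and> \<not> distinct ys}"
begin

text \<open>Roots are listed with multiplicity. Coordinates from index \<open>n\<close> on are left
  free, as functions in \<open>polyfuns n\<close> do not see them.\<close>

definition fib :: "'a \<Rightarrow> (nat \<Rightarrow> 'a) set" where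
  "fib s = {y. root_prod (map y [0..<n]) = P s}"

lemma fib_listI:
  assumes "root_prod ys = P s" "length ys = n"
  shows "(\<lambda>i. if i < n then ys ! i else 0) \<in> fib s"
    and "map (\<lambda>i. if i < n then ys ! i else 0) [0..<n] = ys"
proof -
  show *: "map (\<lambda>i. if i < n then ys ! i else 0) [0..<n] = ys"
    using assms by (intro nth_equalityI) auto
  show "(\<lambda>i. if i < n then ys ! i else 0) \<in> fib s" unfolding fib_def mem_Collect_eq * by fact
qed

lemma fib_nonempty: "\<exists>y. y \<in> fib s"
  using root_prod_exists[OF degree_P lead_coeff_P] fib_listI by blast

lemma fib_permute:
  assumes "\<sigma> permutes {..<n}" "y \<in> fib s"
  shows "y \<circ> \<sigma> \<in> fib s"
proof -
  have "mset [0..<n] = mset_set {..<n}" by (simp add: lessThan_atLeast0)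
  moreover have "image_mset \<sigma> (mset_set {..<n}) = mset_set {..<n}"
    using assms(1) by (subst image_mset_mset_set) (auto simp: permutes_inj_on permutes_image)
  ultimately have "mset (map (y \<circ> \<sigma>) [0..<n]) = mset (map y [0..<n])"
    by (metis image_mset.comp mset_map comp_apply)
  from root_prod_mset_cong[OF this] assms(2) show ?thesis by (simp add: fib_def)
qed

lemma tail_coeff:
  assumes "j \<le> n"
  shows "\<exists>g\<in>polyfuns j. coeff (root_prod (map (\<lambda>i w. snd w i) [j..<n])) k - g \<in> {f. \<forall>s. \<forall>y\<in>fib s. f (s, y) = 0}"
  using assms
proof (induction j arbitrary: k)
  case 0
  obtain q where q: "\<And>s. coeff (P s) k = poly q s" using coeff_P by blast
  have "(\<lambda>w. poly q (fst w)) \<in> polyfuns 0" by (intro polyfuns_intros)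
  moreover have "coeff (root_prod (map (\<lambda>i w. snd w i) [0..<n])) k - (\<lambda>w. poly q (fst w))
     \<in> {f. \<forall>s. \<forall>y\<in>fib s. f (s, y) = 0}"
    by (auto simp: coeff_root_prod_apply o_def fib_def q)
  ultimately show ?case by blast
next
  case (Suc j)
  have upt: "[j..<n] = j # [Suc j..<n]" using Suc.prems by (simp add: upt_conv_Cons)
  show ?case
  proof (rule root_prod_tail_coeff[where P = UNIV and y = "\<lambda>w. snd w j"])
    show "is_ideal UNIV {f. \<forall>s. \<forall>y\<in>fib s. f (s, y) = 0}" by (auto simp: is_ideal_def)
    fix k
    obtain g where g: "g \<in> polyfuns j"
      "coeff (root_prod (map (\<lambda>i w. snd w i) [j..<n])) k - g \<in> {f. \<forall>s. \<forall>y\<in>fib s. f (s, y) = 0}"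
      using Suc.IH[of k] Suc.prems by auto
    show "\<exists>g\<in>polyfuns (Suc j). coeff (root_prod ((\<lambda>w. snd w j) # map (\<lambda>i w. snd w i) [Suc j..<n])) k - g
        \<in> {f. \<forall>s. \<forall>y\<in>fib s. f (s, y) = 0}"
    proof (rule bexI)
      show "g \<in> polyfuns (Suc j)" using g(1) polyfuns_mono[of j "Suc j"] by auto
      show "coeff (root_prod ((\<lambda>w. snd w j) # map (\<lambda>i w. snd w i) [Suc j..<n])) k - g
        \<in> {f. \<forall>s. \<forall>y\<in>fib s. f (s, y) = 0}"
        using g(2) unfolding upt list.map .
    qed
  qed (auto simp: is_subring_def[of UNIV] subring_polyfuns intro: polyfuns_coord)
qed

text \<open>The first \<open>j\<close> coordinates count as part of the coefficient ring.
  \<open>j = 0\<close> gives the normal form over \<open>K[s]\<close>; \<open>j = 2\<close>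
  separates off the two coordinates whose difference is to be divided out.\<close>

lemma normal_form_from:
  assumes "f \<in> polyfuns n" "j \<le> n"
  shows "\<exists>c. (\<forall>ms. c ms \<in> polyfuns j) \<and>
    (\<forall>s. \<forall>y\<in>fib s. f (s, y) = (\<Sum>ms\<in>artin (n - j). c ms (s, y) * monval ms (map y [j..<n])))"
proof -
  have power_apply: "(f ^ k) w = f w ^ k" for f :: "'a \<times> (nat \<Rightarrow> 'a) \<Rightarrow> 'a" and k w
    by (induction k) simp_all
  have monval_apply: "monval ms fs w = monval ms (map (\<lambda>f. f w) fs)"
    for ms w and fs :: "('a \<times> (nat \<Rightarrow> 'a) \<Rightarrow> 'a) list"
    by (induction ms fs rule: monval.induct) (simp_all add: power_apply)
  have sum_apply: "(\<Sum>i\<in>I. F i) w = (\<Sum>i\<in>I. F i w)"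
    for I :: "nat list set" and w and F :: "nat list \<Rightarrow> ('a \<times> (nat \<Rightarrow> 'a) \<Rightarrow> 'a)"
    by (induction I rule: infinite_finite_induct) simp_all
  define ys :: "('a \<times> (nat \<Rightarrow> 'a) \<Rightarrow> 'a) list" where "ys = map (\<lambda>i w. snd w i) [j..<n]"
  have "\<exists>c. (\<forall>ms. c ms \<in> polyfuns j) \<and>
     f - (\<Sum>ms\<in>artin (length ys). c ms * monval ms ys) \<in> {f. \<forall>s. \<forall>y\<in>fib s. f (s, y) = 0}"
  proof (rule artin_reduction)
    show "is_ideal UNIV {f. \<forall>s. \<forall>y\<in>fib s. f (s, y) = 0}" by (auto simp: is_ideal_def)
    show "f \<in> rgen (polyfuns j \<union> set ys)"
      using assms polyfuns_split unfolding ys_def by blast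
  qed (use tail_coeff[OF assms(2)] in \<open>auto simp: is_subring_def[of UNIV] subring_polyfuns ys_def\<close>)
  thus ?thesis by (simp add: monval_apply sum_apply o_def ys_def)
qed

lemma normal_form:
  assumes "f \<in> polyfuns n"
  obtains c where "\<And>s y. y \<in> fib s \<Longrightarrow> f (s, y) = (\<Sum>ms\<in>artin n. poly (c ms) s * monval ms (map y [0..<n]))"
proof -
  from normal_form_from[OF assms, of 0] obtain c where c: "\<And>ms. c ms \<in> polyfuns 0"
    "\<And>s y. y \<in> fib s \<Longrightarrow> f (s, y) = (\<Sum>ms\<in>artin n. c ms (s, y) * monval ms (map y [0..<n]))" by auto
  have "\<forall>ms. \<exists>q. \<forall>w. c ms w = poly q (fst w)" using polyfuns_0[OF c(1)] by blast
  then obtain q where "\<And>ms w. c ms w = poly (q ms) (fst w)" by metis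
  with c(2) show ?thesis by (intro that[of q]) simp
qed

text \<open>When the roots are distinct, every ordering of them is a point of the fibre, so
  \<open>artin_unique\<close> applies. The statement concerns a single parameter because the fibre
  at infinity will be treated on its own.\<close>

lemma normal_form_unique:
  assumes "\<And>y. y \<in> fib s \<Longrightarrow> (\<Sum>ms\<in>artin n. c ms * monval ms (map y [0..<n])) = 0"
    and "\<And>ys. root_prod ys = P s \<Longrightarrow> distinct ys" and "ms \<in> artin n"
  shows "c ms = 0"
proof -
  obtain ys where ys: "length ys = n" "root_prod ys = P s"
    using root_prod_exists[OF degree_P lead_coeff_P] by blast
  show ?thesis
  proof (rule artin_unique[where as = ys])
    fix bs assume "mset bs = mset ys"
    hence bs: "root_prod bs = P s" "length bs = n" using root_prod_mset_cong[of bs ys] ys mset_eq_length[of bs ys] by auto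
    from assms(1)[OF fib_listI(1)[OF this]]
    show "(\<Sum>ms\<in>artin (length ys). c ms * monval ms bs) = 0" unfolding fib_listI(2)[OF bs] ys(1) .
  qed (use ys assms in auto)
qed

text \<open>The curve has no component inside a fibre: off a finite set of parameters the
  coefficients of the normal form vanish by uniqueness, and a polynomial in \<open>s\<close> with so
  many zeros is \<open>0\<close>. Later identities are derived by cancelling a factor that is
  nonzero for all but finitely many \<open>s\<close>, and are extended by this lemma.\<close>

lemma vanish_if_cofinite:
  assumes "f \<in> polyfuns n" "finite S" "\<And>s y. s \<notin> S \<Longrightarrow> y \<in> fib s \<Longrightarrow> f (s, y) = 0" "y \<in> fib s"
  shows "f (s, y) = 0"
proof -
  obtain c where c: "\<And>s y. y \<in> fib s \<Longrightarrow> f (s, y) = (\<Sum>ms\<in>artin n. poly (c ms) s * monval ms (map y [0..<n]))"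
    using normal_form[OF assms(1)] by blast
  have "c ms = 0" if "ms \<in> artin n" for ms
  proof (rule poly_eq_0_if_cofinite_roots)
    show "finite (S \<union> {s. \<exists>ys. root_prod ys = P s \<and> \<not> distinct ys})" using separable_P assms(2) by blast
    fix s assume "s \<notin> S \<union> {s. \<exists>ys. root_prod ys = P s \<and> \<not> distinct ys}"
    thus "poly (c ms) s = 0"
      using that assms(3)[of s] by (intro normal_form_unique[where s = s and c = "\<lambda>ms. poly (c ms) s"]) (auto simp: c)
  qed
  thus ?thesis using c[OF assms(4)] by simp
qed

text \<open>On a separable fibre all points are permutations of one another, so \<open>f\<close> is
  constant there, and this constant times the monomial \<open>1\<close> is a second normal form.
  Uniqueness identifies \<open>f\<close> with its coefficient at that monomial.\<close>

lemma symmetric_polyfun: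
  assumes f: "f \<in> polyfuns n"
    and sym: "\<And>s y \<sigma>. y \<in> fib s \<Longrightarrow> \<sigma> permutes {..<n} \<Longrightarrow> f (s, y \<circ> \<sigma>) = f (s, y)"
  obtains q where "\<And>s y. y \<in> fib s \<Longrightarrow> f (s, y) = poly q s"
proof -
  obtain c where c: "\<And>s y. y \<in> fib s \<Longrightarrow> f (s, y) = (\<Sum>ms\<in>artin n. poly (c ms) s * monval ms (map y [0..<n]))"
    using normal_form[OF f] by blast
  \<comment> \<open>All exponents zero: the index of the monomial \<open>1\<close>.\<close>
  define z where "z = replicate n (0::nat)"
  have "replicate m 0 \<in> artin m" for m by (induction m) auto
  hence z: "z \<in> artin n" by (simp add: z_def)
  have "monval (replicate (length ys) 0) ys = 1" for ys :: "'a list" by (induction ys) auto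
  hence mz: "monval z (map y [0..<n]) = 1" for y :: "nat \<Rightarrow> 'a"
    by (metis z_def length_map length_upt minus_nat.diff_0)
  have "(\<lambda>w. f w - poly (c z) (fst w)) (s, y) = 0" if y: "y \<in> fib s" for s y
  proof (rule vanish_if_cofinite[OF _ separable_P _ y])
    show "(\<lambda>w. f w - poly (c z) (fst w)) \<in> polyfuns n" by (intro polyfuns_intros f)
  next
    fix s y assume "s \<notin> {s. \<exists>ys. root_prod ys = P s \<and> \<not> distinct ys}" and y: "y \<in> fib s"
    hence d: "\<And>ys. root_prod ys = P s \<Longrightarrow> distinct ys" by blast
    have "(\<lambda>ms. poly (c ms) s - (if ms = z then f (s, y) else 0)) z = 0"
    proof (rule normal_form_unique[where c = "\<lambda>ms. poly (c ms) s - (if ms = z then f (s, y) else 0)", OF _ d z])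
      fix y' assume y': "y' \<in> fib s"
      have "mset (map y' [0..<n]) = mset (map y [0..<n])"
        using root_prod_inj_distinct[of "map y' [0..<n]" "map y [0..<n]"] d y y' by (simp add: fib_def)
      then obtain p where p: "p permutes {..<n}" "permute_list p (map y [0..<n]) = map y' [0..<n]"
        using mset_eq_permutation[of "map y' [0..<n]" "map y [0..<n]"] by auto
      have yp: "map (y \<circ> p) [0..<n] = map y' [0..<n]"
        unfolding p(2)[symmetric] using permutes_in_image[OF p(1)]
        by (intro nth_equalityI) (auto simp: permute_list_def)
      have "f (s, y') = f (s, y \<circ> p)"
        using c[OF y'] c[OF fib_permute[OF p(1) y]] by (simp only: yp)
      hence "f (s, y') = f (s, y)" using sym[OF y p(1)] by simp
      thus "(\<Sum>ms\<in>artin n. (poly (c ms) s - (if ms = z then f (s, y) else 0)) * monval ms (map y' [0..<n])) = 0"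
        using z by (simp add: left_diff_distrib sum_subtractf mz if_distrib[of "\<lambda>c. c * _"] flip: c[OF y'] cong: if_cong)
    qed
    thus "f (s, y) - poly (c z) (fst (s, y)) = 0" by simp
  qed
  thus ?thesis by (intro that[of "c z"]) auto
qed

end

lemma double_root_deriv:
  fixes p :: "'a::field poly"
  assumes "[:- b, 1:] ^ 2 dvd p"
  shows "poly p b = 0" "poly (pderiv p) b = 0"
proof -
  obtain q where "p = [:- b, 1:] ^ 2 * q" using assms by blast
  hence p: "p = [:- b, 1:] * ([:- b, 1:] * q)" by (simp only: power2_eq_square mult.assoc)
  show "poly p b = 0" "poly (pderiv p) b = 0" unfolding p pderiv_mult by (simp_all add: pderiv_pCons)
qed

lemma not_distinct_double_root:
  assumes "\<not> distinct ys"
  shows "\<exists>b. [:- b, 1:] ^ 2 dvd root_prod ys"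
proof -
  obtain xs us vs b where ys: "ys = xs @ [b] @ us @ [b] @ vs"
    using not_distinct_decomp[OF assms] by blast
  have "root_prod ys = [:- b, 1:] ^ 2 * (root_prod xs * root_prod us * root_prod vs)"
    unfolding ys by (simp add: root_prod_def power2_eq_square mult_ac del: mult_pCons_left mult_pCons_right)
  thus ?thesis by (metis dvd_triv_left)
qed

section \<open>Permutations of the coordinates and the trace kernel\<close>

lemma polyfuns_permute:
  assumes "\<sigma> permutes {..<n}" "f \<in> polyfuns n"
  shows "(\<lambda>w. f (fst w, snd w \<circ> \<sigma>)) \<in> polyfuns n"
  using assms(2)
proof (induction rule: polyfuns_induct)
  case (coord i)
  thus ?case using permutes_in_image[OF assms(1), of i] by (auto intro!: polyfuns_intros)
next
  case param
  show ?case using polyfuns_fst[of n] by simp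
qed (auto intro!: polyfuns_intros)

definition off_diagonal :: "nat \<Rightarrow> (nat \<times> nat) set" where
  "off_diagonal n = {(i, j). i < n \<and> j < n \<and> i \<noteq> j}"

lemma off_diagonal_subset: "off_diagonal n \<subseteq> {..<n} \<times> {..<n}"
  by (auto simp: off_diagonal_def)

lemma finite_off_diagonal: "finite (off_diagonal n)"
  by (rule finite_subset[OF off_diagonal_subset]) simp

text \<open>Separating \<open>y\<close> from \<open>y'\<close> is what turns a sum over all
  \<open>y' = y \<circ> \<sigma>\<close> into traces of the functions \<open>q\<close>, with
  coefficients \<open>p (s, y)\<close>.\<close>

lemma product_kernel_expansion:
  assumes "finite I" "I \<subseteq> {..<n} \<times> {..<n}"
  shows "\<exists>L. set L \<subseteq> polyfuns n \<times> polyfuns n \<and>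
    (\<forall>s y y'. (\<Prod>(i, j)\<in>I. y i - y' j) = (\<Sum>(p, q)\<leftarrow>L. p (s, y) * q (s, y') :: 'a::comm_ring_1))"
  using assms
proof (induction I rule: finite_induct)
  case empty
  show ?case by (intro exI[of _ "[(\<lambda>_. 1, \<lambda>_. 1)]"]) (auto intro: polyfuns_const)
next
  case (insert x I)
  obtain i j where x: "x = (i, j)" by force
  have ij: "i < n" "j < n" using insert.prems x by auto
  obtain L where L: "set L \<subseteq> polyfuns n \<times> polyfuns n"
    "\<And>s y y'. (\<Prod>(i, j)\<in>I. y i - y' j) = (\<Sum>(p, q)\<leftarrow>L. p (s, y) * q (s, y') :: 'a)"
    using insert by auto
  define L1 where "L1 = map (\<lambda>(p :: 'a \<times> (nat \<Rightarrow> 'a) \<Rightarrow> 'a, q :: 'a \<times> (nat \<Rightarrow> 'a) \<Rightarrow> 'a). (\<lambda>w. snd w i * p w, q)) L"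
  define L2 where "L2 = map (\<lambda>(p :: 'a \<times> (nat \<Rightarrow> 'a) \<Rightarrow> 'a, q :: 'a \<times> (nat \<Rightarrow> 'a) \<Rightarrow> 'a). (\<lambda>w. - p w, \<lambda>w. snd w j * q w)) L"
  have L1: "(\<Sum>(p, q)\<leftarrow>L1. p (s, y) * q (s, y')) = y i * (\<Sum>(p, q)\<leftarrow>L. p (s, y) * q (s, y'))" for s y y'
    unfolding L1_def by (induction L) (auto simp: algebra_simps)
  have L2: "(\<Sum>(p, q)\<leftarrow>L2. p (s, y) * q (s, y')) = - y' j * (\<Sum>(p, q)\<leftarrow>L. p (s, y) * q (s, y'))" for s y y'
    unfolding L2_def by (induction L) (auto simp: algebra_simps)
  have "(\<Prod>(i, j)\<in>insert x I. y i - y' j) = (\<Sum>(p, q)\<leftarrow>L1 @ L2. p (s, y) * q (s, y'))" for s and y y' :: "nat \<Rightarrow> 'a"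
    using insert(1,2) L(2)[of y y' s] by (simp add: L1 L2 x algebra_simps)
  moreover have "set (L1 @ L2) \<subseteq> polyfuns n \<times> polyfuns n"
    using L(1) ij by (auto simp: L1_def L2_def intro!: polyfuns_intros)
  ultimately show ?case by blast
qed

context root_family
begin

text \<open>
  The kernel \<open>\<Prod>\<^bsub>i\<noteq>j\<^esub> (y\<^sub>i - y'\<^sub>j)\<close> vanishes at \<open>y' = y \<circ> \<sigma>\<close> unless \<open>\<sigma>\<close> is the identity. Hence the trace of
  \<open>z\<close> against it is \<open>z\<close> times the discriminant, and this trace only involves traces of
  polynomial functions, which are polynomials in \<open>s\<close>.
\<close>

lemma discriminant_divisible:
  assumes z: "z \<in> polyfuns n" and z0: "\<And>y. y \<in> fib t \<Longrightarrow> z (t, y) = 0"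
  obtains w where "w \<in> polyfuns n"
    "\<And>s y. y \<in> fib s \<Longrightarrow> z (s, y) * (\<Prod>(i, j)\<in>off_diagonal n. y i - y j) = (s - t) * w (s, y)"
proof -
  obtain L where L: "set L \<subseteq> polyfuns n \<times> polyfuns n"
    "\<And>s y y'. (\<Prod>(i, j)\<in>off_diagonal n. y i - y' j) = (\<Sum>(p, q)\<leftarrow>L. p (s, y) * q (s, y') :: 'a)"
    using product_kernel_expansion[OF finite_off_diagonal off_diagonal_subset] by metis
  let ?S = "{\<sigma>. \<sigma> permutes {..<n}}"
  have finS: "finite ?S" by (simp add: finite_permutations)
  have kernel: "(\<Prod>(i, j)\<in>off_diagonal n. y i - (y \<circ> \<sigma>) j) = 0" if perm: "\<sigma> permutes {..<n}" and nid: "\<sigma> \<noteq> id" for \<sigma> and y :: "nat \<Rightarrow> 'a"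
  proof -
    obtain j where j: "\<sigma> j \<noteq> j" using nid by (auto simp: fun_eq_iff)
    hence "j < n" using perm permutes_not_in[of \<sigma> "{..<n}" j] by auto
    moreover from this have "\<sigma> j < n" using permutes_in_image[OF perm, of j] by simp
    ultimately have "(\<sigma> j, j) \<in> off_diagonal n" using j by (simp add: off_diagonal_def)
    thus ?thesis using finite_off_diagonal by (intro prod_zero) force+
  qed
  have "\<exists>\<tau>. \<forall>s. \<forall>y\<in>fib s. (\<Sum>\<sigma>\<in>?S. z (s, y \<circ> \<sigma>) * q (s, y \<circ> \<sigma>)) = (s - t) * poly \<tau> s"
    if q: "q \<in> polyfuns n" for q
  proof -
    define T where "T = (\<lambda>w. \<Sum>\<sigma>\<in>?S. z (fst w, snd w \<circ> \<sigma>) * q (fst w, snd w \<circ> \<sigma>))"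
    have "T \<in> polyfuns n" unfolding T_def
      using polyfuns_permute[OF _ z] polyfuns_permute[OF _ q] by (intro polyfuns_sum_fun polyfuns_mult_fun) auto
    moreover have "T (s, y \<circ> \<pi>) = T (s, y)" if "\<pi> permutes {..<n}" for s y \<pi>
      unfolding T_def using that
      by (intro sum.reindex_bij_witness[of _ "\<lambda>\<sigma>. inv_into UNIV \<pi> \<circ> \<sigma>" "\<lambda>\<sigma>. \<pi> \<circ> \<sigma>"])
         (auto simp: permutes_compose[unfolded o_def] permutes_inv o_def permutes_inverses)
    ultimately obtain \<tau> where \<tau>: "\<And>s y. y \<in> fib s \<Longrightarrow> T (s, y) = poly \<tau> s"
      using symmetric_polyfun[of T] by metis
    \<comment> \<open>As \<open>z\<close> vanishes on the entire fibre over \<open>t\<close>, the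
      trace polynomial has the zero \<open>t\<close>; this supplies the factor
      \<open>s - t\<close>.\<close>
    obtain y where y: "y \<in> fib t" using fib_nonempty by blast
    have "T (t, y) = 0" unfolding T_def
      using z0 fib_permute[OF _ y] by (intro sum.neutral) auto
    hence "poly \<tau> t = 0" using \<tau>[OF y] by simp
    then obtain \<tau>' where \<tau>': "\<tau> = [:- t, 1:] * \<tau>'" by (metis dvdE poly_eq_0_iff_dvd)
    have "poly \<tau> s = (s - t) * poly \<tau>' s" for s unfolding \<tau>' by (simp add: algebra_simps)
    thus ?thesis using \<tau> by (intro exI[of _ \<tau>']) (simp add: T_def)
  qed
  hence "\<forall>q. \<exists>\<tau>. q \<in> polyfuns n \<longrightarrow> (\<forall>s. \<forall>y\<in>fib s.
      (\<Sum>\<sigma>\<in>?S. z (s, y \<circ> \<sigma>) * q (s, y \<circ> \<sigma>)) = (s - t) * poly \<tau> s)" by blast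
  from choice[OF this] obtain \<tau> where \<tau>: "\<And>q s y. q \<in> polyfuns n \<Longrightarrow> y \<in> fib s \<Longrightarrow>
      (\<Sum>\<sigma>\<in>?S. z (s, y \<circ> \<sigma>) * q (s, y \<circ> \<sigma>)) = (s - t) * poly (\<tau> q) s" by blast
  define w where "w = (\<lambda>w. \<Sum>(p, q)\<leftarrow>L. p w * poly (\<tau> q) (fst w))"
  show ?thesis
  proof (rule that[of w])
    show "w \<in> polyfuns n" unfolding w_def using L(1)
      by (induction L) (auto intro!: polyfuns_intros)
    fix s y assume y: "y \<in> fib s"
    have "z (s, y) * (\<Prod>(i, j)\<in>off_diagonal n. y i - y j) =
        (\<Sum>\<sigma>\<in>?S. if \<sigma> = id then z (s, y) * (\<Prod>(i, j)\<in>off_diagonal n. y i - y j) else 0)"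
      using finS by (simp add: permutes_id)
    also have "\<dots> = (\<Sum>\<sigma>\<in>?S. z (s, y \<circ> \<sigma>) * (\<Prod>(i, j)\<in>off_diagonal n. y i - (y \<circ> \<sigma>) j))"
      using kernel by (intro sum.cong) auto
    also have "\<dots> = (\<Sum>\<sigma>\<in>?S. z (s, y \<circ> \<sigma>) * (\<Sum>(p, q)\<leftarrow>L. p (s, y) * q (s, y \<circ> \<sigma>)))"
      by (simp only: L(2)[of _ _ s])
    also have "\<dots> = (\<Sum>(p, q)\<leftarrow>L. p (s, y) * (\<Sum>\<sigma>\<in>?S. z (s, y \<circ> \<sigma>) * q (s, y \<circ> \<sigma>)))"
      by (induction L) (auto simp: sum_distrib_left distrib_left sum.distrib mult_ac)
    also have "\<dots> = (\<Sum>(p, q)\<leftarrow>L. p (s, y) * ((s - t) * poly (\<tau> q) s))"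
      using L(1) y by (intro arg_cong[of _ _ sum_list] map_cong) (auto simp: \<tau>)
    also have "\<dots> = (s - t) * w (s, y)"
      unfolding w_def by (induction L) (auto simp: algebra_simps)
    finally show "z (s, y) * (\<Prod>(i, j)\<in>off_diagonal n. y i - y j) = (s - t) * w (s, y)" .
  qed
qed

end

section \<open>Fibres of a Morse polynomial\<close>

locale monic_morse =
  fixes M :: "'a::alg_closed_field poly" and n :: nat
  assumes degree_M: "degree M = n" and n_pos: "n > 0" and monic_M: "lead_coeff M = 1"
    and n_nonzero: "(of_nat n :: 'a) \<noteq> 0"
    and simple_critical: "\<And>\<beta>. poly (pderiv M) \<beta> = 0 \<Longrightarrow> order \<beta> (pderiv M) = 1"
    and inj_critical: "inj_on (poly M) {\<beta>. poly (pderiv M) \<beta> = 0}"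
begin

lemma pderiv_nonzero: "pderiv M \<noteq> 0"
proof -
  have "coeff (pderiv M) (n - 1) = of_nat n" using n_pos monic_M degree_M by (simp add: coeff_pderiv)
  thus ?thesis using n_nonzero by auto
qed

definition critical_values :: "'a set" where
  "critical_values = poly M ` {\<beta>. poly (pderiv M) \<beta> = 0}"

lemma finite_critical_values: "finite critical_values"
  unfolding critical_values_def using poly_roots_finite[OF pderiv_nonzero] by blast

lemma noncritical_distinct:
  assumes "root_prod ys = M - [:s:]" "s \<notin> critical_values"
  shows "distinct ys"
proof (rule ccontr)
  assume "\<not> distinct ys"
  then obtain b where "[:- b, 1:] ^ 2 dvd M - [:s:]" using not_distinct_double_root assms(1) by metis
  from double_root_deriv[OF this] have "poly M b = s" "poly (pderiv M) b = 0" by (simp_all add: pderiv_diff)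
  thus False using assms(2) by (auto simp: critical_values_def)
qed

lemma coeff_P_fst: "\<exists>q. \<forall>s. coeff (M - [:s:]) k = poly q s"
proof (cases k)
  case 0
  thus ?thesis by (intro exI[of _ "[:coeff M 0, - 1:]"]) simp
next
  case (Suc m)
  thus ?thesis by (intro exI[of _ "[:coeff M k:]"]) simp
qed

sublocale root_family n "\<lambda>s. M - [:s:]"
proof
  fix s
  show deg: "degree (M - [:s:]) = n"
  proof -
    have "M - [:s:] = M + [:- s:]" by simp
    thus ?thesis using degree_add_eq_left[of "[:- s:]" M] n_pos degree_M by (simp only:) simp
  qed
  show "lead_coeff (M - [:s:]) = 1" unfolding deg using n_pos monic_M degree_M by (cases n) auto
  show "finite {s. \<exists>ys. root_prod ys = M - [:s:] \<and> \<not> distinct ys}"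
    by (rule finite_subset[OF _ finite_critical_values]) (use noncritical_distinct in blast)
qed (rule coeff_P_fst)

lemma fib_coord:
  assumes "y \<in> fib s" "i < n"
  shows "poly M (y i) = s"
proof -
  have "poly (root_prod (map y [0..<n])) (y i) = 0" using assms by (intro poly_root_prod_eq_0) auto
  thus ?thesis using assms by (simp add: fib_def)
qed

lemma fib_noncritical_neq:
  assumes "y \<in> fib s" "s \<notin> critical_values" "i < n" "j < n" "i \<noteq> j"
  shows "y i \<noteq> y j"
proof -
  have "distinct (map y [0..<n])" using assms noncritical_distinct by (simp add: fib_def)
  thus ?thesis using assms by (auto simp: distinct_map inj_on_def)
qed

text \<open>A triple root would be a multiple zero of \<open>M'\<close>, against the simplicity of
  its zeros. A repeated root among the remaining ones would be a critical point with the same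
  critical value; by injectivity it equals \<open>\<beta>\<close> and again produces a triple
  root.\<close>

lemma critical_fibre:
  assumes "poly (pderiv M) \<beta> = 0"
  obtains hs where "length hs = n - 2" "distinct hs" "root_prod (\<beta> # \<beta> # hs) = M - [:poly M \<beta>:]"
proof -
  have not3: "\<not> [:- \<beta>, 1:] ^ 3 dvd M - [:poly M \<beta>:]"
  proof
    assume "[:- \<beta>, 1:] ^ 3 dvd M - [:poly M \<beta>:]"
    then obtain q where q: "M - [:poly M \<beta>:] = [:- \<beta>, 1:] ^ 3 * q" by blast
    \<comment> \<open>Collects the derivative of \<open>x * (x * (x * u))\<close>, for
      \<open>x' = 1\<close> and \<open>u' = r\<close>, into a multiple of
      \<open>x ^ 2\<close>.\<close>
    have alg: "x * (x * (x * r + u) + x * u) + x * (x * u) = x ^ 2 * (x * r + 3 * u)" for x r u :: "'a poly"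
      by (simp add: algebra_simps power2_eq_square)
    have X': "pderiv [:- \<beta>, 1:] = 1" by (simp add: pderiv_pCons)
    have "pderiv M = pderiv (M - [:poly M \<beta>:])" by (simp add: pderiv_diff)
    also have "\<dots> = pderiv ([:- \<beta>, 1:] * ([:- \<beta>, 1:] * ([:- \<beta>, 1:] * q)))"
      unfolding q by (simp only: power3_eq_cube mult.assoc)
    also have "\<dots> = [:- \<beta>, 1:] ^ 2 * ([:- \<beta>, 1:] * pderiv q + 3 * q)"
      by (simp only: pderiv_mult X' mult_1_right alg)
    finally have "[:- \<beta>, 1:] ^ 2 dvd pderiv M" by (metis dvd_triv_left)
    hence "2 \<le> order \<beta> (pderiv M)" using pderiv_nonzero order_divides by metis
    thus False using simple_critical[OF assms] by simp
  qed
  obtain ys where ys: "length ys = n" "root_prod ys = M - [:poly M \<beta>:]"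
    using root_prod_exists[OF degree_P lead_coeff_P] by blast
  have root: "poly (root_prod xs) x = 0 \<longleftrightarrow> x \<in> set xs" for x and xs :: "'a list"
    by (induction xs) (auto simp: root_prod_Cons)
  have "\<beta> \<in> set ys" using root[of ys \<beta>] ys by simp
  then obtain zs where zs: "mset ys = mset (\<beta> # zs)"
    by (metis mset_remove1 perm_remove)
  hence 1: "M - [:poly M \<beta>:] = [:- \<beta>, 1:] * root_prod zs"
    using root_prod_mset_cong[OF zs] ys root_prod_Cons by metis
  have "pderiv M = pderiv (M - [:poly M \<beta>:])" by (simp add: pderiv_diff)
  hence "poly (root_prod zs) \<beta> = 0" using assms unfolding 1 pderiv_mult by (simp add: pderiv_pCons)
  hence "\<beta> \<in> set zs" using root by simp
  then obtain hs where hs: "mset zs = mset (\<beta> # hs)"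
    by (metis mset_remove1 perm_remove)
  have eq: "root_prod (\<beta> # \<beta> # hs) = M - [:poly M \<beta>:]"
    using root_prod_mset_cong[of "\<beta> # \<beta> # hs" ys] zs hs ys by simp
  have len: "length hs = n - 2"
    using ys(1) mset_eq_length[OF zs] mset_eq_length[OF hs] by simp
  have "distinct hs"
  proof (rule ccontr)
    assume "\<not> distinct hs"
    then obtain b where b: "[:- b, 1:] ^ 2 dvd root_prod hs" using not_distinct_double_root by blast
    have *: "M - [:poly M \<beta>:] = [:- \<beta>, 1:] * ([:- \<beta>, 1:] * root_prod hs)"
      using eq by (simp only: root_prod_Cons)
    have "root_prod hs dvd M - [:poly M \<beta>:]" unfolding * by (intro dvd_mult dvd_refl)
    from double_root_deriv[OF dvd_trans[OF b this]]
    have "poly M b = poly M \<beta>" "poly (pderiv M) b = 0" by (simp_all add: pderiv_diff)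
    hence "b = \<beta>" using inj_critical assms by (auto simp: inj_on_def)
    hence "[:- \<beta>, 1:] dvd root_prod hs" using b by (meson dvd_trans dvd_power pos2)
    then obtain q where "root_prod hs = [:- \<beta>, 1:] * q" by blast
    hence "M - [:poly M \<beta>:] = [:- \<beta>, 1:] ^ 3 * q" unfolding * by (simp only: power3_eq_cube mult.assoc)
    thus False using not3 by simp
  qed
  with len eq that show ?thesis by blast
qed

text \<open>Simple zeros make \<open>M'\<close> squarefree, so its linear factors can be split off
  \<open>q\<close> one after another.\<close>

lemma pderiv_dvd_if_vanishes:
  assumes "\<And>\<beta>. poly (pderiv M) \<beta> = 0 \<Longrightarrow> poly q \<beta> = 0"
  shows "pderiv M dvd q"
proof -
  define c where "c = lead_coeff (pderiv M)"
  have c: "c \<noteq> 0" using pderiv_nonzero by (simp add: c_def)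
  define D where "D = Polynomial.smult (inverse c) (pderiv M)"
  have "lead_coeff D = 1" using c by (simp add: D_def c_def[symmetric])
  then obtain ys where ys: "root_prod ys = D" using root_prod_exists[of D] by blast
  have "distinct ys"
  proof (rule ccontr)
    assume "\<not> distinct ys"
    then obtain b where b: "[:- b, 1:] ^ 2 dvd D" using not_distinct_double_root ys by metis
    hence "[:- b, 1:] ^ 2 dvd pderiv M" using c by (simp add: D_def dvd_smult_iff)
    hence "2 \<le> order b (pderiv M)" using pderiv_nonzero order_divides by metis
    moreover have "poly (pderiv M) b = 0"
      using double_root_deriv(1)[OF b] c by (simp add: D_def)
    ultimately show False using simple_critical[of b] by simp
  qed
  moreover have "poly q b = 0" if "b \<in> set ys" for b
    using poly_root_prod_eq_0[OF that] c assms[of b] by (simp add: ys D_def)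
  ultimately have "root_prod ys dvd q"
  proof (induction ys arbitrary: q)
    case (Cons b ys)
    obtain r where r: "q = [:- b, 1:] * r" using Cons.prems(2)[of b] by (auto simp: poly_eq_0_iff_dvd)
    have "poly r x = 0" if "x \<in> set ys" for x
      using Cons.prems(2)[of x] Cons.prems(1) that by (auto simp: r)
    hence "root_prod ys dvd r" using Cons by simp
    thus ?case unfolding r root_prod_Cons by (intro mult_dvd_mono dvd_refl)
  qed simp
  thus ?thesis using c by (simp add: ys D_def smult_dvd_iff)
qed

text \<open>Modulo \<open>y_0 - y_1\<close> both coordinates become \<open>y_0\<close>, and
  \<open>s = M(y_0)\<close> on the fibre; what remains is a polynomial in \<open>y_0\<close>
  alone.\<close>

lemma coord_fns_mod_difference:
  assumes "n \<ge> 2" "f \<in> polyfuns 2"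
  shows "\<exists>q d. d \<in> polyfuns n \<and> (\<forall>s. \<forall>y\<in>fib s. f (s, y) = poly q (y 0) + (y 0 - y 1) * d (s, y))"
  using assms(2)
proof (induction rule: polyfuns_induct)
  case (const c)
  show ?case by (rule exI[of _ "[:c:]"], rule exI[of _ "\<lambda>_. 0"]) (auto intro: polyfuns_const)
next
  case param
  show ?case using fib_coord[of _ _ 0] n_pos
    by (intro exI[of _ M] exI[of _ "\<lambda>_. 0"]) (auto intro: polyfuns_const)
next
  case (coord i)
  show ?case
  proof (cases "i = 0")
    case True
    thus ?thesis by (intro exI[of _ "[:0, 1:]"] exI[of _ "\<lambda>_. 0"]) (auto intro: polyfuns_const)
  next
    case False
    hence "i = 1" using coord by simp
    thus ?thesis by (intro exI[of _ "[:0, 1:]"] exI[of _ "\<lambda>_. - 1"]) (auto intro: polyfuns_const)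
  qed
next
  case (diff f g)
  then obtain q d q' d' where *: "d \<in> polyfuns n" "d' \<in> polyfuns n"
    "\<forall>s. \<forall>y\<in>fib s. f (s, y) = poly q (y 0) + (y 0 - y 1) * d (s, y)"
    "\<forall>s. \<forall>y\<in>fib s. g (s, y) = poly q' (y 0) + (y 0 - y 1) * d' (s, y)" by blast
  show ?case
    by (rule exI[of _ "q - q'"], rule exI[of _ "\<lambda>w. d w - d' w"])
       (use * in \<open>auto intro!: polyfuns_intros simp: algebra_simps\<close>)
next
  case (mult f g)
  then obtain q d q' d' where *: "d \<in> polyfuns n" "d' \<in> polyfuns n"
    "\<forall>s. \<forall>y\<in>fib s. f (s, y) = poly q (y 0) + (y 0 - y 1) * d (s, y)"
    "\<forall>s. \<forall>y\<in>fib s. g (s, y) = poly q' (y 0) + (y 0 - y 1) * d' (s, y)" by blast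
  define e where "e = (\<lambda>w. poly q (snd w 0) * d' w + poly q' (snd w 0) * d w + (snd w 0 - snd w 1) * d w * d' w)"
  have "e \<in> polyfuns n" unfolding e_def using * assms(1) by (intro polyfuns_intros) auto
  moreover have "f (s, y) * g (s, y) = poly (q * q') (y 0) + (y 0 - y 1) * e (s, y)" if "y \<in> fib s" for s y
  proof -
    have 1: "f (s, y) = poly q (y 0) + (y 0 - y 1) * d (s, y)"
      and 2: "g (s, y) = poly q' (y 0) + (y 0 - y 1) * d' (s, y)" using *(3,4) that by blast+
    show ?thesis unfolding 1 2 by (simp add: e_def algebra_simps)
  qed
  ultimately show ?case by blast
qed

lemma pderiv_M_first_coord:
  assumes "n \<ge> 2" "y \<in> fib s"
  shows "poly (pderiv M) (y 0) = (y 0 - y 1) * (\<Prod>j\<leftarrow>[2..<n]. y 0 - y j)"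
proof -
  have "[0..<n] = 0 # 1 # [2..<n]" using assms(1) by (simp add: upt_conv_Cons numeral_2_eq_2)
  hence eq: "M - [:s:] = [:- y 0, 1:] * ([:- y 1, 1:] * root_prod (map y [2..<n]))"
    using assms(2) by (simp only: fib_def mem_Collect_eq list.map root_prod_Cons)
  have "pderiv M = pderiv (M - [:s:])" by (simp add: pderiv_diff)
  also have "poly \<dots> (y 0) = (y 0 - y 1) * poly (root_prod (map y [2..<n])) (y 0)"
    unfolding eq pderiv_mult[of "[:- y 0, 1:]"] by (simp add: pderiv_pCons algebra_simps)
  also have "poly (root_prod (map y xs)) (y 0) = (\<Prod>j\<leftarrow>xs. y 0 - y j)" for xs
    by (induction xs) (auto simp: root_prod_Cons left_diff_distrib)
  finally show ?thesis .
qed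

text \<open>
  The Morse condition enters here: the scheme \<open>y\<^sub>0 = y\<^sub>1\<close> on the curve of ordered roots is reduced.
\<close>

lemma divide_by_first_difference:
  assumes n2: "n \<ge> 2" and w: "w \<in> polyfuns n" and w0: "\<And>s y. y \<in> fib s \<Longrightarrow> y 0 = y 1 \<Longrightarrow> w (s, y) = 0"
  obtains v where "v \<in> polyfuns n" "\<And>s y. y \<in> fib s \<Longrightarrow> w (s, y) = (y 0 - y 1) * v (s, y)"
proof -
  obtain c where c: "\<And>ms. c ms \<in> polyfuns 2"
    "\<And>s y. y \<in> fib s \<Longrightarrow> w (s, y) = (\<Sum>ms\<in>artin (n - 2). c ms (s, y) * monval ms (map y [2..<n]))"
    using normal_form_from[OF w n2] by blast
  have "\<forall>ms. \<exists>q d. d \<in> polyfuns n \<and> (\<forall>s. \<forall>y\<in>fib s. c ms (s, y) = poly q (y 0) + (y 0 - y 1) * d (s, y))"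
    using coord_fns_mod_difference[OF n2 c(1)] by blast
  then obtain q d where d: "\<And>ms. d ms \<in> polyfuns n"
    and qd: "\<And>ms s y. y \<in> fib s \<Longrightarrow> c ms (s, y) = poly (q ms) (y 0) + (y 0 - y 1) * d ms (s, y)"
    by metis
  \<comment> \<open>For a critical point \<open>\<beta>\<close>, the points with
    \<open>y_0 = y_1 = \<beta>\<close> run through all orderings of the other roots, which are
    distinct. Hence each \<open>q ms\<close> vanishes at \<open>\<beta>\<close>, so
    \<open>M'\<close> divides it; and on the fibre \<open>M'(y_0)\<close> is itself a multiple of
    \<open>y_0 - y_1\<close>.\<close>
  have "pderiv M dvd q ms" if ms: "ms \<in> artin (n - 2)" for ms
  proof (rule pderiv_dvd_if_vanishes)
    fix \<beta> assume "poly (pderiv M) \<beta> = 0"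
    then obtain hs where hs: "length hs = n - 2" "distinct hs" "root_prod (\<beta> # \<beta> # hs) = M - [:poly M \<beta>:]"
      using critical_fibre by metis
    show "poly (q ms) \<beta> = 0"
    proof (rule artin_unique[OF hs(2), where c = "\<lambda>ms. poly (q ms) \<beta>"])
      fix bs assume "mset bs = mset hs"
      hence bs: "root_prod (\<beta> # \<beta> # bs) = M - [:poly M \<beta>:]" "length (\<beta> # \<beta> # bs) = n"
        using root_prod_mset_cong[of "\<beta> # \<beta> # bs" "\<beta> # \<beta> # hs"] hs n2 mset_eq_length[of bs hs] by auto
      define y where "y = (\<lambda>i. if i < n then (\<beta> # \<beta> # bs) ! i else 0)"
      have y: "y \<in> fib (poly M \<beta>)" "y 0 = \<beta>" "y 1 = \<beta>"
        using fib_listI(1)[OF bs] n2 by (auto simp: y_def)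
      have "map y [2..<n] = bs" using bs(2) by (intro nth_equalityI) (auto simp: y_def)
      hence "0 = (\<Sum>ms\<in>artin (n - 2). poly (q ms) \<beta> * monval ms bs)"
        using w0[OF y(1)] c(2)[OF y(1)] qd[OF y(1)] y by simp
      thus "(\<Sum>ms\<in>artin (length hs). poly (q ms) \<beta> * monval ms bs) = 0" using hs(1) by simp
    qed (use ms hs in simp)
  qed
  hence "\<forall>ms. \<exists>r. ms \<in> artin (n - 2) \<longrightarrow> q ms = pderiv M * r" by (auto elim: dvdE)
  from choice[OF this] obtain r where r: "\<And>ms. ms \<in> artin (n - 2) \<Longrightarrow> q ms = pderiv M * r ms" by blast
  define v where "v = (\<lambda>w. \<Sum>ms\<in>artin (n - 2).
    ((\<Prod>j\<in>{2..<n}. snd w 0 - snd w j) * poly (r ms) (snd w 0) + d ms w) * monval ms (map (snd w) [2..<n]))"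
  show ?thesis
  proof (rule that[of v])
    show "v \<in> polyfuns n" unfolding v_def using d n_pos by (intro polyfuns_intros) auto
    fix s y assume y: "y \<in> fib s"
    have D: "poly (pderiv M) (y 0) = (y 0 - y 1) * (\<Prod>j\<in>{2..<n}. y 0 - y j)"
      using pderiv_M_first_coord[OF n2 y] by (simp add: prod.distinct_set_conv_list[symmetric])
    show "w (s, y) = (y 0 - y 1) * v (s, y)"
      unfolding c(2)[OF y] v_def sum_distrib_left
      by (intro sum.cong refl) (auto simp: qd[OF y] r D algebra_simps)
  qed
qed

lemma divide_by_difference:
  assumes ij: "(i, j) \<in> off_diagonal n" and w: "w \<in> polyfuns n"
    and w0: "\<And>s y. y \<in> fib s \<Longrightarrow> y i = y j \<Longrightarrow> w (s, y) = 0"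
  obtains v where "v \<in> polyfuns n" "\<And>s y. y \<in> fib s \<Longrightarrow> w (s, y) = (y i - y j) * v (s, y)"
proof -
  have i: "i < n" and j: "j < n" and "i \<noteq> j" using ij by (auto simp: off_diagonal_def)
  hence n2: "n \<ge> 2" by linarith
  \<comment> \<open>\<open>\<tau>\<close> sends \<open>0\<close> to \<open>i\<close>, and the second
    transposition moves \<open>\<tau> 1\<close> to \<open>j\<close> while fixing \<open>i\<close>.
    So \<open>\<sigma>\<close> reduces the pair \<open>(i, j)\<close> to
    \<open>(0, 1)\<close>.\<close>
  define \<tau> where "\<tau> = Transposition.transpose 0 i"
  define \<sigma> where "\<sigma> = Transposition.transpose (\<tau> 1) j \<circ> \<tau>"
  have "\<tau> permutes {..<n}" unfolding \<tau>_def using i by (intro permutes_swap_id) auto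
  moreover from this have "\<tau> 1 < n" using permutes_in_image[of \<tau> "{..<n}" 1] n2 by simp
  ultimately have \<sigma>: "\<sigma> permutes {..<n}" unfolding \<sigma>_def
    using j by (intro permutes_compose permutes_swap_id) auto
  have "\<tau> 1 \<noteq> i" by (auto simp: \<tau>_def Transposition.transpose_def)
  hence \<sigma>01: "\<sigma> 0 = i" "\<sigma> 1 = j" using \<open>i \<noteq> j\<close> by (auto simp: \<sigma>_def) (auto simp: \<tau>_def Transposition.transpose_def)
  let ?\<rho> = "inv_into UNIV \<sigma>"
  have \<rho>: "?\<rho> permutes {..<n}" using permutes_inv[OF \<sigma>] .
  have \<rho>ij: "?\<rho> i = 0" "?\<rho> j = 1" using \<sigma>01 permutes_inverses(2)[OF \<sigma>] by metis+
  obtain v where v: "v \<in> polyfuns n" "\<And>s y. y \<in> fib s \<Longrightarrow> w (s, y \<circ> ?\<rho>) = (y 0 - y 1) * v (s, y)"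
  proof (rule divide_by_first_difference[OF n2 polyfuns_permute[OF \<rho> w]])
    fix s y assume "y \<in> fib s" "y 0 = y 1"
    thus "w (fst (s, y), snd (s, y) \<circ> ?\<rho>) = 0" using w0[OF fib_permute[OF \<rho>]] \<rho>ij by simp
  qed auto
  show ?thesis
  proof (rule that)
    show "(\<lambda>w. v (fst w, snd w \<circ> \<sigma>)) \<in> polyfuns n" by (rule polyfuns_permute[OF \<sigma> v(1)])
    fix s y assume y: "y \<in> fib s"
    have "(y \<circ> \<sigma>) \<circ> ?\<rho> = y" using permutes_inv_o(1)[OF \<sigma>] by (simp add: comp_assoc)
    thus "w (s, y) = (y i - y j) * v (fst (s, y), snd (s, y) \<circ> \<sigma>)"
      using v(2)[OF fib_permute[OF \<sigma> y]] \<sigma>01 by simp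
  qed
qed

text \<open>Here the quadratic equation for \<open>z\<close> is used: dividing the square of the
  last hypothesis by \<open>(s - t)^2\<close> gives \<open>w^2 = g w (y_i - y_j) pr\<close>, where
  \<open>pr\<close> is the product of the remaining differences. So \<open>w\<close> vanishes where
  \<open>y_i = y_j\<close>, is divisible by \<open>y_i - y_j\<close>, and one factor is
  cancelled.\<close>

lemma cancel_differences:
  assumes z: "z \<in> polyfuns n" and zz: "\<And>s y. y \<in> fib s \<Longrightarrow> z (s, y) ^ 2 = (s - t) * poly g s * z (s, y)"
    and "set ps \<subseteq> off_diagonal n" "w \<in> polyfuns n"
    and "\<And>s y. y \<in> fib s \<Longrightarrow> z (s, y) * (\<Prod>(i, j)\<leftarrow>ps. y i - y j) = (s - t) * w (s, y)"
  shows "\<exists>v\<in>polyfuns n. \<forall>s. \<forall>y\<in>fib s. z (s, y) = (s - t) * v (s, y)"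
  using assms(3-)
proof (induction ps arbitrary: w)
  case Nil
  thus ?case by (intro bexI[of _ w]) auto
next
  case (Cons ij ps)
  obtain i j where ij: "ij = (i, j)" by force
  have off: "(i, j) \<in> off_diagonal n" using Cons.prems(1) ij by simp
  hence lt: "i < n" "j < n" by (auto simp: off_diagonal_def)
  define pr :: "'a \<times> (nat \<Rightarrow> 'a) \<Rightarrow> 'a" where "pr = (\<lambda>w. \<Prod>(i, j)\<leftarrow>ps. snd w i - snd w j)"
  have pr: "pr \<in> polyfuns n" using Cons.prems(1) unfolding pr_def
    by (induction ps) (auto intro!: polyfuns_intros simp: off_diagonal_def)
  have zw: "z (s, y) * ((y i - y j) * pr (s, y)) = (s - t) * w (s, y)" if "y \<in> fib s" for s y
    using Cons.prems(3)[OF that] by (simp add: ij pr_def)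
  have ww: "(\<lambda>x. w x ^ 2 - poly g (fst x) * w x * ((snd x i - snd x j) * pr x)) (s, y) = 0" if y: "y \<in> fib s" for s y
  proof (rule vanish_if_cofinite[where S = "{t}", OF _ _ _ y])
    show "(\<lambda>x. w x ^ 2 - poly g (fst x) * w x * ((snd x i - snd x j) * pr x)) \<in> polyfuns n"
      using pr Cons.prems(2) lt by (intro polyfuns_intros)
    fix s y assume s: "s \<notin> {t}" and y: "y \<in> fib s"
    define \<delta> where "\<delta> = (y i - y j) * pr (s, y)"
    have "(s - t) ^ 2 * w (s, y) ^ 2 = (z (s, y) * \<delta>) ^ 2"
      using zw[OF y] by (simp add: \<delta>_def flip: power_mult_distrib)
    also have "\<dots> = (s - t) * poly g s * \<delta> * (z (s, y) * \<delta>)"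
      unfolding power_mult_distrib zz[OF y] by (simp add: power2_eq_square mult_ac)
    also have "\<dots> = (s - t) ^ 2 * (poly g s * w (s, y) * \<delta>)"
      using zw[OF y] by (simp add: \<delta>_def power2_eq_square mult_ac)
    finally have "w (s, y) ^ 2 = poly g s * w (s, y) * \<delta>" using s by simp
    thus "w (s, y) ^ 2 - poly g (fst (s, y)) * w (s, y) * ((snd (s, y) i - snd (s, y) j) * pr (s, y)) = 0"
      by (simp add: \<delta>_def)
  qed simp
  have w0: "w (s, y) = 0" if "y \<in> fib s" "y i = y j" for s y
    using ww[OF that(1)] that(2) by simp
  obtain v where v: "v \<in> polyfuns n" "\<And>s y. y \<in> fib s \<Longrightarrow> w (s, y) = (y i - y j) * v (s, y)"
    using divide_by_difference[OF off Cons.prems(2) w0] by blast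
  have "(\<lambda>x. z x * pr x - (fst x - t) * v x) (s, y) = 0" if y: "y \<in> fib s" for s y
  proof (rule vanish_if_cofinite[OF _ finite_critical_values _ y])
    show "(\<lambda>x. z x * pr x - (fst x - t) * v x) \<in> polyfuns n"
      using pr v z by (intro polyfuns_intros)
    fix s y assume s: "s \<notin> critical_values" and y: "y \<in> fib s"
    have "(y i - y j) * (z (s, y) * pr (s, y)) = (y i - y j) * ((s - t) * v (s, y))"
      using zw[OF y] v(2)[OF y] by (simp add: mult_ac)
    moreover have "y i \<noteq> y j" using fib_noncritical_neq[OF y s] off by (simp add: off_diagonal_def)
    ultimately show "z (s, y) * pr (s, y) - (fst (s, y) - t) * v (s, y) = 0" by simp
  qed
  thus ?case using Cons.prems(1) v(1) by (intro Cons.IH[of v]) (auto simp: pr_def)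
qed

lemma divide_by_parameter:
  assumes z: "z \<in> polyfuns n" and zz: "\<And>s y. y \<in> fib s \<Longrightarrow> z (s, y) ^ 2 = (s - t) * poly g s * z (s, y)"
  obtains v where "v \<in> polyfuns n" "\<And>s y. y \<in> fib s \<Longrightarrow> z (s, y) = (s - t) * v (s, y)"
proof -
  have "z (t, y) = 0" if "y \<in> fib t" for y using zz[OF that] by simp
  then obtain w where w: "w \<in> polyfuns n"
    "\<And>s y. y \<in> fib s \<Longrightarrow> z (s, y) * (\<Prod>(i, j)\<in>off_diagonal n. y i - y j) = (s - t) * w (s, y)"
    using discriminant_divisible[OF z] by metis
  obtain ps where ps: "set ps = off_diagonal n" "distinct ps"
    using finite_distinct_list[OF finite_off_diagonal] by blast
  have "\<exists>v\<in>polyfuns n. \<forall>s. \<forall>y\<in>fib s. z (s, y) = (s - t) * v (s, y)"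
    by (rule cancel_differences[OF z zz, of ps w]) (use w ps in \<open>auto simp: prod.distinct_set_conv_list[symmetric]\<close>)
  thus ?thesis using that by blast
qed

end

section \<open>The curve of ordered roots at infinity\<close>

lemma length_artin: "ms \<in> artin r \<Longrightarrow> length ms = r"
  by (induction r arbitrary: ms) auto

lemma monval_scale:
  fixes ys :: "'a::field list"
  assumes "length ms = length ys"
  shows "monval ms (map (\<lambda>y. c * y) ys) = c ^ sum_list ms * monval ms ys"
  using assms by (induction ms ys rule: list_induct2) (auto simp: power_mult_distrib power_add)

lemma monval_sum_list_0: "sum_list ms = 0 \<Longrightarrow> monval ms ys = 1"
proof (induction ms arbitrary: ys)
  case (Cons k ms)
  thus ?case by (cases ys) auto
qed simp

lemma poly_root_prod_scale:
  fixes ys :: "'a::field list"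
  assumes "c \<noteq> 0"
  shows "poly (root_prod (map (\<lambda>y. c * y) ys)) (c * x) = c ^ length ys * poly (root_prod ys) x"
  by (induction ys) (simp_all add: root_prod_Cons algebra_simps)

context monic_morse
begin

text \<open>
  The rescaled polynomials \<open>l\<^sup>n M(Y/l) - 1\<close> degenerate to \<open>Y\<^sup>n - 1\<close> at \<open>l = 0\<close>, which describes
  the points at infinity of the curve of ordered roots.
\<close>

definition rescaled :: "'a \<Rightarrow> 'a poly" where
  "rescaled l = (\<Sum>k\<le>n. monom (l ^ (n - k) * coeff M k) k) - 1"

lemma coeff_rescaled: "coeff (rescaled l) k = (if k \<le> n then l ^ (n - k) * coeff M k else 0) - (if k = 0 then 1 else 0)"
  unfolding rescaled_def by (simp add: coeff_sum)

lemma poly_rescaled: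
  assumes "l \<noteq> 0"
  shows "poly (rescaled l) (l * x) = l ^ n * poly (M - [:inverse (l ^ n):]) x"
proof -
  have "l ^ (n - k) * coeff M k * (l * x) ^ k = l ^ n * (coeff M k * x ^ k)" if "k \<le> n" for k
  proof -
    have "l ^ n = l ^ (n - k) * l ^ k" using that by (simp flip: power_add)
    thus ?thesis by (simp only: power_mult_distrib mult_ac)
  qed
  hence "(\<Sum>k\<le>n. l ^ (n - k) * coeff M k * (l * x) ^ k) = (\<Sum>k\<le>n. l ^ n * (coeff M k * x ^ k))"
    by (intro sum.cong) auto
  thus ?thesis using assms
    by (simp add: rescaled_def poly_sum poly_monom poly_altdef[of M] degree_M sum_distrib_left right_diff_distrib)
qed

text \<open>For \<open>l \<noteq> 0\<close> the substitution \<open>s = l^(-n)\<close>, together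
  with division of all roots by \<open>l\<close>, turns the rescaled family back into
  \<open>M - s\<close>.\<close>

lemma root_prod_rescaled:
  assumes l: "l \<noteq> 0" and ys: "root_prod ys = rescaled l" "length ys = n"
  shows "root_prod (map (\<lambda>y. inverse l * y) ys) = M - [:inverse (l ^ n):]"
proof -
  have "poly (root_prod (map (\<lambda>y. inverse l * y) ys) - (M - [:inverse (l ^ n):])) x = 0" for x
  proof -
    have "poly (root_prod (map (\<lambda>y. inverse l * y) ys)) (inverse l * (l * x)) = inverse l ^ n * poly (rescaled l) (l * x)"
      using poly_root_prod_scale[of "inverse l" ys "l * x"] l ys by simp
    also have "\<dots> = poly (M - [:inverse (l ^ n):]) x"
      using l by (simp add: poly_rescaled power_inverse field_simps)
    finally show ?thesis using l by (simp add: mult.assoc[symmetric])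
  qed
  hence "root_prod (map (\<lambda>y. inverse l * y) ys) - (M - [:inverse (l ^ n):]) = 0"
    using poly_eq_0_if_cofinite_roots[of "{}"] by blast
  thus ?thesis by simp
qed

lemma root_family_rescaled: "root_family n rescaled"
proof
  fix l k
  have c: "coeff (rescaled l) n = 1" using n_pos monic_M degree_M by (simp add: coeff_rescaled)
  show deg: "degree (rescaled l) = n" for l
    using n_pos monic_M degree_M
    by (intro antisym degree_le le_degree) (auto simp: coeff_rescaled)
  show "lead_coeff (rescaled l) = 1" unfolding deg by (rule c)
  show "\<exists>q. \<forall>s. coeff (rescaled s) k = poly q s"
    by (rule exI[of _ "(if k \<le> n then monom (coeff M k) (n - k) else 0) - (if k = 0 then 1 else 0)"])
       (auto simp: coeff_rescaled poly_monom)
  \<comment> \<open>A repeated root at \<open>l \<noteq> 0\<close> forces \<open>l^(-n)\<close> to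
    be a critical value \<open>s\<close>, that is, \<open>s l^n = 1\<close>.\<close>
  have "finite (\<Union>s\<in>critical_values. {l. poly (monom s n - 1) l = 0})"
  proof (intro finite_UN_I finite_critical_values poly_roots_finite)
    fix s :: 'a
    have "poly (monom s n - 1) 0 \<noteq> 0" using n_pos by (simp add: poly_monom power_0_left)
    thus "monom s n - 1 \<noteq> 0" by (metis poly_0)
  qed
  moreover have "{l. \<exists>ys. root_prod ys = rescaled l \<and> \<not> distinct ys} \<subseteq>
      insert 0 (\<Union>s\<in>critical_values. {l. poly (monom s n - 1) l = 0})"
  proof (rule subsetI, rule ccontr)
    fix l assume "l \<in> {l. \<exists>ys. root_prod ys = rescaled l \<and> \<not> distinct ys}"
      and "l \<notin> insert 0 (\<Union>s\<in>critical_values. {l. poly (monom s n - 1) l = 0})"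
    then obtain ys where ys: "root_prod ys = rescaled l" "\<not> distinct ys"
      and l: "l \<notin> (\<Union>s\<in>critical_values. {l. poly (monom s n - 1) l = 0})" "l \<noteq> 0" by blast
    have "length ys = n"
      using degree_root_prod_eq[of ys] ys(1) deg by simp
    from root_prod_rescaled[OF l(2) ys(1) this]
    have "\<not> distinct (map (\<lambda>y. inverse l * y) ys) \<Longrightarrow> inverse (l ^ n) \<in> critical_values"
      using noncritical_distinct by blast
    hence "inverse (l ^ n) \<in> critical_values" using ys(2) l(2) by (simp add: distinct_map inj_on_def)
    thus False using l by (auto simp: poly_monom)
  qed
  ultimately show "finite {l. \<exists>ys. root_prod ys = rescaled l \<and> \<not> distinct ys}"
    by (meson finite_insert finite_subset)
qed

lemma rescaled_0_distinct:
  assumes "root_prod ys = rescaled 0"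
  shows "distinct ys"
proof (rule ccontr)
  assume "\<not> distinct ys"
  then obtain b where "[:- b, 1:] ^ 2 dvd rescaled 0" using not_distinct_double_root assms by metis
  moreover have "rescaled 0 = monom 1 n - 1"
    using n_pos monic_M degree_M by (intro poly_eqI) (auto simp: coeff_rescaled)
  ultimately have "b ^ n = 1" "of_nat n * b ^ (n - 1) = 0"
    using double_root_deriv[of b "monom 1 n - 1"] by (auto simp: poly_monom pderiv_diff pderiv_monom)
  thus False using n_nonzero n_pos by (cases "n = 1") (auto simp: power_0_left)
qed

text \<open>Suppose the normal form of \<open>z\<close> has positive top weight \<open>d\<close>.
  Then \<open>Z(l, y) = l^d z(l^(-n), y/l)\<close> extends to a polynomial function at
  \<open>l = 0\<close> with \<open>Z^2 = l^d Z\<close>, so \<open>Z\<close> vanishes on the fibre at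
  infinity. The roots there are distinct, so uniqueness kills the leading coefficients, a
  contradiction.\<close>

lemma idempotent_constant:
  assumes z: "z \<in> polyfuns n" and zz: "\<And>s y. y \<in> fib s \<Longrightarrow> z (s, y) ^ 2 = z (s, y)"
  obtains a where "\<And>s y. y \<in> fib s \<Longrightarrow> z (s, y) = a"
proof -
  interpret I: root_family n rescaled by (rule root_family_rescaled)
  obtain c where c: "\<And>s y. y \<in> fib s \<Longrightarrow> z (s, y) = (\<Sum>ms\<in>artin n. poly (c ms) s * monval ms (map y [0..<n]))"
    using normal_form[OF z] by blast
  \<comment> \<open>\<open>s\<close> has weight \<open>n\<close> and each \<open>y_i\<close> weight
    \<open>1\<close>, in accordance with \<open>M(y_i) = s\<close>.\<close>
  define wt where "wt = (\<lambda>(ms :: nat list, k). n * k + sum_list ms)"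
  define S where "S = {(ms, k). ms \<in> artin n \<and> coeff (c ms) k \<noteq> 0}"
  have finS: "finite S"
  proof (rule finite_subset)
    show "S \<subseteq> Sigma (artin n) (\<lambda>ms. {..degree (c ms)})"
      by (auto simp: S_def le_degree)
  qed auto
  have wt0: "wt x = 0" if "x \<in> S" for x
  proof (rule ccontr)
    assume "wt x \<noteq> 0"
    define d where "d = Max (wt ` S)"
    have le: "wt x \<le> d" if "x \<in> S" for x using finS that by (simp add: d_def)
    have "d > 0" using le[OF \<open>x \<in> S\<close>] \<open>wt x \<noteq> 0\<close> by simp
    have "d \<in> wt ` S" unfolding d_def using finS \<open>x \<in> S\<close> by (intro Max_in) auto
    then obtain ms0 k0 where top: "(ms0, k0) \<in> S" "wt (ms0, k0) = d" by auto
    \<comment> \<open>Homogenization by \<open>l\<close>. Truncated subtraction does no harm: terms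
      of weight above \<open>d\<close> have coefficient \<open>0\<close>.\<close>
    define Z :: "'a \<times> (nat \<Rightarrow> 'a) \<Rightarrow> 'a" where
      "Z = (\<lambda>w. \<Sum>ms\<in>artin n. (\<Sum>k\<le>degree (c ms). coeff (c ms) k * fst w ^ (d - wt (ms, k))) *
              monval ms (map (snd w) [0..<n]))"
    have Z: "Z \<in> polyfuns n" unfolding Z_def by (intro polyfuns_intros) auto
    have scale: "Z (l, y) = l ^ d * z (inverse (l ^ n), \<lambda>i. inverse l * y i)"
      and fibs: "(\<lambda>i. inverse l * y i) \<in> fib (inverse (l ^ n))" if y: "y \<in> I.fib l" and l: "l \<noteq> 0" for l y
    proof -
      show f: "(\<lambda>i. inverse l * y i) \<in> fib (inverse (l ^ n))"
        using root_prod_rescaled[OF l, of "map y [0..<n]"] y by (simp add: I.fib_def fib_def o_def)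
      have summand: "coeff (c ms) k * l ^ (d - wt (ms, k)) * monval ms (map y [0..<n]) =
          l ^ d * (coeff (c ms) k * inverse (l ^ n) ^ k * monval ms (map (\<lambda>i. inverse l * y i) [0..<n]))"
        if ms: "ms \<in> artin n" for ms k
      proof (cases "coeff (c ms) k = 0")
        case False
        hence "wt (ms, k) \<le> d" using ms le by (simp add: S_def)
        hence "l ^ (d - wt (ms, k)) = l ^ d * inverse l ^ wt (ms, k)"
          using l by (simp add: power_diff field_simps)
        also have "inverse l ^ wt (ms, k) = inverse (l ^ n) ^ k * inverse l ^ sum_list ms"
          by (simp add: wt_def power_add power_mult power_inverse)
        finally have "l ^ (d - wt (ms, k)) = l ^ d * (inverse (l ^ n) ^ k * inverse l ^ sum_list ms)" .
        moreover have "monval ms (map (\<lambda>i. inverse l * y i) [0..<n]) = inverse l ^ sum_list ms * monval ms (map y [0..<n])"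
          using monval_scale[of ms "map y [0..<n]" "inverse l"] length_artin[OF ms] by (simp add: o_def)
        ultimately show ?thesis by (simp only: mult_ac)
      qed simp
      show "Z (l, y) = l ^ d * z (inverse (l ^ n), \<lambda>i. inverse l * y i)"
        unfolding Z_def c[OF f] poly_altdef sum_distrib_left sum_distrib_right fst_conv snd_conv
        by (intro sum.cong refl summand)
    qed
    have Z0: "Z (0, y) = 0" if y: "y \<in> I.fib 0" for y
    proof -
      have "(\<lambda>w. Z w ^ 2 - fst w ^ d * Z w) (0, y) = 0"
      proof (rule I.vanish_if_cofinite[where S = "{0}", OF _ _ _ y])
        show "(\<lambda>w. Z w ^ 2 - fst w ^ d * Z w) \<in> polyfuns n" using Z by (intro polyfuns_intros)
        fix l y assume "l \<notin> {0}" and y: "y \<in> I.fib l"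
        hence "l \<noteq> 0" by simp
        have "(l ^ d * z (inverse (l ^ n), \<lambda>i. inverse l * y i))\<^sup>2
            = l ^ d * (l ^ d * z (inverse (l ^ n), \<lambda>i. inverse l * y i))"
          unfolding power_mult_distrib zz[OF fibs[OF y \<open>l \<noteq> 0\<close>]] by (simp add: power2_eq_square)
        thus "Z (l, y) ^ 2 - fst (l, y) ^ d * Z (l, y) = 0"
          unfolding scale[OF y \<open>l \<noteq> 0\<close>] by simp
      qed simp
      thus ?thesis using \<open>d > 0\<close> by (simp add: power_0_left)
    qed
    have "(\<Sum>k\<le>degree (c ms0). coeff (c ms0) k * 0 ^ (d - wt (ms0, k))) = 0"
    proof (rule I.normal_form_unique[where s = 0 and c = "\<lambda>ms. \<Sum>k\<le>degree (c ms). coeff (c ms) k * 0 ^ (d - wt (ms, k))"])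
      fix y assume "y \<in> I.fib 0"
      from Z0[OF this] show "(\<Sum>ms\<in>artin n. (\<Sum>k\<le>degree (c ms). coeff (c ms) k * 0 ^ (d - wt (ms, k))) *
          monval ms (map y [0..<n])) = 0" by (simp add: Z_def)
    qed (use rescaled_0_distinct top in \<open>auto simp: S_def\<close>)
    \<comment> \<open>At \<open>l = 0\<close> only weight \<open>d\<close> survives, and for the
      fixed \<open>ms0\<close> the weight determines \<open>k\<close> because
      \<open>n > 0\<close>.\<close>
    also have "(\<Sum>k\<le>degree (c ms0). coeff (c ms0) k * 0 ^ (d - wt (ms0, k))) =
        (\<Sum>k\<le>degree (c ms0). if k = k0 then coeff (c ms0) k0 else 0)"
    proof (rule sum.cong)
      fix k
      show "coeff (c ms0) k * 0 ^ (d - wt (ms0, k)) = (if k = k0 then coeff (c ms0) k0 else 0)"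
      proof (cases "coeff (c ms0) k = 0 \<or> k = k0")
        case False
        hence "(ms0, k) \<in> S" using top by (simp add: S_def)
        moreover have "wt (ms0, k) \<noteq> wt (ms0, k0)" using False n_pos by (simp add: wt_def)
        ultimately have "wt (ms0, k) < d" using le top(2) by fastforce
        thus ?thesis using False by simp
      qed (use top in auto)
    qed simp
    also have "\<dots> = coeff (c ms0) k0" using top by (simp add: S_def le_degree)
    finally show False using top by (simp add: S_def)
  qed
  have "poly (c ms) s * monval ms ys = coeff (c ms) 0" if ms: "ms \<in> artin n" for ms s ys
  proof -
    have "coeff (c ms) k = 0" if "k > 0" for k
      using wt0[of "(ms, k)"] ms that n_pos by (auto simp: S_def wt_def)
    hence "c ms = [:coeff (c ms) 0:]" by (intro poly_eqI) (auto simp: coeff_pCons split: nat.split)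
    hence *: "poly (c ms) s = coeff (c ms) 0" by (metis mult_zero_right poly_0 poly_pCons add.right_neutral)
    show ?thesis
    proof (cases "coeff (c ms) 0 = 0")
      case False
      hence "sum_list ms = 0" using wt0[of "(ms, 0)"] ms by (auto simp: S_def wt_def)
      thus ?thesis using * by (simp only: monval_sum_list_0 mult_1_right)
    qed (use * in simp)
  qed
  thus ?thesis by (intro that[of "\<Sum>ms\<in>artin n. coeff (c ms) 0"]) (simp add: c)
qed

text \<open>Induction on the degree of \<open>g\<close>: a zero \<open>t\<close> of \<open>g\<close>
  is removed from \<open>g\<close> and, by \<open>divide_by_parameter\<close>, from
  \<open>z\<close>, and the quotients satisfy an equation of the same kind. For constant
  \<open>g\<close> a scalar multiple of \<open>z\<close> is idempotent.\<close>

lemma quasi_idempotent_constant: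
  assumes "z \<in> polyfuns n" "g \<noteq> 0" "\<And>s y. y \<in> fib s \<Longrightarrow> z (s, y) ^ 2 = poly g s * z (s, y)"
  shows "\<exists>a. \<forall>s. \<forall>y\<in>fib s. z (s, y) = poly g s * a"
  using assms
proof (induction "degree g" arbitrary: g z)
  case 0
  then obtain b where b: "g = [:b:]" using degree_eq_zeroE by metis
  have "b \<noteq> 0" using b 0 by simp
  have "\<exists>a. \<forall>s. \<forall>y\<in>fib s. inverse b * z (s, y) = a"
  proof -
    have "(\<lambda>w. inverse b * z w) \<in> polyfuns n" using 0 by (intro polyfuns_intros)
    moreover have "(inverse b * z (s, y)) ^ 2 = inverse b * z (s, y)" if "y \<in> fib s" for s y
      unfolding power_mult_distrib "0.prems"(3)[OF that] using \<open>b \<noteq> 0\<close> by (simp add: b power2_eq_square)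
    ultimately show ?thesis using idempotent_constant by (metis (no_types, lifting))
  qed
  then obtain a where "\<And>s y. y \<in> fib s \<Longrightarrow> inverse b * z (s, y) = a" by blast
  thus ?case using \<open>b \<noteq> 0\<close> by (intro exI[of _ a]) (auto simp: b field_simps)
next
  case (Suc m)
  then obtain t where "poly g t = 0" using alg_closed_imp_poly_has_root[of g] by auto
  then obtain h where g: "g = [:- t, 1:] * h" by (metis dvdE poly_eq_0_iff_dvd)
  hence h: "h \<noteq> 0" using Suc.prems by auto
  have gs: "poly g s = (s - t) * poly h s" for s unfolding g by (simp add: left_diff_distrib)
  obtain v where v: "v \<in> polyfuns n" "\<And>s y. y \<in> fib s \<Longrightarrow> z (s, y) = (s - t) * v (s, y)"
    using divide_by_parameter[OF Suc.prems(1), of t h] Suc.prems(3) unfolding gs by blast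
  have "\<exists>a. \<forall>s. \<forall>y\<in>fib s. v (s, y) = poly h s * a"
  proof (rule Suc.hyps(1)[OF _ v(1) h])
    show "m = degree h"
      using Suc.hyps(2) h unfolding g by (subst (asm) degree_mult_eq) auto
    fix s y assume y: "y \<in> fib s"
    have "(\<lambda>w. v w ^ 2 - poly h (fst w) * v w) (s, y) = 0"
    proof (rule vanish_if_cofinite[where S = "{t}", OF _ _ _ y])
      show "(\<lambda>w. v w ^ 2 - poly h (fst w) * v w) \<in> polyfuns n" using v(1) by (intro polyfuns_intros)
      fix s y assume s: "s \<notin> {t}" and y: "y \<in> fib s"
      have "(s - t) ^ 2 * v (s, y) ^ 2 = (s - t) ^ 2 * (poly h s * v (s, y))"
        using Suc.prems(3)[OF y] unfolding v(2)[OF y] gs by (simp add: power_mult_distrib power2_eq_square mult_ac)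
      thus "v (s, y) ^ 2 - poly h (fst (s, y)) * v (s, y) = 0" using s by simp
    qed simp
    thus "v (s, y) ^ 2 = poly h s * v (s, y)" by simp
  qed
  then obtain a where "\<forall>s. \<forall>y\<in>fib s. v (s, y) = poly h s * a" by blast
  thus ?case using v(2) by (intro exI[of _ a]) (simp add: gs mult.assoc)
qed

lemma coeff_prod_linear_polyfuns:
  assumes "finite I" "\<And>i. i \<in> I \<Longrightarrow> f i \<in> polyfuns n"
  shows "(\<lambda>w. coeff (\<Prod>i\<in>I. [:- f i w, 1:]) k) \<in> polyfuns n"
  using assms
proof (induction I arbitrary: k rule: finite_induct)
  case empty
  show ?case using polyfuns_const by (cases k) simp_all
next
  case (insert i I)
  have 1: "(\<lambda>w. coeff (\<Prod>i\<in>I. [:- f i w, 1:]) j) \<in> polyfuns n" for j by (intro insert.IH insert.prems) auto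
  have eq: "coeff (\<Prod>i\<in>insert i I. [:- f i w, 1:]) k =
      (case k of 0 \<Rightarrow> 0 | Suc j \<Rightarrow> coeff (\<Prod>i\<in>I. [:- f i w, 1:]) j) - f i w * coeff (\<Prod>i\<in>I. [:- f i w, 1:]) k" for w
    using insert.hyps by (cases k) simp_all
  show ?case unfolding eq using 1 insert.prems by (cases k) (auto intro!: polyfuns_intros simp del: One_nat_def)
qed

theorem curve_of_ordered_roots_irreducible:
  assumes F: "F \<in> polyfuns n" and G: "G \<in> polyfuns n"
    and FG: "\<And>s y. y \<in> fib s \<Longrightarrow> F (s, y) * G (s, y) = 0"
  shows "(\<forall>s. \<forall>y\<in>fib s. F (s, y) = 0) \<or> (\<forall>s. \<forall>y\<in>fib s. G (s, y) = 0)"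
proof -
  let ?S = "{\<sigma>. \<sigma> permutes {..<n}}"
  have finS: "finite ?S" by (simp add: finite_permutations)
  define N where "N = card ?S"
  define char where "char = (\<lambda>w. \<Prod>\<sigma>\<in>?S. [:- F (fst w, snd w \<circ> \<sigma>), 1:])"
  have deg: "degree (char w) = N" for w
    unfolding char_def N_def by (subst degree_prod_sum_eq) auto
  have lead: "coeff (char w) N = 1" for w
    using lead_coeff_prod[of "\<lambda>\<sigma>. [:- F (fst w, snd w \<circ> \<sigma>), 1:]" ?S] deg[of w] by (simp add: char_def)
  have root: "poly (char w) (F w) = 0" for w
    unfolding char_def poly_prod using finS permutes_id[of "{..<n}"] by (intro prod_zero) (auto intro!: exI[of _ id])
  have "\<exists>A. \<forall>s. \<forall>y\<in>fib s. coeff (char (s, y)) k = poly A s" for k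
  proof -
    have "(\<lambda>w. coeff (char w) k) \<in> polyfuns n"
      unfolding char_def using polyfuns_permute[OF _ F] by (intro coeff_prod_linear_polyfuns finS) auto
    moreover have "char (s, y \<circ> \<pi>) = char (s, y)" if "\<pi> permutes {..<n}" for s y \<pi>
      unfolding char_def using that
      by (intro prod.reindex_bij_witness[of _ "\<lambda>\<sigma>. inv_into UNIV \<pi> \<circ> \<sigma>" "\<lambda>\<sigma>. \<pi> \<circ> \<sigma>"])
         (auto simp: permutes_compose[unfolded o_def] permutes_inv o_def permutes_inverses)
    ultimately show ?thesis using symmetric_polyfun[of "\<lambda>w. coeff (char w) k"] by (metis (no_types, lifting))
  qed
  then obtain A where A: "\<And>k s y. y \<in> fib s \<Longrightarrow> coeff (char (s, y)) k = poly (A k) s" by metis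
  have "A N \<noteq> 0" using A[of _ 0 N] lead fib_nonempty[of 0] by auto
  define r where "r = (LEAST k. A k \<noteq> 0)"
  have r: "A r \<noteq> 0" unfolding r_def by (rule LeastI) fact
  have rN: "r \<le> N" unfolding r_def by (rule Least_le) fact
  have below: "A k = 0" if "k < r" for k using not_less_Least that unfolding r_def by blast
  txt \<open>This \<open>z\<close> is \<open>A\<^sub>r(s)\<close> where \<open>F\<close> vanishes and \<open>0\<close> elsewhere.\<close>
  define z where "z = (\<lambda>w. \<Sum>k\<in>{r..N}. poly (A k) (fst w) * F w ^ (k - r))"
  have z: "z \<in> polyfuns n" unfolding z_def using F by (intro polyfuns_intros)
  have Fz: "F (s, y) ^ r * z (s, y) = 0" if y: "y \<in> fib s" for s y
  proof -
    have "F (s, y) ^ r * z (s, y) = (\<Sum>k\<in>{r..N}. poly (A k) s * F (s, y) ^ k)"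
      unfolding z_def sum_distrib_left by (intro sum.cong) (auto simp: mult.left_commute simp flip: power_add)
    also have "\<dots> = (\<Sum>k\<le>N. poly (A k) s * F (s, y) ^ k)"
      using below by (intro sum.mono_neutral_left) auto
    also have "\<dots> = poly (char (s, y)) (F (s, y))"
      by (simp add: poly_altdef deg A[OF y])
    finally show ?thesis using root by simp
  qed
  have z_if: "z (s, y) = (if F (s, y) = 0 then poly (A r) s else 0)" if y: "y \<in> fib s" for s y
  proof (cases "F (s, y) = 0")
    case True
    have "z (s, y) = (\<Sum>k\<in>{r..N}. if k = r then poly (A r) s else 0)"
      unfolding z_def by (intro sum.cong) (auto simp: True)
    thus ?thesis using True rN by simp
  next
    case False
    thus ?thesis using Fz[OF y] by simp
  qed
  have "\<exists>a. \<forall>s. \<forall>y\<in>fib s. z (s, y) = poly (A r) s * a"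
    by (rule quasi_idempotent_constant[OF z r]) (simp add: z_if power2_eq_square)
  then obtain a where a: "\<And>s y. y \<in> fib s \<Longrightarrow> z (s, y) = poly (A r) s * a" by blast
  have fin: "finite {s. poly (A r) s = 0}" using r by (rule poly_roots_finite)
  show ?thesis
  \<comment> \<open>Over the parameters where \<open>A r\<close> does not vanish,
    \<open>a = 0\<close> means that \<open>F\<close> has no zero, so \<open>G = 0\<close> there,
    while \<open>a \<noteq> 0\<close> means that \<open>F\<close> vanishes at every point.\<close>
  proof (cases "a = 0")
    case True
    have "G (s, y) = 0" if "s \<notin> {s. poly (A r) s = 0}" "y \<in> fib s" for s y
      using a[OF that(2)] z_if[OF that(2)] FG[OF that(2)] that(1) True by (auto split: if_splits)
    thus ?thesis using vanish_if_cofinite[OF G fin] by blast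
  next
    case False
    have "F (s, y) = 0" if "s \<notin> {s. poly (A r) s = 0}" "y \<in> fib s" for s y
      using a[OF that(2)] z_if[OF that(2)] that(1) False by (auto split: if_splits)
    thus ?thesis using vanish_if_cofinite[OF F fin] by blast
  qed
qed

end

section \<open>Finite extensions\<close>

lemma dvd_if_common_root:
  fixes f g :: "'a::field poly" and h :: "'a \<Rightarrow> 'b::field"
  assumes h: "field_hom h" and f: "irreducible f"
    and fa: "poly (map_poly h f) a = 0" and ga: "poly (map_poly h g) a = 0"
  shows "f dvd g"
proof -
  interpret h: field_hom h by fact
  interpret hp: map_poly_idom_hom h ..
  define I where "I = {p. p \<noteq> 0 \<and> poly (map_poly h p) a = 0}"
  have "f \<in> I" using f fa by (auto simp: I_def irreducible_def)
  then obtain m where m: "m \<in> I" and min: "\<And>p. p \<in> I \<Longrightarrow> degree m \<le> degree p"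
    using ex_has_least_nat[of "\<lambda>p. p \<in> I" f degree] by auto
  have m0: "m \<noteq> 0" "poly (map_poly h m) a = 0" using m by (auto simp: I_def)
  have dvd: "m dvd p" if p: "poly (map_poly h p) a = 0" for p
  proof (rule ccontr)
    assume "\<not> m dvd p"
    hence ne: "p mod m \<noteq> 0" by (simp add: dvd_eq_mod_eq_0)
    have "p = p div m * m + p mod m" by simp
    hence "map_poly h p = map_poly h (p div m) * map_poly h m + map_poly h (p mod m)"
      by (metis hp.hom_add hp.hom_mult)
    hence "poly (map_poly h (p mod m)) a = 0" using p m0 by simp
    hence "p mod m \<in> I" using ne by (simp add: I_def)
    moreover have "degree (p mod m) < degree m"
      using degree_mod_less[of m p] m0 ne by simp
    ultimately show False using min by fastforce
  qed
  obtain q where q: "f = m * q" using dvd[OF fa] by blast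
  have "\<not> is_unit m"
  proof
    assume "is_unit m"
    then obtain c where c: "m = [:c:]" "c \<noteq> 0" using is_unit_poly_iff by (metis is_unit_iff_degree degree_eq_zeroE m0(1) pCons_0_0)
    thus False using m0(2) by simp
  qed
  hence "is_unit q" using irreducibleD[OF f q] by blast
  hence "f dvd m" unfolding q by simp
  thus ?thesis using dvd[OF ga] dvd_trans by blast
qed

locale finite_extension =
  fixes \<iota> :: "'k::field \<Rightarrow> 'e::field" and n :: nat
  assumes hom: "field_hom \<iota>" and dim_n: "ext_degree \<iota> = n" and n_pos: "n > 0"
begin

sublocale field_hom \<iota> by (rule hom)
sublocale P: map_poly_inj_idom_hom \<iota> ..

abbreviation (input) sc where "sc \<equiv> \<lambda>c x. \<iota> c * x"

sublocale V: vector_space sc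
  by unfold_locales (simp_all add: hom_distribs algebra_simps)

lemma dim_UNIV: "V.dim UNIV = n"
  using dim_n by (simp add: ext_degree_def)

definition basis :: "'e set" where
  "basis = (SOME B. V.independent B \<and> V.span B = UNIV \<and> finite B)"

lemma basis: "V.independent basis" "V.span basis = UNIV" "finite basis"
proof -
  obtain B where B: "V.independent B" "UNIV \<subseteq> V.span B" "card B = V.dim UNIV"
    using V.basis_exists[of UNIV] by auto
  \<comment> \<open>Infinite sets have \<open>card\<close> equal to \<open>0\<close>, so
    \<open>n > 0\<close> excludes the convention of degree \<open>0\<close> for infinite
    extensions.\<close>
  hence "finite B" using n_pos dim_UNIV by (intro card_ge_0_finite) simp
  hence "\<exists>B. V.independent B \<and> V.span B = UNIV \<and> finite B" using B by blast
  from someI_ex[OF this] show "V.independent basis" "V.span basis = UNIV" "finite basis"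
    unfolding basis_def by blast+
qed

sublocale F: finite_dimensional_vector_space sc basis
  using basis by unfold_locales

abbreviation ev :: "'k poly \<Rightarrow> 'e \<Rightarrow> 'e" where
  "ev g a \<equiv> poly (map_poly \<iota> g) a"

lemma ev_mult: "ev (p * q) a = ev p a * ev q a"
  and ev_add: "ev (p + q) a = ev p a + ev q a"
  and ev_diff: "ev (p - q) a = ev p a - ev q a"
  and ev_const: "ev [:c:] a = \<iota> c"
  by (simp_all add: hom_distribs)

lemma ev_altdef: "degree p < m \<Longrightarrow> ev p a = (\<Sum>j<m. \<iota> (coeff p j) * a ^ j)"
proof -
  assume d: "degree p < m"
  have "ev p a = (\<Sum>j\<le>degree p. \<iota> (coeff p j) * a ^ j)" by (simp add: poly_altdef)
  also have "\<dots> = (\<Sum>j<m. \<iota> (coeff p j) * a ^ j)"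
    using d by (intro sum.mono_neutral_left) (auto simp: coeff_eq_0)
  finally show ?thesis .
qed

text \<open>The factor \<open>w\<close> allows for the translates \<open>k(a) w\<close> in the tower
  law; \<open>w = 1\<close> gives the powers of \<open>a\<close>.\<close>

lemma independent_powers:
  assumes "w \<noteq> 0" and "\<And>g. ev g a = 0 \<Longrightarrow> g \<noteq> 0 \<Longrightarrow> d \<le> degree g"
  shows "V.independent ((\<lambda>j. a ^ j * w) ` {..<d})" "inj_on (\<lambda>j. a ^ j * w) {..<d}"
proof -
  have no_rel: "u j = 0" if "(\<Sum>j<d. \<iota> (u j) * (a ^ j * w)) = 0" "j < d" for u j
  proof -
    define g where "g = (\<Sum>j<d. monom (u j) j)"
    have cg: "coeff g k = (if k < d then u k else 0)" for k by (simp add: g_def coeff_sum)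
    have deg: "g \<noteq> 0 \<Longrightarrow> degree g < d"
      using cg by (metis leading_coeff_0_iff)
    have "ev g a = (\<Sum>j<d. \<iota> (u j) * a ^ j)"
      unfolding g_def by (simp add: hom_distribs poly_sum poly_monom)
    hence "ev g a * w = 0" using that(1) by (simp add: sum_distrib_right mult.assoc)
    hence "g = 0" using assms deg by force
    thus ?thesis using cg[of j] that(2) by simp
  qed
  show inj: "inj_on (\<lambda>j. a ^ j * w) {..<d}"
  proof (rule inj_onI, rule ccontr)
    fix i j assume ij: "i \<in> {..<d}" "j \<in> {..<d}" "a ^ i * w = a ^ j * w" "i \<noteq> j"
    define u where "u = (\<lambda>k. if k = i then 1 else if k = j then - 1 else (0::'k))"
    have "(\<Sum>k<d. \<iota> (u k) * (a ^ k * w)) = (\<Sum>k<d. if k = i then a ^ i * w else 0) - (\<Sum>k<d. if k = j then a ^ j * w else 0)"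
      unfolding sum_subtractf[symmetric] using ij(4) by (intro sum.cong) (auto simp: u_def hom_distribs)
    also have "\<dots> = 0" using ij by simp
    finally have "u i = 0" using no_rel ij by auto
    thus False by (simp add: u_def)
  qed
  show "V.independent ((\<lambda>j. a ^ j * w) ` {..<d})"
  proof
    assume "V.dependent ((\<lambda>j. a ^ j * w) ` {..<d})"
    then obtain U v where U: "v \<in> (\<lambda>j. a ^ j * w) ` {..<d}" "U v \<noteq> 0"
      "(\<Sum>v\<in>(\<lambda>j. a ^ j * w) ` {..<d}. \<iota> (U v) * v) = 0"
      using V.dependent_finite[of "(\<lambda>j. a ^ j * w) ` {..<d}"] by auto
    from U(3) have "(\<Sum>j<d. \<iota> (U (a ^ j * w)) * (a ^ j * w)) = 0"
      by (subst (asm) sum.reindex[OF inj]) (simp add: o_def)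
    from no_rel[of "\<lambda>j. U (a ^ j * w)", OF this] U(1,2) show False by auto
  qed
qed

lemma exists_annihilator: "\<exists>g. g \<noteq> 0 \<and> ev g a = 0"
proof (rule ccontr)
  assume none: "\<not> ?thesis"
  have *: "\<And>g. ev g a = 0 \<Longrightarrow> g \<noteq> 0 \<Longrightarrow> Suc n \<le> degree g" using none by blast
  note ind = independent_powers[of 1 a "Suc n", OF _ *]
  have "card ((\<lambda>j. a ^ j * 1) ` {..<Suc n}) \<le> V.dim UNIV"
    by (rule F.independent_card_le_dim) (use ind in auto)
  also have "card ((\<lambda>j. a ^ j * 1) ` {..<Suc n}) = Suc n" using ind by (subst card_image) auto
  finally show False unfolding dim_UNIV by simp
qed

lemma minimal_polynomial:
  obtains f where "lead_coeff f = 1" "irreducible f" "ev f a = 0"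
    "\<And>g. ev g a = 0 \<Longrightarrow> g \<noteq> 0 \<Longrightarrow> degree f \<le> degree g"
proof -
  define I where "I = {p. p \<noteq> 0 \<and> ev p a = 0}"
  obtain g where "g \<in> I" using exists_annihilator unfolding I_def by blast
  then obtain m where m: "m \<in> I" and min: "\<And>p. p \<in> I \<Longrightarrow> degree m \<le> degree p"
    using ex_has_least_nat[of "\<lambda>p. p \<in> I" g degree] by auto
  define c where "c = lead_coeff m"
  have c: "c \<noteq> 0" using m by (simp add: c_def I_def)
  define f where "f = Polynomial.smult (inverse c) m"
  have deg: "degree f = degree m" using c by (simp add: f_def)
  have fI: "f \<in> I" using m c by (simp add: I_def f_def hom_distribs)
  have "irreducible f"
  proof (rule irreducibleI)
    show "f \<noteq> 0" using fI by (simp add: I_def)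
    show "\<not> is_unit f"
    proof
      assume "is_unit f"
      hence "degree f = 0" by (simp add: is_unit_iff_degree \<open>f \<noteq> 0\<close>)
      then obtain b where "f = [:b:]" using degree_eq_zeroE by blast
      thus False using fI by (simp add: I_def ev_const)
    qed
    fix p q assume pq: "f = p * q"
    have "ev p a * ev q a = 0" using fI by (simp add: I_def pq ev_mult)
    moreover have ne: "p \<noteq> 0" "q \<noteq> 0" using pq \<open>f \<noteq> 0\<close> by auto
    ultimately have "p \<in> I \<or> q \<in> I" by (simp add: I_def)
    moreover have "degree f = degree p + degree q" using pq ne by (simp add: degree_mult_eq)
    ultimately have "degree p = 0 \<or> degree q = 0" using min deg by fastforce
    thus "is_unit p \<or> is_unit q" using ne is_unit_iff_degree by blast
  qed
  moreover have "lead_coeff f = 1" using c by (simp add: f_def c_def[symmetric])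
  moreover have "ev f a = 0" using fI by (simp add: I_def)
  ultimately show ?thesis using min that[of f] deg by (simp add: I_def)
qed

text \<open>The ring \<open>k[a]\<close>; it is already the field \<open>k(a)\<close>, by
  \<open>adj_inverse\<close>.\<close>

definition adj :: "'e \<Rightarrow> 'e set" where
  "adj a = range (\<lambda>g. ev g a)"

lemma adj_gen: "a \<in> adj a"
  unfolding adj_def by (rule image_eqI[of _ _ "[:0, 1:]"]) (simp_all add: hom_distribs)

lemma adj_const: "\<iota> c \<in> adj a"
  unfolding adj_def by (rule image_eqI[of _ _ "[:c:]"]) (simp_all add: hom_distribs)

lemma adj_add: "x \<in> adj a \<Longrightarrow> y \<in> adj a \<Longrightarrow> x + y \<in> adj a"
  and adj_diff: "x \<in> adj a \<Longrightarrow> y \<in> adj a \<Longrightarrow> x - y \<in> adj a"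
  and adj_mult: "x \<in> adj a \<Longrightarrow> y \<in> adj a \<Longrightarrow> x * y \<in> adj a"
  unfolding adj_def using ev_add ev_diff ev_mult by (auto simp flip: ev_add ev_diff ev_mult)

lemma adj_power: "x \<in> adj a \<Longrightarrow> x ^ k \<in> adj a"
  by (induction k) (use adj_const[of 1] in \<open>auto intro: adj_mult\<close>)

lemma adj_sum: "(\<And>i. i \<in> I \<Longrightarrow> f i \<in> adj a) \<Longrightarrow> sum f I \<in> adj a"
  by (induction I rule: infinite_finite_induct) (use adj_const[of 0] in \<open>auto intro: adj_add\<close>)

lemma adj_ev: "x \<in> adj a \<Longrightarrow> ev g x \<in> adj a"
  unfolding poly_altdef by (auto intro!: adj_sum adj_mult adj_power adj_const)

lemma adj_subset: "x \<in> adj a \<Longrightarrow> adj x \<subseteq> adj a"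
  using adj_ev by (auto simp: adj_def[of x])

text \<open>By minimality the constant coefficient \<open>c\<close> of the minimal polynomial of
  \<open>x\<close> is nonzero; solving \<open>c + x g(x) = 0\<close> gives the inverse.\<close>

lemma adj_inverse:
  assumes "x \<in> adj a"
  shows "inverse x \<in> adj a"
proof (cases "x = 0")
  case False
  obtain f where f: "irreducible f" "ev f x = 0"
    and min: "\<And>g. ev g x = 0 \<Longrightarrow> g \<noteq> 0 \<Longrightarrow> degree f \<le> degree g"
    using minimal_polynomial by metis
  obtain c g where fc: "f = pCons c g" by (cases f) auto
  have "c \<noteq> 0"
  proof
    assume "c = 0"
    hence "g \<noteq> 0" using f fc by (auto simp: irreducible_def)
    moreover have "ev g x = 0" using f(2) False by (simp add: fc \<open>c = 0\<close> hom_distribs)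
    ultimately show False using min[of g] fc by simp
  qed
  have "\<iota> c + x * ev g x = 0" using f(2) by (simp add: fc hom_distribs)
  hence "x * ev g x = - \<iota> c" by (simp add: eq_neg_iff_add_eq_0 add.commute)
  hence "\<iota> (- inverse c) * (x * ev g x) = 1" using \<open>c \<noteq> 0\<close> by (simp add: hom_distribs)
  hence "x * (\<iota> (- inverse c) * ev g x) = 1" by (simp only: mult.left_commute)
  hence "inverse x = \<iota> (- inverse c) * ev g x" using inverse_unique by blast
  thus ?thesis using assms by (simp only:) (intro adj_mult adj_const adj_ev)
qed (use adj_const[of 0] in auto)

lemma span_powers_translate:
  assumes "lead_coeff f = 1" "ev f a = 0" "irreducible f"
    and min: "\<And>g. ev g a = 0 \<Longrightarrow> g \<noteq> 0 \<Longrightarrow> degree f \<le> degree g" and w: "w \<noteq> 0"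
  shows "V.subspace ((\<lambda>x. x * w) ` adj a)" "V.dim ((\<lambda>x. x * w) ` adj a) = degree f"
proof -
  let ?W = "(\<lambda>x. x * w) ` adj a" and ?d = "degree f"
  show sub: "V.subspace ?W"
  proof (rule V.subspaceI)
    show "0 \<in> ?W" using adj_const[of 0 a] by (intro image_eqI[of _ _ 0]) auto
    show "x + y \<in> ?W" if "x \<in> ?W" "y \<in> ?W" for x y
      using that adj_add by (auto simp flip: distrib_right)
    show "\<iota> c * x \<in> ?W" if "x \<in> ?W" for c x
      using that adj_mult[OF adj_const] by (auto simp flip: mult.assoc)
  qed
  show "V.dim ?W = ?d"
  proof (rule V.dim_unique)
    show "(\<lambda>j. a ^ j * w) ` {..<?d} \<subseteq> ?W" using adj_power[OF adj_gen] by auto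
    show "V.independent ((\<lambda>j. a ^ j * w) ` {..<?d})" by (rule independent_powers[OF w min])
    show "card ((\<lambda>j. a ^ j * w) ` {..<?d}) = ?d"
      using independent_powers(2)[OF w min] by (subst card_image) auto
    show "?W \<subseteq> V.span ((\<lambda>j. a ^ j * w) ` {..<?d})"
    proof safe
      fix x assume "x \<in> adj a"
      then obtain g where g: "x = ev g a" by (auto simp: adj_def)
      have "g = g div f * f + g mod f" by simp
      hence "x = ev (g mod f) a" using assms(2) unfolding g by (metis ev_add ev_mult mult_zero_right add_0)
      moreover have "degree (g mod f) < ?d"
      proof -
        have "?d > 0" using assms(2,3) assms(1)
          by (metis irreducible_def gr0I is_unit_iff_degree)
        moreover from this have "f \<noteq> 0" by auto
        ultimately show ?thesis using degree_mod_less[of f g] by (cases "g mod f = 0") auto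
      qed
      ultimately have "x * w = (\<Sum>j<?d. \<iota> (coeff (g mod f) j) * (a ^ j * w))"
        by (simp add: ev_altdef sum_distrib_right mult.assoc)
      thus "x * w \<in> V.span ((\<lambda>j. a ^ j * w) ` {..<?d})"
        by (simp only:) (intro V.span_sum V.span_scale V.span_base, auto)
    qed
  qed
qed

lemma dim_adj:
  assumes "lead_coeff f = 1" "ev f a = 0" "irreducible f"
    and min: "\<And>g. ev g a = 0 \<Longrightarrow> g \<noteq> 0 \<Longrightarrow> degree f \<le> degree g"
  shows "V.subspace (adj a)" "V.dim (adj a) = degree f"
  using span_powers_translate[OF assms, of 1] by simp_all

text \<open>The tower law, by adding translates of \<open>k(a)\<close> one at a time.\<close>

lemma degree_dvd_n:
  assumes f: "lead_coeff f = 1" "ev f a = 0" "irreducible f"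
    and min: "\<And>g. ev g a = 0 \<Longrightarrow> g \<noteq> 0 \<Longrightarrow> degree f \<le> degree g"
  shows "degree f dvd n"
proof -
  define good where "good = {S. V.subspace S \<and> (\<forall>x\<in>adj a. \<forall>s\<in>S. x * s \<in> S) \<and> degree f dvd V.dim S}"
  have bounded: "V.dim S \<le> n" for S using F.dim_subset[of S UNIV] dim_UNIV by simp
  have dim0: "V.dim {0} = 0" by (rule V.dim_unique[of "{}"]) (auto simp: V.independent_empty)
  have "{0} \<in> good" using dim0 by (auto simp: good_def V.subspace_def)
  then obtain S where S: "S \<in> good" and max: "\<And>T. T \<in> good \<Longrightarrow> V.dim T \<le> V.dim S"
    using ex_has_greatest_nat[of "\<lambda>S. S \<in> good" "{0}" V.dim "Suc n"] bounded
    by (auto simp: less_Suc_eq_le)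
  have "S = UNIV"
  proof (rule ccontr)
    assume "S \<noteq> UNIV"
    then obtain w where w: "w \<notin> S" by blast
    have S': "V.subspace S" "\<And>x s. x \<in> adj a \<Longrightarrow> s \<in> S \<Longrightarrow> x * s \<in> S" "degree f dvd V.dim S"
      using S by (auto simp: good_def)
    hence w0: "w \<noteq> 0" using w V.subspace_0 by blast
    let ?W = "(\<lambda>x. x * w) ` adj a"
    note W = span_powers_translate[OF f min w0]
    \<comment> \<open>A nonzero \<open>x\<close> with \<open>x w\<close> in \<open>S\<close> is
      invertible in \<open>k(a)\<close>, so it would bring \<open>w\<close> itself into
      \<open>S\<close>.\<close>
    have "S \<inter> ?W = {0}"
    proof -
      have "x = 0" if x: "x \<in> adj a" "x * w \<in> S" for x
      proof (rule ccontr)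
        assume "x \<noteq> 0"
        have "inverse x * (x * w) \<in> S" by (rule S'(2)[OF adj_inverse[OF x(1)] x(2)])
        thus False using w \<open>x \<noteq> 0\<close> by (simp flip: mult.assoc)
      qed
      moreover have "0 \<in> S" "0 \<in> ?W" using S'(1) W(1) V.subspace_0 by blast+
      ultimately show ?thesis by auto
    qed
    moreover define T where "T = {x + y |x y. x \<in> S \<and> y \<in> ?W}"
    ultimately have dT: "V.dim T = V.dim S + degree f"
      using F.dim_sums_Int[OF S'(1) W(1)] W(2) dim0 by simp
    have "T \<in> good"
      unfolding good_def
    proof (intro CollectI conjI ballI)
      show "V.subspace T" unfolding T_def by (rule V.subspace_sums[OF S'(1) W(1)])
      show "degree f dvd V.dim T" using dT S'(3) by simp
      fix x s assume x: "x \<in> adj a" and "s \<in> T"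
      then obtain u v where s: "s = u + v * w" "u \<in> S" "v \<in> adj a" unfolding T_def by blast
      have "x * s = x * u + (x * v) * w" by (simp add: s(1) algebra_simps)
      thus "x * s \<in> T" unfolding T_def using S'(2)[OF x s(2)] adj_mult[OF x s(3)] by blast
    qed
    from max[OF this] dT have "degree f = 0" by simp
    thus False using f by (metis irreducible_def is_unit_iff_degree)
  qed
  thus ?thesis using S dim_UNIV by (auto simp: good_def)
qed

end

section \<open>Separability and primitive elements\<close>

lemma irreducible_degree_pos: "irreducible (f :: 'a::field poly) \<Longrightarrow> 0 < degree f"
  by (metis irreducible_def gr0I is_unit_iff_degree)

text \<open>A multiple root makes \<open>f\<close> divide \<open>f'\<close>. As the characteristic
  does not divide the degree, \<open>f'\<close> is nonzero and of smaller degree than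
  \<open>f\<close>.\<close>

lemma separable_root_simple:
  fixes f :: "'a::field poly" and h :: "'a \<Rightarrow> 'b::field"
  assumes h: "field_hom h" and f: "irreducible f" and f': "\<not> CHAR('a) dvd degree f"
    and a: "poly (map_poly h f) a = 0"
  shows "poly (pderiv (map_poly h f)) a \<noteq> 0"
proof
  interpret h: field_hom h by fact
  assume "poly (pderiv (map_poly h f)) a = 0"
  hence "poly (map_poly h (pderiv f)) a = 0" by (simp add: h.map_poly_pderiv)
  hence dvd: "f dvd pderiv f" by (rule dvd_if_common_root[OF h f a])
  have "coeff (pderiv f) (degree f - 1) = of_nat (degree f) * lead_coeff f"
    using irreducible_degree_pos[OF f] by (simp add: coeff_pderiv)
  also have "\<dots> \<noteq> 0" using f f' by (auto simp: of_nat_eq_0_iff_char_dvd irreducible_def)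
  finally have "pderiv f \<noteq> 0" by auto
  hence "degree f \<le> degree (pderiv f)" by (rule dvd_imp_degree_le[OF dvd])
  thus False using irreducible_degree_pos[OF f] degree_pderiv_le[of f] by simp
qed

text \<open>Polynomials over the subfield \<open>L\<close> are kept as polynomials over the big
  field with coefficients in \<open>L\<close>; subtracting \<open>monom c k * m\<close> removes the
  leading term without leaving \<open>L\<close>.\<close>

lemma minimal_polynomial_over_set_dvd:
  fixes m p :: "'e::field poly"
  assumes L: "\<And>x y. x \<in> L \<Longrightarrow> y \<in> L \<Longrightarrow> x - y \<in> L" "\<And>x y. x \<in> L \<Longrightarrow> y \<in> L \<Longrightarrow> x * y \<in> L"
      "\<And>x. x \<in> L \<Longrightarrow> inverse x \<in> L" "0 \<in> L"
    and m: "\<And>i. coeff m i \<in> L" "lead_coeff m = 1" "poly m a = 0"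
    and min: "\<And>q. (\<And>i. coeff q i \<in> L) \<Longrightarrow> lead_coeff q = 1 \<Longrightarrow> poly q a = 0 \<Longrightarrow> degree m \<le> degree q"
    and p: "\<And>i. coeff p i \<in> L" "poly p a = 0"
  shows "m dvd p"
  using p
proof (induction "degree p" arbitrary: p rule: less_induct)
  case less
  show ?case
  proof (cases "p = 0")
    case False
    define c where "c = lead_coeff p"
    have c: "c \<noteq> 0" "c \<in> L" using False less.prems by (auto simp: c_def)
    have "degree m \<le> degree (Polynomial.smult (inverse c) p)"
      using less.prems c L by (intro min) (auto simp: c_def[symmetric])
    hence deg: "degree m \<le> degree p" using c by simp
    define k where "k = degree p - degree m"
    define q where "q = p - monom c k * m"
    have cq: "coeff q i = coeff p i - (if i < k then 0 else c * coeff m (i - k))" for i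
      unfolding q_def coeff_diff by (simp add: coeff_monom_mult)
    have "coeff q i \<in> L" for i
      unfolding cq using L less.prems m c by auto
    moreover have "poly q a = 0" using less.prems m by (simp add: q_def)
    moreover have "q = 0 \<or> degree q < degree p"
    proof -
      have "coeff q i = 0" if "i \<ge> degree p" for i
      proof (cases "i = degree p")
        case True
        thus ?thesis using deg m(2) by (simp add: cq k_def c_def)
      next
        case False
        hence "i > degree p" "i - k > degree m" using that deg by (auto simp: k_def)
        thus ?thesis by (simp add: cq coeff_eq_0)
      qed
      thus ?thesis by (metis leading_coeff_0_iff linorder_not_le)
    qed
    ultimately have "m dvd q" using less.hyps[of q] by (metis dvd_0_right)
    hence "m dvd q + monom c k * m" by (intro dvd_add) simp_all
    thus ?thesis by (simp add: q_def)
  qed simp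
qed

context finite_extension
begin

text \<open>The classical choice \<open>\<gamma> = \<theta> + c \<alpha>\<close>. The minimal
  polynomial \<open>m\<close> of \<open>\<alpha>\<close> over \<open>k(\<gamma>)\<close> divides
  both \<open>g\<close> and \<open>f(\<gamma> - c X)\<close>; for suitable \<open>c\<close> these
  share only the root \<open>\<alpha>\<close>, and \<open>g\<close> is separable, so
  \<open>m\<close> is linear.\<close>

lemma adj_contains_both:
  assumes inf: "infinite (UNIV :: 'k set)" and char: "\<not> CHAR('k) dvd n"
  shows "\<exists>c. \<theta> \<in> adj c \<and> \<alpha> \<in> adj c"
proof -
  interpret T: field_hom "to_ac :: 'e \<Rightarrow> 'e alg_closure" by unfold_locales auto
  interpret TP: map_poly_inj_idom_hom "to_ac :: 'e \<Rightarrow> 'e alg_closure" ..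
  obtain f where f: "lead_coeff f = 1" "irreducible f" "ev f \<theta> = 0"
    using minimal_polynomial by metis
  obtain g where g: "lead_coeff g = 1" "irreducible g" "ev g \<alpha> = 0"
    and gmin: "\<And>h. ev h \<alpha> = 0 \<Longrightarrow> h \<noteq> 0 \<Longrightarrow> degree g \<le> degree h"
    using minimal_polynomial by metis
  \<comment> \<open>By the tower law the degree of \<open>g\<close> is not divisible by the
    characteristic, which makes \<open>g\<close> separable.\<close>
  have "degree g dvd n" using degree_dvd_n g gmin by blast
  hence gsep: "\<not> CHAR('k) dvd degree g" using char dvd_trans by blast
  define fE where "fE = map_poly \<iota> f"
  define gE where "gE = map_poly \<iota> g"
  define A where "A = {x. poly (map_poly to_ac fE) x = 0}"
  define B where "B = {x. poly (map_poly to_ac gE) x = 0}"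
  have "fE \<noteq> 0" "gE \<noteq> 0" using f g by (auto simp: fE_def gE_def)
  hence fin: "finite A" "finite B"
    unfolding A_def B_def by (intro poly_roots_finite; simp)+
  \<comment> \<open>The values of \<open>c\<close> for which \<open>\<gamma> - c y\<close> is again
    a root of \<open>f\<close> for some root \<open>y \<noteq> \<alpha>\<close> of \<open>g\<close>.
    Pairs with second entry \<open>\<alpha>\<close> contribute only the value \<open>0\<close>, as
    division by zero.\<close>
  define bad where "bad = (\<lambda>(x, y). (x - to_ac \<theta>) / (to_ac \<alpha> - y)) ` (A \<times> B)"
  have "infinite (range (\<lambda>c. to_ac (\<iota> c)))"
    using inf by (auto dest!: finite_imageD simp: inj_on_def)
  moreover have "finite bad" unfolding bad_def using fin by simp
  ultimately obtain c where c: "to_ac (\<iota> c) \<notin> bad" by (metis (mono_tags, lifting) finite_subset image_subset_iff)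
  define \<gamma> where "\<gamma> = \<theta> + \<iota> c * \<alpha>"
  define fc where "fc = fE \<circ>\<^sub>p [:\<gamma>, - \<iota> c:]"
  define L where "L = adj \<gamma>"
  have L: "x \<in> L \<Longrightarrow> y \<in> L \<Longrightarrow> x - y \<in> L" "x \<in> L \<Longrightarrow> y \<in> L \<Longrightarrow> x * y \<in> L" "x \<in> L \<Longrightarrow> y \<in> L \<Longrightarrow> x + y \<in> L"
     "x \<in> L \<Longrightarrow> inverse x \<in> L" "\<iota> b \<in> L" "\<gamma> \<in> L" for x y b
    using adj_diff adj_mult adj_add adj_inverse adj_const adj_gen by (auto simp: L_def)
  have L0: "0 \<in> L" "1 \<in> L" using L(5)[of 0] L(5)[of 1] by simp_all
  have prodL: "\<forall>i. coeff (p * q) i \<in> L" if "\<forall>i. coeff p i \<in> L" "\<forall>i. coeff q i \<in> L" for p q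
    unfolding coeff_mult L_def using that by (auto intro!: adj_sum adj_mult simp: L_def)
  have fcL: "\<forall>i. coeff (p \<circ>\<^sub>p [:\<gamma>, - \<iota> c:]) i \<in> L" if "\<forall>i. coeff p i \<in> L" for p
    using that
  proof (induction p)
    case (pCons b p)
    have b: "b \<in> L" "\<forall>i. coeff p i \<in> L"
      using pCons.prems by (auto simp: coeff_pCons split: nat.splits)
    have "- \<iota> c \<in> L" using L(1)[OF L0(1) L(5)] by simp
    hence lin: "\<forall>i. coeff [:\<gamma>, - \<iota> c:] i \<in> L" using L(6) L0(1) by (simp add: coeff_pCons split: nat.split)
    have "\<forall>i. coeff [:b:] i \<in> L" using b(1) L0(1) by (simp add: coeff_pCons split: nat.split)
    thus ?case unfolding pcompose_pCons coeff_add using prodL[OF lin pCons.IH[OF b(2)]] L(3) by blast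
  qed (simp add: L0)
  define I where "I = {q. (\<forall>i. coeff q i \<in> L) \<and> lead_coeff q = 1 \<and> poly q \<alpha> = 0}"
  have "gE \<in> I" using g L(5) by (simp add: I_def gE_def)
  then obtain m where m: "m \<in> I" and mmin: "\<And>q. q \<in> I \<Longrightarrow> degree m \<le> degree q"
    using ex_has_least_nat[of "\<lambda>p. p \<in> I" gE degree] by auto
  have dvd: "m dvd p" if p: "\<And>i. coeff p i \<in> L" "poly p \<alpha> = 0" for p
  proof (rule minimal_polynomial_over_set_dvd[where L = L and m = m and a = \<alpha>])
    show "degree m \<le> degree q"
      if "\<And>i. coeff q i \<in> L" "lead_coeff q = 1" "poly q \<alpha> = 0" for q
      using that by (intro mmin) (simp add: I_def)
  qed (use L L0 m p in \<open>auto simp: I_def\<close>)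
  have mg: "m dvd gE" using dvd[of gE] g L(5) by (simp add: gE_def)
  have "poly fc \<alpha> = 0" using f(3) by (simp add: fc_def poly_pcompose \<gamma>_def fE_def mult.commute)
  hence mf: "m dvd fc" using dvd[of fc] fcL[of fE] L(5) by (simp add: fc_def fE_def)
  have roots: "x = to_ac \<alpha>" if x: "poly (map_poly to_ac m) x = 0" for x
  proof (rule ccontr)
    assume "x \<noteq> to_ac \<alpha>"
    have zero: "poly (map_poly to_ac p) x = 0" if "m dvd p" for p
      using that x by (auto elim!: dvdE simp: TP.hom_mult)
    have "map_poly to_ac [:\<gamma>, - \<iota> c:] = [:to_ac \<gamma>, - to_ac (\<iota> c):]"
      by (rule poly_eqI) (simp add: coeff_map_poly coeff_pCons split: nat.split)
    hence "map_poly to_ac fc = map_poly to_ac fE \<circ>\<^sub>p [:to_ac \<gamma>, - to_ac (\<iota> c):]"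
      by (simp only: fc_def T.map_poly_pcompose)
    hence "poly (map_poly to_ac fE) (to_ac \<gamma> - to_ac (\<iota> c) * x) = 0"
      using zero[OF mf] by (simp add: poly_pcompose mult.commute)
    hence "x \<in> B" "to_ac \<gamma> - to_ac (\<iota> c) * x \<in> A"
      using zero[OF mg] by (simp_all add: B_def A_def)
    hence "((to_ac \<gamma> - to_ac (\<iota> c) * x) - to_ac \<theta>) / (to_ac \<alpha> - x) \<in> bad" unfolding bad_def by force
    also have "((to_ac \<gamma> - to_ac (\<iota> c) * x) - to_ac \<theta>) / (to_ac \<alpha> - x) = to_ac (\<iota> c)"
      using \<open>x \<noteq> to_ac \<alpha>\<close> by (simp add: \<gamma>_def field_simps)
    finally show False using c by simp
  qed
  obtain ys where ys: "root_prod ys = map_poly to_ac m"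
    using root_prod_exists[of "map_poly to_ac m"] m by (auto simp: I_def)
  have ysroot: "x = to_ac \<alpha>" if "x \<in> set ys" for x
    using roots poly_root_prod_eq_0[OF that] ys by simp
  have "distinct ys"
  proof (rule ccontr)
    assume "\<not> distinct ys"
    then obtain b where b: "[:- b, 1:] ^ 2 dvd map_poly to_ac m" using not_distinct_double_root ys by metis
    also have "map_poly to_ac m dvd map_poly to_ac gE" using mg by (auto elim!: dvdE simp: TP.hom_mult)
    finally have *: "poly (map_poly to_ac gE) b = 0" "poly (pderiv (map_poly to_ac gE)) b = 0"
      by (rule double_root_deriv)+
    have comp: "field_hom (\<lambda>x. to_ac (\<iota> x))" by unfold_locales (simp_all add: hom_add hom_mult)
    have "map_poly to_ac gE = map_poly (\<lambda>x. to_ac (\<iota> x)) g"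
      unfolding gE_def by (intro poly_eqI) (simp add: coeff_map_poly)
    thus False using separable_root_simple[OF comp g(2) gsep, of b] * by simp
  qed
  hence "length ys \<le> 1"
    using ysroot distinct_card[of ys] card_mono[of "{to_ac \<alpha>}" "set ys"] by fastforce
  moreover have "degree m = length ys" using degree_root_prod_eq[of ys] ys by simp
  moreover have "degree m \<noteq> 0"
  proof
    assume "degree m = 0"
    then obtain b where "m = [:b:]" using degree_eq_zeroE by blast
    thus False using m by (auto simp: I_def)
  qed
  ultimately have d1: "degree m = 1" by linarith
  have "m = [:coeff m 0, 1:]"
  proof (rule poly_eqI)
    fix i
    show "coeff m i = coeff [:coeff m 0, 1:] i"
      using m d1 coeff_eq_0[of m i] by (cases "i = 0"; cases "i = 1") (auto simp: I_def coeff_pCons split: nat.splits)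
  qed
  moreover have "poly m \<alpha> = 0" using m by (simp add: I_def)
  ultimately have "coeff m 0 + \<alpha> = 0" by (metis poly_pCons poly_0 mult_zero_right add.right_neutral mult_1_right pCons_one poly_1)
  hence "\<alpha> = 0 - coeff m 0" by (simp add: eq_neg_iff_add_eq_0 add.commute)
  also have "\<dots> \<in> L" using m L(1)[OF L0(1)] by (simp add: I_def)
  finally have \<alpha>: "\<alpha> \<in> L" .
  moreover have "\<theta> \<in> L" using L(1)[OF L(6) L(2)[OF L(5) \<alpha>], of c] by (simp add: \<gamma>_def)
  ultimately show ?thesis unfolding L_def by blast
qed

text \<open>Take \<open>\<theta>\<close> with \<open>k(\<theta>)\<close> of largest dimension; an
  element outside would give a larger field by \<open>adj_contains_both\<close>.\<close>

theorem primitive_element_exists: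
  assumes inf: "infinite (UNIV :: 'k set)" and char: "\<not> CHAR('k) dvd n"
  obtains \<theta> f where "irreducible f" "lead_coeff f = 1" "degree f = n"
    "poly (map_poly \<iota> f) \<theta> = 0" "adj \<theta> = UNIV"
proof -
  have sub: "V.subspace (adj a)" for a using dim_adj minimal_polynomial by metis
  have bounded: "V.dim (adj a) \<le> n" for a using F.dim_subset[of "adj a" UNIV] dim_UNIV by simp
  then obtain \<theta> where max: "\<And>a. V.dim (adj a) \<le> V.dim (adj \<theta>)"
    using ex_has_greatest_nat[of "\<lambda>_. True" 0 "\<lambda>a. V.dim (adj a)" "Suc n"] by (auto simp: less_Suc_eq_le)
  have UN: "adj \<theta> = UNIV"
  proof (rule ccontr)
    assume "adj \<theta> \<noteq> UNIV"
    then obtain \<alpha> where \<alpha>: "\<alpha> \<notin> adj \<theta>" by blast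
    obtain c where c: "\<theta> \<in> adj c" "\<alpha> \<in> adj c" using adj_contains_both[OF inf char] by blast
    have "adj \<theta> = adj c"
      using F.subspace_dim_equal[OF sub sub adj_subset[OF c(1)] max] .
    thus False using \<alpha> c by simp
  qed
  obtain f where f: "lead_coeff f = 1" "irreducible f" "ev f \<theta> = 0"
    and fmin: "\<And>h. ev h \<theta> = 0 \<Longrightarrow> h \<noteq> 0 \<Longrightarrow> degree f \<le> degree h"
    using minimal_polynomial by metis
  have "degree f = n" using dim_adj(2)[OF f(1,3,2) fmin] UN dim_UNIV by simp
  thus ?thesis using that f UN by blast
qed

end

section \<open>Polynomial rings in several variables\<close>

definition cnst :: "'a::comm_ring_1 \<Rightarrow> 'a mpoly" where
  "cnst c = Poly_Mapping.single 0 c"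

definition mvar :: "nat \<Rightarrow> 'a::comm_ring_1 mpoly" where
  "mvar i = Poly_Mapping.single (Poly_Mapping.single i 1) 1"

definition power_product :: "(nat \<Rightarrow> 'a::comm_ring_1) \<Rightarrow> (nat \<Rightarrow>\<^sub>0 nat) \<Rightarrow> 'a" where
  "power_product x m = (\<Prod>i\<in>Poly_Mapping.keys m. x i ^ Poly_Mapping.lookup m i)"

lemma power_product_superset:
  assumes "finite I" "Poly_Mapping.keys m \<subseteq> I"
  shows "power_product x m = (\<Prod>i\<in>I. x i ^ Poly_Mapping.lookup m i)"
  unfolding power_product_def using assms by (intro prod.mono_neutral_left) (auto simp: in_keys_iff)

lemma power_product_add: "power_product x (m + m') = power_product x m * power_product x m'"
proof -
  let ?I = "Poly_Mapping.keys m \<union> Poly_Mapping.keys m'"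
  have "power_product x (m + m') = (\<Prod>i\<in>?I. x i ^ Poly_Mapping.lookup (m + m') i)"
    by (rule power_product_superset) (auto dest: keys_add[THEN subsetD])
  also have "\<dots> = (\<Prod>i\<in>?I. x i ^ Poly_Mapping.lookup m i) * (\<Prod>i\<in>?I. x i ^ Poly_Mapping.lookup m' i)"
    by (simp add: lookup_add power_add prod.distrib)
  also have "\<dots> = power_product x m * power_product x m'"
    using power_product_superset[of ?I m x] power_product_superset[of ?I m' x] by simp
  finally show ?thesis .
qed

lemma eval_mpoly_superset:
  assumes "finite I" "Poly_Mapping.keys P \<subseteq> I"
  shows "eval_mpoly P x = (\<Sum>m\<in>I. Poly_Mapping.lookup P m * power_product x m)"
  unfolding eval_mpoly_def power_product_def using assms
  by (intro sum.mono_neutral_left) (auto simp: in_keys_iff)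

lemma eval_mpoly_single: "eval_mpoly (Poly_Mapping.single m c) x = c * power_product x m"
  by (subst eval_mpoly_superset[of "{m}"]) auto

lemma eval_mpoly_add:
  fixes P Q :: "'a::comm_ring_1 mpoly"
  shows "eval_mpoly (P + Q) x = eval_mpoly P x + eval_mpoly Q x"
proof -
  let ?I = "Poly_Mapping.keys P \<union> Poly_Mapping.keys Q"
  have "eval_mpoly (P + Q) x = (\<Sum>m\<in>?I. Poly_Mapping.lookup (P + Q) m * power_product x m)"
    by (rule eval_mpoly_superset) (auto dest: keys_add[THEN subsetD])
  also have "\<dots> = (\<Sum>m\<in>?I. Poly_Mapping.lookup P m * power_product x m) + (\<Sum>m\<in>?I. Poly_Mapping.lookup Q m * power_product x m)"
    by (simp add: lookup_add distrib_right sum.distrib)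
  also have "\<dots> = eval_mpoly P x + eval_mpoly Q x"
    using eval_mpoly_superset[of ?I P x] eval_mpoly_superset[of ?I Q x] by simp
  finally show ?thesis .
qed

lemma eval_mpoly_0 [simp]: "eval_mpoly 0 x = 0"
  by (simp add: eval_mpoly_def)

lemma eval_mpoly_sum:
  fixes f :: "'i \<Rightarrow> 'a::comm_ring_1 mpoly"
  shows "eval_mpoly (\<Sum>i\<in>I. f i) x = (\<Sum>i\<in>I. eval_mpoly (f i) x)"
  by (induction I rule: infinite_finite_induct) (auto simp: eval_mpoly_add)

lemma mpoly_sum_monomials: "P = (\<Sum>m\<in>Poly_Mapping.keys P. Poly_Mapping.single m (Poly_Mapping.lookup P m))"
  by (rule poly_mapping_eqI) (auto simp: lookup_sum lookup_single when_def in_keys_iff)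

lemma mpoly_mult_monomials:
  "P * Q = (\<Sum>m\<in>Poly_Mapping.keys P. \<Sum>m'\<in>Poly_Mapping.keys Q.
     Poly_Mapping.single (m + m') (Poly_Mapping.lookup P m * Poly_Mapping.lookup Q m'))"
  by (subst (1) mpoly_sum_monomials[of P], subst (1) mpoly_sum_monomials[of Q])
     (simp add: sum_product mult_single)

lemma eval_mpoly_mult:
  fixes P Q :: "'a::comm_ring_1 mpoly"
  shows "eval_mpoly (P * Q) x = eval_mpoly P x * eval_mpoly Q x"
proof -
  have "eval_mpoly (P * Q) x = (\<Sum>m\<in>Poly_Mapping.keys P. \<Sum>m'\<in>Poly_Mapping.keys Q.
     Poly_Mapping.lookup P m * Poly_Mapping.lookup Q m' * (power_product x m * power_product x m'))"
    by (subst mpoly_mult_monomials) (simp add: eval_mpoly_sum eval_mpoly_single power_product_add)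
  also have "\<dots> = (\<Sum>m\<in>Poly_Mapping.keys P. Poly_Mapping.lookup P m * power_product x m) *
       (\<Sum>m\<in>Poly_Mapping.keys Q. Poly_Mapping.lookup Q m * power_product x m)"
    unfolding sum_product by (intro sum.cong refl) (simp add: mult_ac)
  finally show ?thesis by (simp add: eval_mpoly_def power_product_def)
qed

lemma eval_mpoly_cnst [simp]: "eval_mpoly (cnst c) x = c"
  by (simp add: cnst_def eval_mpoly_single power_product_def)

lemma eval_mpoly_mvar [simp]: "eval_mpoly (mvar i) x = x i"
  by (simp add: mvar_def eval_mpoly_single power_product_def)

lemma eval_mpoly_uminus:
  fixes P :: "'a::comm_ring_1 mpoly"
  shows "eval_mpoly (- P) x = - eval_mpoly P x"
  using eval_mpoly_add[of P "- P" x] by (simp add: eq_neg_iff_add_eq_0 add.commute)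

lemma eval_mpoly_diff:
  fixes P :: "'a::comm_ring_1 mpoly"
  shows "eval_mpoly (P - Q) x = eval_mpoly P x - eval_mpoly Q x"
  using eval_mpoly_add[of P "- Q" x] by (simp add: eval_mpoly_uminus)

lemma cnst_hom: "cnst 0 = 0" "cnst 1 = 1" "cnst (a + b) = cnst a + cnst b" "cnst (a * b) = cnst a * cnst b"
  by (simp_all add: cnst_def single_add mult_single)

interpretation cnst: comm_ring_hom cnst
  by unfold_locales (simp_all add: cnst_hom)

lemma eval_hom: "comm_ring_hom (\<lambda>P :: 'a::comm_ring_1 mpoly. eval_mpoly P x)"
proof
  have "eval_mpoly (cnst 1) x = 1" by (rule eval_mpoly_cnst)
  thus "eval_mpoly 1 x = 1" by simp
qed (simp_all add: eval_mpoly_add eval_mpoly_mult)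

lemma
  fixes P :: "'a::comm_ring_1 mpoly"
  shows eval_mpoly_power: "eval_mpoly (P ^ k) x = eval_mpoly P x ^ k"
  and eval_mpoly_prod: "eval_mpoly (\<Prod>i\<in>I. f i) x = (\<Prod>i\<in>I. eval_mpoly (f i) x)"
proof -
  interpret comm_ring_hom "\<lambda>P :: 'a mpoly. eval_mpoly P x" by (rule eval_hom)
  show "eval_mpoly (P ^ k) x = eval_mpoly P x ^ k" "eval_mpoly (\<Prod>i\<in>I. f i) x = (\<Prod>i\<in>I. eval_mpoly (f i) x)"
    by (simp_all add: hom_distribs)
qed

lemma eval_poly_map_cnst:
  fixes p :: "'a::comm_ring_1 poly"
  shows "eval_mpoly (poly (map_poly cnst p) Q) x = poly p (eval_mpoly Q x)"
proof -
  interpret e: comm_ring_hom "\<lambda>P :: 'a mpoly. eval_mpoly P x" by (rule eval_hom)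
  interpret c: map_poly_comm_ring_hom "cnst :: 'a \<Rightarrow> _" ..
  show ?thesis by (induction p) (simp_all add: c.map_poly_pCons_hom e.hom_add e.hom_mult)
qed

lemma subring_poly_ring: "is_subring (poly_ring N :: 'a::comm_ring_1 mpoly set)"
  unfolding is_subring_def
proof (intro conjI ballI)
  show "1 \<in> (poly_ring N :: 'a mpoly set)" by (simp add: poly_ring_def)
  fix P Q :: "'a mpoly" assume PQ: "P \<in> poly_ring N" "Q \<in> poly_ring N"
  thus "P - Q \<in> poly_ring N" by (auto simp: poly_ring_def dest!: keys_diff[THEN subsetD])
  show "P * Q \<in> poly_ring N" unfolding poly_ring_def
  proof (intro CollectI ballI)
    fix m assume "m \<in> Poly_Mapping.keys (P * Q)"
    then obtain a b where ab: "m = a + b" "a \<in> Poly_Mapping.keys P" "b \<in> Poly_Mapping.keys Q"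
      using keys_mult by blast
    have "Poly_Mapping.keys a \<union> Poly_Mapping.keys b \<subseteq> {..<N}"
      using ab PQ by (auto simp: poly_ring_def)
    thus "Poly_Mapping.keys m \<subseteq> {..<N}" using keys_add[of a b] ab by blast
  qed
qed

lemma cnst_in_poly_ring: "cnst c \<in> poly_ring N"
  and mvar_in_poly_ring: "i < N \<Longrightarrow> mvar i \<in> poly_ring N"
  by (auto simp: poly_ring_def cnst_def mvar_def split: if_splits)

lemma poly_ring_generators: "poly_ring N \<subseteq> rgen (range cnst \<union> mvar ` {..<N})"
proof
  fix P :: "'a mpoly" assume P: "P \<in> poly_ring N"
  let ?R = "rgen (range cnst \<union> mvar ` {..<N}) :: 'a mpoly set"
  have var_pow: "mvar i ^ k = Poly_Mapping.single (Poly_Mapping.single i k) (1 :: 'a)" for i k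
    by (induction k) (simp_all add: mvar_def mult_single flip: single_add)
  have sum_single: "(\<Sum>i\<in>Poly_Mapping.keys m. Poly_Mapping.single i (Poly_Mapping.lookup m i)) = m"
    for m :: "nat \<Rightarrow>\<^sub>0 nat"
    by (rule poly_mapping_eqI) (auto simp: lookup_sum lookup_single when_def in_keys_iff)
  have "Poly_Mapping.single m c \<in> ?R" if m: "m \<in> Poly_Mapping.keys P" for m c
  proof -
    have "(\<Prod>i\<in>I. Poly_Mapping.single (g i) (1 :: 'a)) = Poly_Mapping.single (\<Sum>i\<in>I. g i) 1"
      for I and g :: "nat \<Rightarrow> (nat \<Rightarrow>\<^sub>0 nat)"
      by (induction I rule: infinite_finite_induct) (simp_all add: mult_single)
    hence "Poly_Mapping.single m c = cnst c * (\<Prod>i\<in>Poly_Mapping.keys m. mvar i ^ Poly_Mapping.lookup m i)"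
      by (simp add: var_pow sum_single cnst_def mult_single)
    moreover have "Poly_Mapping.keys m \<subseteq> {..<N}" using P m by (auto simp: poly_ring_def)
    ultimately show ?thesis
      by (simp only:) (intro rgen_intros rgen.base; blast)
  qed
  thus "P \<in> ?R" by (subst mpoly_sum_monomials) (intro rgen_intros)
qed

lemma lookup_map: "h 0 = 0 \<Longrightarrow> Poly_Mapping.lookup (Poly_Mapping.map h P) m = h (Poly_Mapping.lookup P m)"
  by (simp add: Poly_Mapping.map.rep_eq when_def)

lemma map_mpoly_hom:
  assumes "comm_ring_hom h"
  shows "comm_ring_hom (Poly_Mapping.map h :: 'a::comm_ring_1 mpoly \<Rightarrow> 'b::comm_ring_1 mpoly)"
proof -
  interpret h: comm_ring_hom h by fact
  have single: "Poly_Mapping.map h (Poly_Mapping.single m c) = Poly_Mapping.single m (h c)" for m :: "nat \<Rightarrow>\<^sub>0 nat" and c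
    by (rule poly_mapping_eqI) (simp add: lookup_map lookup_single when_def)
  have add: "Poly_Mapping.map h (P + Q) = Poly_Mapping.map h P + Poly_Mapping.map h Q" for P Q :: "'a mpoly"
    by (rule poly_mapping_eqI) (simp add: lookup_map lookup_add h.hom_add)
  have zero: "Poly_Mapping.map h (0 :: 'a mpoly) = 0"
    by (rule poly_mapping_eqI) (simp add: lookup_map)
  have sum: "Poly_Mapping.map h (\<Sum>i\<in>I. f i) = (\<Sum>i\<in>I. Poly_Mapping.map h (f i))"
    for I :: "(nat \<Rightarrow>\<^sub>0 nat) set" and f :: "(nat \<Rightarrow>\<^sub>0 nat) \<Rightarrow> 'a mpoly"
    by (induction I rule: infinite_finite_induct) (simp_all add: add zero)
  show ?thesis
  proof
    show "Poly_Mapping.map h (1 :: 'a mpoly) = 1" using single[of 0 1] by simp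
    fix P Q :: "'a mpoly"
    show "Poly_Mapping.map h (P + Q) = Poly_Mapping.map h P + Poly_Mapping.map h Q" by (rule add)
    have "Poly_Mapping.map h (P * Q) = (\<Sum>m\<in>Poly_Mapping.keys P. \<Sum>m'\<in>Poly_Mapping.keys Q.
        Poly_Mapping.map h (Poly_Mapping.single m (Poly_Mapping.lookup P m)) *
        Poly_Mapping.map h (Poly_Mapping.single m' (Poly_Mapping.lookup Q m')))"
      by (subst mpoly_mult_monomials) (simp add: sum single mult_single h.hom_mult)
    also have "\<dots> = Poly_Mapping.map h P * Poly_Mapping.map h Q"
      by (subst (3) mpoly_sum_monomials, subst (5) mpoly_sum_monomials) (simp add: sum sum_product)
    finally show "Poly_Mapping.map h (P * Q) = Poly_Mapping.map h P * Poly_Mapping.map h Q" .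
  qed (rule zero)
qed

lemma map_in_poly_ring:
  assumes "h 0 = 0" "P \<in> poly_ring N"
  shows "Poly_Mapping.map h P \<in> poly_ring N"
  using assms by (auto simp: poly_ring_def in_keys_iff lookup_map)

lemma ideal_ideal_generated: "is_ideal (poly_ring N) (ideal_generated N (B :: 'a::comm_ring_1 mpoly set))"
  unfolding is_ideal_def
proof (intro conjI ballI)
  note PR = subring_intros[OF subring_poly_ring[of N]]
  show "0 \<in> ideal_generated N B" unfolding ideal_generated_def
    by (intro CollectI exI[of _ "{}"] exI[of _ "\<lambda>_. 0"]) simp
  fix S T assume "S \<in> ideal_generated N B" "T \<in> ideal_generated N B"
  then obtain G Q G' Q' where *: "S = (\<Sum>P\<in>G. Q P * P)" "finite G" "G \<subseteq> B" "\<forall>P\<in>G. Q P \<in> poly_ring N"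
    "T = (\<Sum>P\<in>G'. Q' P * P)" "finite G'" "G' \<subseteq> B" "\<forall>P\<in>G'. Q' P \<in> poly_ring N"
    unfolding ideal_generated_def by blast
  define R where "R = (\<lambda>P. (if P \<in> G then Q P else 0) + (if P \<in> G' then Q' P else 0))"
  have "(\<Sum>P\<in>G. Q P * P) = (\<Sum>P\<in>G \<union> G'. (if P \<in> G then Q P else 0) * P)"
    using * by (intro sum.mono_neutral_cong_left) auto
  moreover have "(\<Sum>P\<in>G'. Q' P * P) = (\<Sum>P\<in>G \<union> G'. (if P \<in> G' then Q' P else 0) * P)"
    using * by (intro sum.mono_neutral_cong_left) auto
  ultimately have "S + T = (\<Sum>P\<in>G \<union> G'. R P * P)"
    using * by (simp add: R_def distrib_right sum.distrib)
  moreover have "\<forall>P\<in>G \<union> G'. R P \<in> poly_ring N" using * by (auto simp: R_def intro: PR)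
  ultimately show "S + T \<in> ideal_generated N B"
    unfolding ideal_generated_def using * by (intro CollectI exI[of _ "G \<union> G'"] exI[of _ R]) auto
next
  fix A S :: "'a mpoly" assume A: "A \<in> poly_ring N" and "S \<in> ideal_generated N B"
  then obtain G Q where *: "S = (\<Sum>P\<in>G. Q P * P)" "finite G" "G \<subseteq> B" "\<forall>P\<in>G. Q P \<in> poly_ring N"
    unfolding ideal_generated_def by blast
  have "A * S = (\<Sum>P\<in>G. (A * Q P) * P)" by (simp add: * sum_distrib_left mult.assoc)
  thus "A * S \<in> ideal_generated N B"
    unfolding ideal_generated_def using * A
    by (intro CollectI exI[of _ G] exI[of _ "\<lambda>P. A * Q P"]) (auto intro: subring_mult[OF subring_poly_ring])
qed

lemma generator_in_ideal: "(P :: 'a::comm_ring_1 mpoly) \<in> B \<Longrightarrow> P \<in> ideal_generated N B"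
  unfolding ideal_generated_def
  by (intro CollectI exI[of _ "{P}"] exI[of _ "\<lambda>_. 1"]) (auto intro: subring_one[OF subring_poly_ring])

lemma ideal_generated_vanishes:
  fixes P :: "'a::comm_ring_1 mpoly"
  assumes "P \<in> ideal_generated N B" "\<And>Q. Q \<in> B \<Longrightarrow> eval_mpoly Q x = 0"
  shows "eval_mpoly P x = 0"
proof -
  obtain G Q where *: "P = (\<Sum>R\<in>G. Q R * R)" "G \<subseteq> B"
    using assms(1) unfolding ideal_generated_def by blast
  have "eval_mpoly (Q R) x * eval_mpoly R x = 0" if "R \<in> G" for R
    using * assms(2) that by auto
  thus ?thesis by (simp add: * eval_mpoly_sum eval_mpoly_mult)
qed

lemma ideal_generated_subset:
  fixes B :: "'a::comm_ring_1 mpoly set"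
  assumes "B \<subseteq> poly_ring N"
  shows "ideal_generated N B \<subseteq> poly_ring N"
  using assms unfolding ideal_generated_def
  by (auto intro!: subring_sum[OF subring_poly_ring] subring_mult[OF subring_poly_ring])

lemma zariski_irreducibleI:
  fixes V :: "(nat \<Rightarrow> 'a::comm_ring_1) set"
  assumes V: "V \<subseteq> affine_space N"
    and prod: "\<And>p q. p \<in> poly_ring N \<Longrightarrow> q \<in> poly_ring N \<Longrightarrow>
      (\<And>w. w \<in> V \<Longrightarrow> eval_mpoly p w * eval_mpoly q w = 0) \<Longrightarrow>
      (\<forall>w\<in>V. eval_mpoly p w = 0) \<or> (\<forall>w\<in>V. eval_mpoly q w = 0)"
  shows "zariski_irreducible N V"
  unfolding zariski_irreducible_def
proof (intro allI impI)
  fix A B assume AB: "zariski_closed N A \<and> zariski_closed N B \<and> V = A \<union> B"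
  then obtain SA SB where SA: "SA \<subseteq> poly_ring N" "A = zero_locus N SA"
    and SB: "SB \<subseteq> poly_ring N" "B = zero_locus N SB"
    unfolding zariski_closed_def by blast
  show "V = A \<or> V = B"
  proof (rule ccontr)
    assume "\<not> (V = A \<or> V = B)"
    then obtain v w where vw: "v \<in> V" "v \<notin> A" "w \<in> V" "w \<notin> B" using AB by blast
    obtain p where p: "p \<in> SA" "eval_mpoly p v \<noteq> 0" using vw V by (auto simp: SA zero_locus_def)
    obtain q where q: "q \<in> SB" "eval_mpoly q w \<noteq> 0" using vw V by (auto simp: SB zero_locus_def)
    have "eval_mpoly p x * eval_mpoly q x = 0" if "x \<in> V" for x
    proof -
      have "x \<in> A \<or> x \<in> B" using that AB by blast
      thus ?thesis using p q by (auto simp: SA zero_locus_def SB)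
    qed
    from prod[OF _ _ this] p q vw SA(1) SB(1) show False by blast
  qed
qed

text \<open>Inversion of a Vandermonde system without division: it is enough that the differences
  \<open>y_i - y_j\<close> can be cancelled modulo \<open>Q\<close>. The lemma is applied with
  \<open>Q\<close> equal to \<open>{0}\<close>, to the ideal \<open>J\<close> of the twisted curve,
  and to the set \<open>G\<close> in \<open>clear_denominators\<close>.\<close>

lemma coeffs_from_values:
  fixes y :: "nat \<Rightarrow> 'r::comm_ring_1" and R :: "'r poly"
  assumes P: "is_subring P" and y: "\<And>i. i < n \<Longrightarrow> y i \<in> P"
    and Q0: "0 \<in> Q" and Qdiff: "\<And>a b. a \<in> Q \<Longrightarrow> b \<in> Q \<Longrightarrow> a - b \<in> Q"
    and Qmult: "\<And>i a. i < n \<Longrightarrow> a \<in> Q \<Longrightarrow> y i * a \<in> Q"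
    and cancel: "\<And>i j a. i < n \<Longrightarrow> j < n \<Longrightarrow> i \<noteq> j \<Longrightarrow> a \<in> P \<Longrightarrow> (y i - y j) * a \<in> Q \<Longrightarrow> a \<in> Q"
    and RP: "\<And>k. coeff R k \<in> P" and deg: "\<And>k. k \<ge> n \<Longrightarrow> coeff R k = 0"
    and val: "\<And>i. i < n \<Longrightarrow> poly R (y i) \<in> Q"
  shows "coeff R k \<in> Q"
  using y Qmult cancel RP deg val
proof (induction n arbitrary: R k)
  case 0
  thus ?case using Q0 by simp
next
  case (Suc n)
  \<comment> \<open>Newton's scheme: for the quotient \<open>S\<close> of \<open>R\<close> by
    \<open>Y - y_n\<close> one has \<open>(y_i - y_n) S(y_i) = R(y_i) - R(y_n)\<close>, so
    \<open>S\<close> satisfies the assumptions with one node less.\<close>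
  define S where "S = synthetic_div R (y n)"
  have R: "R = [:- y n, 1:] * S + [:poly R (y n):]"
    unfolding S_def using synthetic_div_correct'[of "y n" R] by simp
  have coeff_R: "coeff R (Suc j) = coeff S j - y n * coeff S (Suc j)" for j
    by (subst R) simp
  have S0: "coeff S j = 0" if "j \<ge> n" for j
  proof -
    have "degree R \<le> n" using Suc.prems(5) by (intro degree_le) auto
    moreover have "degree S = degree R - 1" by (simp add: S_def degree_synthetic_div)
    ultimately have "S = 0 \<or> degree S < n"
      by (cases "degree R = 0") (auto simp: S_def synthetic_div_eq_0_iff)
    thus ?thesis using that by (auto intro: coeff_eq_0)
  qed
  have Qadd: "a + b \<in> Q" if "a \<in> Q" "b \<in> Q" for a b
    using Qdiff[OF that(1) Qdiff[OF Q0 that(2)]] by simp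
  have SP: "coeff S j \<in> P" for j
  proof (induction "n - j" arbitrary: j rule: less_induct)
    case less
    show ?case
    proof (cases "j \<ge> n")
      case True
      thus ?thesis using S0 subring_zero[OF P] by simp
    next
      case False
      hence "coeff S (Suc j) \<in> P" by (intro less) auto
      moreover have "coeff S j = coeff R (Suc j) + y n * coeff S (Suc j)" by (simp add: coeff_R)
      ultimately show ?thesis using Suc.prems(1,4) by (auto intro!: subring_intros[OF P])
    qed
  qed
  have val: "poly S (y i) \<in> Q" if i: "i < n" for i
  proof (rule Suc.prems(3)[of i n])
    have "poly R (y i) = (y i - y n) * poly S (y i) + poly R (y n)"
      by (subst R) (simp add: algebra_simps)
    hence "(y i - y n) * poly S (y i) = poly R (y i) - poly R (y n)" by simp
    thus "(y i - y n) * poly S (y i) \<in> Q" using Qdiff Suc.prems(6) i by simp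
    show "poly S (y i) \<in> P" unfolding poly_altdef using Suc.prems(1) i SP
      by (intro subring_intros[OF P]) auto
  qed (use i in auto)
  have SQ: "coeff S j \<in> Q" for j
  proof (rule Suc.IH)
    show "b \<in> Q" if "i < n" "j < n" "i \<noteq> j" "b \<in> P" "(y i - y j) * b \<in> Q" for i j b
      using Suc.prems(3)[of i j b] that by simp
  qed (use Suc.prems S0 SP val in auto)
  show ?case
  proof (cases k)
    case 0
    have "coeff R 0 = poly R (y n) - y n * coeff S 0" by (subst R) simp
    thus ?thesis using 0 Suc.prems(2,6) SQ Qdiff by simp
  next
    case (Suc j)
    thus ?thesis using coeff_R[of j] Suc.prems(2) SQ Qdiff by simp
  qed
qed

lemma interpolation_exists:
  fixes a b :: "nat \<Rightarrow> 'a::field"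
  assumes "inj_on a {..<n}"
  shows "\<exists>p. (\<forall>k\<ge>n. coeff p k = 0) \<and> (\<forall>i<n. poly p (a i) = b i)"
  using assms
proof (induction n)
  case 0
  show ?case by (intro exI[of _ 0]) simp
next
  case (Suc n)
  then obtain p where p: "\<And>k. k \<ge> n \<Longrightarrow> coeff p k = 0" "\<And>i. i < n \<Longrightarrow> poly p (a i) = b i"
    by (auto simp: inj_on_def)
  define q where "q = root_prod (map a [0..<n])"
  have root: "poly (root_prod (map a xs)) x = (\<Prod>i\<leftarrow>xs. x - a i)" for xs x
    by (induction xs) (auto simp: root_prod_Cons left_diff_distrib)
  have q0: "poly q (a i) = 0" if "i < n" for i
    unfolding q_def using that by (intro poly_root_prod_eq_0) auto
  have "a n - a i \<noteq> 0" if "i < n" for i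
    using inj_onD[OF Suc.prems, of n i] that by auto
  hence "0 \<notin> set (map (\<lambda>i. a n - a i) [0..<n])" by (metis (no_types, lifting) imageE set_map atLeastLessThan_iff set_upt)
  hence qn: "poly q (a n) \<noteq> 0" unfolding q_def root prod_list_zero_iff .
  have qdeg: "coeff q k = 0" if "k > n" for k
    using that degree_root_prod_eq[of "map a [0..<n]"] by (intro coeff_eq_0) (simp add: q_def)
  define r where "r = p + Polynomial.smult ((b n - poly p (a n)) / poly q (a n)) q"
  have "poly r (a i) = b i" if "i < Suc n" for i
    using that p q0 qn by (cases "i = n") (auto simp: r_def)
  moreover have "coeff r k = 0" if "k \<ge> Suc n" for k
    using that p qdeg by (simp add: r_def)
  ultimately show ?case by blast
qed

lemma monic_division:
  fixes g p :: "'r::comm_ring_1 poly"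
  assumes R: "is_subring R" and g: "\<And>k. coeff g k \<in> R" "coeff g n = 1" "degree g = n"
    and p: "\<And>k. coeff p k \<in> R"
  shows "\<exists>q r. p = q * g + r \<and> (\<forall>k. coeff r k \<in> R) \<and> (\<forall>k\<ge>n. coeff r k = 0)"
  using p
proof (induction p)
  case 0
  show ?case by (rule exI[of _ 0], rule exI[of _ 0]) (auto intro: subring_zero[OF R])
next
  case (pCons c p)
  have c: "c \<in> R" using pCons.prems[of 0] by simp
  have "coeff p k \<in> R" for k using pCons.prems[of "Suc k"] by simp
  then obtain q r where qr: "p = q * g + r" "\<And>k. coeff r k \<in> R" "\<And>k. k \<ge> n \<Longrightarrow> coeff r k = 0"
    using pCons.IH by blast
  define b where "b = coeff (pCons c r) n"
  have pr: "coeff (pCons c r) k \<in> R" for k using c qr(2) by (cases k) auto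
  define s where "s = pCons c r - Polynomial.smult b g"
  have "pCons c p = (pCons 0 q + [:b:]) * g + s"
    by (simp add: s_def qr(1) algebra_simps)
  moreover have "coeff s k \<in> R" for k
    using pr[of k] pr[of n] g(1) unfolding s_def coeff_diff coeff_smult b_def by (intro subring_intros[OF R])
  moreover have "coeff s k = 0" if "k \<ge> n" for k
  proof (cases "k = n")
    case False
    hence "k > n" using that by simp
    hence "coeff g k = 0" using g(3) by (intro coeff_eq_0) simp
    moreover have "coeff (pCons c r) k = 0" using \<open>k > n\<close> qr(3) by (cases k) auto
    ultimately show ?thesis by (simp add: s_def)
  qed (simp add: s_def b_def g(2))
  ultimately show ?case by blast
qed

section \<open>The twisted curve\<close>

text \<open>
  The variables are \<open>X\<^sub>0, \<dots>, X\<^bsub>n-1\<^esub>\<close>, \<open>U\<^sub>0, \<dots>, U\<^bsub>n-1\<^esub>\<close> and \<open>T\<close>, numbered in this order. They encode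
  \<open>\<eta> = \<Sum>X\<^sub>j \<theta>\<^sup>j\<close>, with conjugates \<open>y\<^sub>i = \<Sum>X\<^sub>j a\<^sub>i\<^sup>j\<close>, subject to \<open>M(\<eta>) + T = 0\<close> and \<open>\<Sum>U\<^sub>j \<eta>\<^sup>j = \<theta>\<close>.
\<close>

definition twist_coord :: "nat \<Rightarrow> (nat \<Rightarrow> 'a::comm_ring_1) \<Rightarrow> nat \<Rightarrow> 'a mpoly" where
  "twist_coord n a i = (\<Sum>j<n. mvar j * cnst (a i ^ j))"

definition value_eqn :: "nat \<Rightarrow> (nat \<Rightarrow> 'a::comm_ring_1) \<Rightarrow> 'a poly \<Rightarrow> nat \<Rightarrow> 'a mpoly" where
  "value_eqn n a M i = poly (map_poly cnst M) (twist_coord n a i) + mvar (2 * n)"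

definition inverse_eqn :: "nat \<Rightarrow> (nat \<Rightarrow> 'a::comm_ring_1) \<Rightarrow> nat \<Rightarrow> 'a mpoly" where
  "inverse_eqn n a i = (\<Sum>j<n. mvar (n + j) * twist_coord n a i ^ j) - cnst (a i)"

lemma subring_poly_coeffs:
  assumes R: "is_subring R"
  shows "is_subring {p. \<forall>k. coeff p k \<in> R}"
  unfolding is_subring_def
  by (auto simp: coeff_mult intro!: subring_sum[OF R] subring_mult[OF R] subring_diff[OF R])
     (auto simp: coeff_1 subring_one[OF R] subring_zero[OF R])

lemma pcompose_coeffs_in_subring:
  assumes R: "is_subring R" and p: "\<forall>k. coeff p k \<in> R" and q: "\<forall>k. coeff q k \<in> R"
  shows "\<forall>k. coeff (p \<circ>\<^sub>p q) k \<in> R"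
  using p
proof (induction p)
  case 0
  show ?case using subring_zero[OF R] by simp
next
  case (pCons c p)
  note C = subring_intros[OF subring_poly_coeffs[OF R]]
  have c: "c \<in> R" using pCons.prems by (metis coeff_pCons_0)
  have p: "\<forall>k. coeff p k \<in> R" using pCons.prems by (metis coeff_pCons_Suc)
  have "[:c:] \<in> {p. \<forall>k. coeff p k \<in> R}" using c subring_zero[OF R] by (auto simp: coeff_pCons split: nat.split)
  moreover have "q \<in> {p. \<forall>k. coeff p k \<in> R}" "p \<circ>\<^sub>p q \<in> {p. \<forall>k. coeff p k \<in> R}"
    using q pCons.IH p by auto
  ultimately have "[:c:] + q * (p \<circ>\<^sub>p q) \<in> {p. \<forall>k. coeff p k \<in> R}" by (intro C)
  thus ?case by (simp add: pcompose_pCons)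
qed

lemma map_mpoly_cnst: "h 0 = 0 \<Longrightarrow> Poly_Mapping.map h (cnst c) = cnst (h c)"
  by (rule poly_mapping_eqI) (simp add: lookup_map cnst_def lookup_single when_def)

lemma map_mpoly_mvar: "h 0 = 0 \<Longrightarrow> h 1 = 1 \<Longrightarrow> Poly_Mapping.map h (mvar i) = mvar i"
  by (rule poly_mapping_eqI) (simp add: lookup_map mvar_def lookup_single when_def)

lemma to_ac_hom: "field_hom (to_ac :: 'k::field \<Rightarrow> 'k alg_closure)"
  by unfold_locales auto

text \<open>
  Reduction modulo \<open>f\<close> turns the conjugate equations \<open>p(a\<^sub>i) = 0\<close>, where \<open>a\<^sub>i\<close> runs through the
  roots of \<open>f\<close>, into equations over the base field.
\<close>

lemma reduce_modulo_f:
  fixes f :: "'k::field poly" and p :: "'k mpoly poly"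
  assumes f: "lead_coeff f = 1" "degree f = n" and p: "\<forall>k. coeff p k \<in> poly_ring N"
  shows "\<exists>r. (\<forall>l. r l \<in> poly_ring N) \<and> (\<forall>\<alpha>. poly (map_poly to_ac f) \<alpha> = 0 \<longrightarrow>
     poly (map_poly (Poly_Mapping.map to_ac) p) (cnst \<alpha>) = (\<Sum>l<n. Poly_Mapping.map to_ac (r l) * cnst (\<alpha> ^ l)))"
proof -
  interpret T: field_hom "to_ac :: 'k \<Rightarrow> 'k alg_closure" by (rule to_ac_hom)
  interpret m: comm_ring_hom "Poly_Mapping.map to_ac :: 'k mpoly \<Rightarrow> 'k alg_closure mpoly"
    by (rule map_mpoly_hom) unfold_locales
  interpret mp: map_poly_comm_ring_hom "Poly_Mapping.map to_ac :: 'k mpoly \<Rightarrow> 'k alg_closure mpoly" ..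
  let ?h = "Poly_Mapping.map to_ac :: 'k mpoly \<Rightarrow> 'k alg_closure mpoly"
  define g where "g = map_poly cnst f"
  have cg: "coeff g k = cnst (coeff f k)" for k by (simp add: g_def)
  have inj: "cnst c = 0 \<longleftrightarrow> c = 0" for c :: 'k
    using eval_mpoly_cnst[of c "\<lambda>_. 0"] by (metis cnst_hom(1) eval_mpoly_0)
  have degg: "degree g = n"
    using f by (intro antisym degree_le le_degree) (auto simp: cg inj coeff_eq_0)
  obtain q r where qr: "p = q * g + r" "\<And>k. coeff r k \<in> poly_ring N" "\<And>k. k \<ge> n \<Longrightarrow> coeff r k = 0"
    using monic_division[OF subring_poly_ring, of g N n p] degg f p by (auto simp: cg cnst_in_poly_ring)
  have "poly (map_poly ?h p) (cnst \<alpha>) = (\<Sum>l<n. ?h (coeff r l) * cnst (\<alpha> ^ l))"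
    if \<alpha>: "poly (map_poly to_ac f) \<alpha> = 0" for \<alpha>
  proof -
    have "map_poly ?h g = map_poly cnst (map_poly to_ac f)"
      by (rule poly_eqI) (simp add: cg coeff_map_poly map_mpoly_cnst)
    hence "poly (map_poly ?h g) (cnst \<alpha>) = cnst (poly (map_poly to_ac f) \<alpha>)"
      by simp
    hence "poly (map_poly ?h p) (cnst \<alpha>) = poly (map_poly ?h r) (cnst \<alpha>)"
      using \<alpha> by (simp add: qr(1) mp.hom_add mp.hom_mult)
    also have "\<dots> = (\<Sum>l\<le>degree (map_poly ?h r). ?h (coeff r l) * cnst \<alpha> ^ l)"
      by (simp add: poly_altdef)
    also have "\<dots> = (\<Sum>l\<in>{..degree (map_poly ?h r)} \<union> {..<n}. ?h (coeff r l) * cnst \<alpha> ^ l)"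
      using coeff_eq_0[of "map_poly ?h r"] by (intro sum.mono_neutral_left) auto
    also have "\<dots> = (\<Sum>l<n. ?h (coeff r l) * cnst \<alpha> ^ l)"
      using qr(3) by (intro sum.mono_neutral_right) auto
    finally show ?thesis by (simp add: cnst.hom_power)
  qed
  thus ?thesis using qr(2) by (intro exI[of _ "coeff r"]) auto
qed

text \<open>All conjugate equations of one kind arise from a single polynomial over \<open>k\<close>
  in an extra indeterminate, \<open>p1\<close> or \<open>p2\<close>, by inserting
  \<open>a i\<close>. Reduced modulo \<open>f\<close> it has \<open>n\<close> coefficients over
  \<open>k\<close>; these are \<open>r\<close> and \<open>h\<close> respectively.\<close>

lemma equations_over_base_field:
  fixes f M :: "'k::field poly"
  assumes f: "lead_coeff f = 1" "degree f = n"
    and a: "\<And>i. i < n \<Longrightarrow> poly (map_poly to_ac f) (a i) = 0"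
  shows "\<exists>r h. (\<forall>l. r l \<in> poly_ring (2 * n + 1)) \<and> (\<forall>l. h l \<in> poly_ring (2 * n + 1)) \<and>
    (\<forall>i<n. value_eqn n a (map_poly to_ac M) i = (\<Sum>l<n. Poly_Mapping.map to_ac (r l) * cnst (a i ^ l)) \<and>
           inverse_eqn n a i = (\<Sum>l<n. Poly_Mapping.map to_ac (h l) * cnst (a i ^ l)))"
proof -
  interpret T: field_hom "to_ac :: 'k \<Rightarrow> 'k alg_closure" by (rule to_ac_hom)
  interpret m: comm_ring_hom "Poly_Mapping.map to_ac :: 'k mpoly \<Rightarrow> 'k alg_closure mpoly"
    by (rule map_mpoly_hom) unfold_locales
  interpret mp: map_poly_comm_ring_hom "Poly_Mapping.map to_ac :: 'k mpoly \<Rightarrow> 'k alg_closure mpoly" ..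
  let ?h = "Poly_Mapping.map to_ac :: 'k mpoly \<Rightarrow> 'k alg_closure mpoly"
  let ?N = "2 * n + 1"
  let ?C = "{p :: 'k mpoly poly. \<forall>k. coeff p k \<in> poly_ring ?N}"
  note C = subring_intros[OF subring_poly_coeffs[OF subring_poly_ring[of ?N]]]
  \<comment> \<open>The generic element \<open>\<eta>\<close> with the indeterminate in place of
    \<open>\<theta>\<close>; \<open>\<phi> i\<close> will insert the root
    \<open>a i\<close>.\<close>
  define g :: "'k mpoly poly" where "g = (\<Sum>j<n. monom (mvar j) j)"
  have cst: "[:c:] \<in> ?C" if "c \<in> poly_ring ?N" for c
    using that subring_zero[OF subring_poly_ring] by (auto simp: coeff_pCons split: nat.split)
  have g: "g \<in> ?C"
    unfolding g_def
    by (intro C) (auto simp: coeff_monom intro: mvar_in_poly_ring subring_zero[OF subring_poly_ring])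
  define \<phi> where "\<phi> = (\<lambda>i (p :: 'k mpoly poly). poly (map_poly ?h p) (cnst (a i)))"
  have "map_poly ?h [:c:] = [:?h c:]" for c
    by (rule poly_eqI) (simp add: coeff_map_poly coeff_pCons split: nat.split)
  moreover have "map_poly ?h [:0, 1:] = [:0, 1:]"
    by (rule poly_eqI) (simp add: coeff_map_poly coeff_pCons split: nat.split)
  ultimately have \<phi>_hom: "\<phi> i (p + q) = \<phi> i p + \<phi> i q" "\<phi> i (p * q) = \<phi> i p * \<phi> i q" "\<phi> i (p - q) = \<phi> i p - \<phi> i q"
     "\<phi> i 0 = 0" "\<phi> i 1 = 1" "\<phi> i [:c:] = ?h c" "\<phi> i [:0, 1:] = cnst (a i)" for i p q c
    by (simp_all add: \<phi>_def mp.hom_add mp.hom_mult mp.hom_minus)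
  have \<phi>_sum: "\<phi> i (\<Sum>j\<in>J. q j) = (\<Sum>j\<in>J. \<phi> i (q j))" for i q and J :: "nat set"
    by (induction J rule: infinite_finite_induct) (simp_all add: \<phi>_hom)
  have \<phi>_pow: "\<phi> i (p ^ j) = \<phi> i p ^ j" for i p j
    by (induction j) (simp_all add: \<phi>_hom)
  have \<phi>g: "\<phi> i g = twist_coord n a i" for i
    unfolding g_def \<phi>_sum twist_coord_def
    by (intro sum.cong refl) (simp add: \<phi>_def poly_monom map_mpoly_mvar cnst.hom_power)
  have \<phi>_comp: "\<phi> i (map_poly cnst M \<circ>\<^sub>p g) = poly (map_poly cnst (map_poly to_ac M)) (twist_coord n a i)" for i
  proof -
    have "map_poly ?h (map_poly cnst M) = map_poly cnst (map_poly to_ac M)"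
      by (rule poly_eqI) (simp add: coeff_map_poly map_mpoly_cnst)
    moreover have "\<phi> i (map_poly cnst M \<circ>\<^sub>p g) = poly (map_poly ?h (map_poly cnst M)) (\<phi> i g)"
      by (simp add: \<phi>_def m.map_poly_pcompose poly_pcompose)
    ultimately show ?thesis by (simp only: \<phi>g)
  qed
  define p1 where "p1 = map_poly cnst M \<circ>\<^sub>p g + [:mvar (2 * n):]"
  define p2 where "p2 = (\<Sum>j<n. [:mvar (n + j):] * g ^ j) - [:0, 1:]"
  have "map_poly cnst M \<circ>\<^sub>p g \<in> ?C"
    using pcompose_coeffs_in_subring[OF subring_poly_ring, of "map_poly cnst M" ?N g] g
    by (simp add: cnst_in_poly_ring)
  hence p1: "p1 \<in> ?C" unfolding p1_def by (intro C cst mvar_in_poly_ring) auto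
  have "[:0, 1:] \<in> ?C" using subring_zero[OF subring_poly_ring] subring_one[OF subring_poly_ring]
    by (auto simp: coeff_pCons split: nat.split)
  hence p2: "p2 \<in> ?C" unfolding p2_def using g by (intro C cst mvar_in_poly_ring) auto
  obtain r where r: "\<And>l. r l \<in> poly_ring ?N"
    "\<And>\<alpha>. poly (map_poly to_ac f) \<alpha> = 0 \<Longrightarrow> poly (map_poly ?h p1) (cnst \<alpha>) = (\<Sum>l<n. ?h (r l) * cnst (\<alpha> ^ l))"
    using reduce_modulo_f[OF f, of p1 ?N] p1 by blast
  obtain h where h: "\<And>l. h l \<in> poly_ring ?N"
    "\<And>\<alpha>. poly (map_poly to_ac f) \<alpha> = 0 \<Longrightarrow> poly (map_poly ?h p2) (cnst \<alpha>) = (\<Sum>l<n. ?h (h l) * cnst (\<alpha> ^ l))"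
    using reduce_modulo_f[OF f, of p2 ?N] p2 by blast
  have "value_eqn n a (map_poly to_ac M) i = \<phi> i p1" for i
    unfolding value_eqn_def p1_def \<phi>_hom \<phi>_comp by (simp add: map_mpoly_mvar)
  moreover have "inverse_eqn n a i = \<phi> i p2" for i
    unfolding inverse_eqn_def p2_def \<phi>_hom \<phi>_sum \<phi>_pow \<phi>g by (simp add: map_mpoly_mvar)
  ultimately show ?thesis using r h a unfolding \<phi>_def by (intro exI[of _ r] exI[of _ h]) simp
qed

lemma hom_coeff_root_prod:
  assumes "comm_ring_hom \<phi>"
  shows "\<phi> (coeff (root_prod ys) k) = coeff (root_prod (map \<phi> ys)) k"
proof -
  interpret comm_ring_hom \<phi> by fact
  show ?thesis
  proof (induction ys arbitrary: k)
    case Nil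
    show ?case by (cases k) simp_all
  next
    case (Cons y ys)
    show ?case by (cases k) (simp_all add: root_prod_Cons Cons hom_minus hom_mult hom_uminus)
  qed
qed

lemma root_prod_coeffs_in_subring:
  assumes R: "is_subring R" and "set ys \<subseteq> R"
  shows "coeff (root_prod ys) k \<in> R"
proof -
  have "root_prod ys \<in> {p. \<forall>k. coeff p k \<in> R}"
    using assms(2)
  proof (induction ys)
    case (Cons y ys)
    have "[:- y, 1:] \<in> {p. \<forall>k. coeff p k \<in> R}"
      using Cons.prems subring_uminus[OF R] subring_zero[OF R] subring_one[OF R]
      by (auto simp: coeff_pCons split: nat.split)
    thus ?case unfolding root_prod_Cons using Cons by (intro subring_mult[OF subring_poly_coeffs[OF R]]) auto
  qed (use subring_one[OF subring_poly_coeffs[OF R]] in simp)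
  thus ?thesis by simp
qed

lemma poly_diff_factor:
  fixes p :: "'r::comm_ring_1 poly"
  assumes R: "is_subring R" and p: "\<And>k. coeff p k \<in> R" and xy: "x \<in> R" "y \<in> R"
  shows "\<exists>w\<in>R. poly p x - poly p y = (x - y) * w"
  using p
proof (induction p)
  case 0
  show ?case by (rule bexI[of _ 0]) (simp_all add: subring_zero[OF R])
next
  case (pCons c p)
  have p: "\<And>k. coeff p k \<in> R" using pCons.prems by (metis coeff_pCons_Suc)
  then obtain w where w: "w \<in> R" "poly p x - poly p y = (x - y) * w" using pCons.IH by blast
  have "poly (pCons c p) x - poly (pCons c p) y = (x - y) * poly p x + y * (poly p x - poly p y)"
    by (simp add: algebra_simps)
  also have "\<dots> = (x - y) * (poly p x + y * w)" unfolding w(2) by (simp add: algebra_simps)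
  finally have "poly (pCons c p) x - poly (pCons c p) y = (x - y) * (poly p x + y * w)" .
  moreover have "poly p x \<in> R" unfolding poly_altdef using p xy by (intro subring_intros[OF R])
  hence "poly p x + y * w \<in> R" using w(1) xy by (intro subring_intros[OF R])
  ultimately show ?case by blast
qed

text \<open>\<open>r\<close> and \<open>h\<close> are the coordinates of the two equations with
  respect to the powers of \<open>\<theta>\<close>; being over \<open>k\<close>, they will generate
  the ideal. The conjugate equations, in which the curve \<open>C\<close> is visible, are their
  combinations by the Vandermonde matrix of the \<open>a i\<close>.\<close>

locale twisted_curve =
  fixes M :: "'k::field poly" and n :: nat and a :: "nat \<Rightarrow> 'k alg_closure" and r h :: "nat \<Rightarrow> 'k mpoly"
  assumes morse: "monic_morse (map_poly to_ac M) n"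
    and inj_a: "inj_on a {..<n}"
    and r_ring: "\<And>l. r l \<in> poly_ring (2 * n + 1)" and h_ring: "\<And>l. h l \<in> poly_ring (2 * n + 1)"
    and value_eqn: "\<And>i. i < n \<Longrightarrow> value_eqn n a (map_poly to_ac M) i = (\<Sum>l<n. Poly_Mapping.map to_ac (r l) * cnst (a i ^ l))"
    and inverse_eqn: "\<And>i. i < n \<Longrightarrow> inverse_eqn n a i = (\<Sum>l<n. Poly_Mapping.map to_ac (h l) * cnst (a i ^ l))"
begin

definition "N = 2 * n + 1"
abbreviation "MK \<equiv> map_poly to_ac M"
abbreviation "PN \<equiv> poly_ring N :: 'k alg_closure mpoly set"
abbreviation "yy \<equiv> twist_coord n a"

sublocale monic_morse MK n by (rule morse)

definition eqns :: "'k mpoly set" where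
  "eqns = r ` {..<n} \<union> h ` {..<n}"

definition J :: "'k alg_closure mpoly set" where
  "J = ideal_generated N (Poly_Mapping.map to_ac ` eqns)"

definition V :: "(nat \<Rightarrow> 'k alg_closure) set" where
  "V = zero_locus N (Poly_Mapping.map to_ac ` eqns)"

lemma eqns_ring: "Poly_Mapping.map to_ac ` eqns \<subseteq> PN"
  using r_ring h_ring by (auto simp: eqns_def N_def[symmetric] intro!: map_in_poly_ring simp del: One_nat_def)

lemma J_ideal: "is_ideal PN J"
  unfolding J_def by (rule ideal_ideal_generated)

lemma PN_subring: "is_subring PN"
  by (rule subring_poly_ring)

lemmas PN_intros = subring_intros[OF PN_subring]
lemmas J_intros = ideal_zero[OF PN_subring J_ideal] ideal_add[OF PN_subring J_ideal] ideal_mult[OF PN_subring J_ideal]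
  ideal_mult_right[OF PN_subring J_ideal] ideal_uminus[OF PN_subring J_ideal] ideal_diff[OF PN_subring J_ideal]
  ideal_sum[OF PN_subring J_ideal]

lemma J_subset: "J \<subseteq> PN"
  unfolding J_def by (rule ideal_generated_subset[OF eqns_ring])

lemma J_vanishes: "q \<in> J \<Longrightarrow> w \<in> V \<Longrightarrow> eval_mpoly q w = 0"
  unfolding J_def V_def zero_locus_def by (rule ideal_generated_vanishes) auto

lemma yy_ring: "yy i \<in> PN"
  unfolding twist_coord_def by (intro PN_intros mvar_in_poly_ring cnst_in_poly_ring) (auto simp: N_def)

lemma value_eqn_J: "i < n \<Longrightarrow> value_eqn n a MK i \<in> J"
  and inverse_eqn_J: "i < n \<Longrightarrow> inverse_eqn n a i \<in> J"
  unfolding value_eqn inverse_eqn J_def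
  by (intro J_intros[unfolded J_def] cnst_in_poly_ring generator_in_ideal; simp add: eqns_def)+

lemma eval_value_eqn: "eval_mpoly (value_eqn n a MK i) w = poly MK (eval_mpoly (yy i) w) + w (2 * n)"
  by (simp add: value_eqn_def eval_mpoly_add eval_poly_map_cnst)

lemma eval_inverse_eqn:
  "eval_mpoly (inverse_eqn n a i) w = (\<Sum>j<n. w (n + j) * eval_mpoly (yy i) w ^ j) - a i"
  by (simp add: inverse_eqn_def eval_mpoly_diff eval_mpoly_sum eval_mpoly_mult eval_mpoly_power)

lemma eval_yy: "eval_mpoly (yy i) w = (\<Sum>j<n. w j * a i ^ j)"
  by (simp add: twist_coord_def eval_mpoly_sum eval_mpoly_mult)

text \<open>The conjugate equations lie in \<open>J\<close>, which gives one direction; the other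
  inverts the Vandermonde matrix of the distinct constants \<open>a i\<close>.\<close>

lemma V_iff: "w \<in> V \<longleftrightarrow> w \<in> affine_space N \<and>
  (\<forall>i<n. eval_mpoly (value_eqn n a MK i) w = 0 \<and> eval_mpoly (inverse_eqn n a i) w = 0)"
proof
  assume "w \<in> V"
  thus "w \<in> affine_space N \<and> (\<forall>i<n. eval_mpoly (value_eqn n a MK i) w = 0 \<and> eval_mpoly (inverse_eqn n a i) w = 0)"
    using J_vanishes value_eqn_J inverse_eqn_J by (auto simp: V_def zero_locus_def)
next
  assume w: "w \<in> affine_space N \<and> (\<forall>i<n. eval_mpoly (value_eqn n a MK i) w = 0 \<and> eval_mpoly (inverse_eqn n a i) w = 0)"
  have coeffs_0: "c l = 0" if "\<And>i. i < n \<Longrightarrow> (\<Sum>l<n. c l * a i ^ l) = 0" "l < n" for c :: "nat \<Rightarrow> 'k alg_closure" and l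
  proof -
    have "coeff (\<Sum>l<n. monom (c l) l) l \<in> {0}"
    proof (rule coeffs_from_values[where P = UNIV and y = a and n = n])
      show "poly (\<Sum>l<n. monom (c l) l) (a i) \<in> {0}" if "i < n" for i
        using \<open>\<And>i. i < n \<Longrightarrow> (\<Sum>l<n. c l * a i ^ l) = 0\<close>[OF that] by (simp add: poly_sum poly_monom)
    qed (use inj_a in \<open>auto simp: is_subring_def coeff_sum inj_on_def\<close>)
    thus ?thesis using that(2) by (simp add: coeff_sum)
  qed
  have "eval_mpoly (Poly_Mapping.map to_ac (r l)) w = 0" if "l < n" for l
  proof (rule coeffs_0[OF _ that])
    fix i assume "i < n"
    thus "(\<Sum>l<n. eval_mpoly (Poly_Mapping.map to_ac (r l)) w * a i ^ l) = 0"
      using w by (auto simp: value_eqn eval_mpoly_sum eval_mpoly_mult)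
  qed
  moreover have "eval_mpoly (Poly_Mapping.map to_ac (h l)) w = 0" if "l < n" for l
  proof (rule coeffs_0[OF _ that])
    fix i assume "i < n"
    thus "(\<Sum>l<n. eval_mpoly (Poly_Mapping.map to_ac (h l)) w * a i ^ l) = 0"
      using w by (auto simp: inverse_eqn eval_mpoly_sum eval_mpoly_mult)
  qed
  ultimately show "w \<in> V" using w by (auto simp: V_def zero_locus_def eqns_def)
qed

text \<open>
  Modulo \<open>J\<close> the differences \<open>y\<^sub>i - y\<^sub>j\<close> are units, because \<open>a\<^sub>i = U(y\<^sub>i)\<close> for a polynomial \<open>U\<close> and
  the \<open>a\<^sub>i\<close> are distinct constants.
\<close>

lemma difference_unit:
  assumes "i < n" "j < n" "i \<noteq> j"
  shows "\<exists>v\<in>PN. v * (yy i - yy j) - 1 \<in> J"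
proof -
  define U where "U = (\<Sum>l<n. monom (mvar (n + l) :: 'k alg_closure mpoly) l)"
  have U: "coeff U k \<in> PN" for k
    unfolding U_def coeff_sum coeff_monom by (intro PN_intros) (auto simp: N_def mvar_in_poly_ring subring_zero[OF subring_poly_ring])
  have ev: "poly U (yy i) = inverse_eqn n a i + cnst (a i)" for i
    by (simp add: U_def poly_sum poly_monom inverse_eqn_def)
  obtain w where w: "w \<in> PN" "poly U (yy i) - poly U (yy j) = (yy i - yy j) * w"
    using poly_diff_factor[OF PN_subring U yy_ring yy_ring] by blast
  define c where "c = a i - a j"
  have "c \<noteq> 0" using inj_a assms by (auto simp: c_def inj_on_def)
  hence c: "cnst (inverse c) * cnst c = 1" by (simp flip: cnst_hom(4) add: cnst_hom(2))
  have "(yy i - yy j) * w = inverse_eqn n a i - inverse_eqn n a j + cnst c"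
    unfolding w(2)[symmetric] ev c_def by (simp add: cnst.hom_minus)
  hence "cnst (inverse c) * w * (yy i - yy j) = cnst (inverse c) * (inverse_eqn n a i - inverse_eqn n a j + cnst c)"
    by (simp add: mult_ac)
  also have "\<dots> = cnst (inverse c) * (inverse_eqn n a i - inverse_eqn n a j) + 1"
    using c by (simp add: distrib_left)
  finally have "cnst (inverse c) * w * (yy i - yy j) - 1 = cnst (inverse c) * (inverse_eqn n a i - inverse_eqn n a j)"
    by simp
  moreover have "cnst (inverse c) * (inverse_eqn n a i - inverse_eqn n a j) \<in> J"
    using assms by (intro J_intros inverse_eqn_J cnst_in_poly_ring)
  moreover have "cnst (inverse c) * w \<in> PN" using w(1) by (intro PN_intros cnst_in_poly_ring)
  ultimately show ?thesis by metis
qed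

lemma cancel_difference:
  assumes "i < n" "j < n" "i \<noteq> j" "q \<in> PN" "(yy i - yy j) * q \<in> J"
  shows "q \<in> J"
proof -
  obtain v where v: "v \<in> PN" "v * (yy i - yy j) - 1 \<in> J" using difference_unit[OF assms(1-3)] by blast
  have "v * ((yy i - yy j) * q) - (v * (yy i - yy j) - 1) * q \<in> J"
    using ideal_diff[OF PN_subring J_ideal] ideal_mult[OF PN_subring J_ideal v(1) assms(5)]
      ideal_mult_right[OF PN_subring J_ideal v(2) assms(4)] by blast
  thus ?thesis by (simp add: algebra_simps)
qed

definition Disc :: "'k alg_closure mpoly" where
  "Disc = (\<Prod>(i, j)\<in>off_diagonal n. yy i - yy j)"

lemma cancel_Disc:
  assumes "q \<in> PN" "Disc ^ e * q \<in> J"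
  shows "q \<in> J"
proof -
  have prod: "q \<in> J" if "finite I" "I \<subseteq> off_diagonal n" "(\<Prod>(i, j)\<in>I. yy i - yy j) * q \<in> J" "q \<in> PN" for I q
    using that
  proof (induction I arbitrary: q rule: finite_induct)
    case (insert x I)
    obtain i j where x: "x = (i, j)" by force
    have ij: "i < n" "j < n" "i \<noteq> j" using insert.prems(1) x by (auto simp: off_diagonal_def)
    have yq: "(yy i - yy j) * q \<in> PN" using insert.prems by (intro PN_intros yy_ring)
    have "(\<Prod>(i, j)\<in>I. yy i - yy j) * ((yy i - yy j) * q) \<in> J"
      using insert.prems(2) insert.hyps by (simp add: x mult_ac)
    hence "(yy i - yy j) * q \<in> J" using insert.IH yq insert.prems by auto
    thus ?case using cancel_difference[OF ij] insert.prems by blast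
  qed simp
  show ?thesis using assms
  proof (induction e)
    case (Suc e)
    have D: "Disc \<in> PN" unfolding Disc_def case_prod_unfold by (intro PN_intros yy_ring)
    have DqP: "Disc ^ e * q \<in> PN" using D Suc.prems(1) by (intro PN_intros)
    have "(\<Prod>(i, j)\<in>off_diagonal n. yy i - yy j) * (Disc ^ e * q) \<in> J"
      using Suc.prems(2) by (simp only: Disc_def[symmetric] power_Suc mult.assoc)
    hence "Disc ^ e * q \<in> J" by (rule prod[OF finite_off_diagonal subset_refl _ DqP])
    thus ?case using Suc by blast
  qed simp
qed

text \<open>The product of all \<open>Y - y_i\<close> is \<open>M + T\<close> modulo
  \<open>J\<close>, which is where \<open>C\<close> reappears, with \<open>s = - T\<close>. The
  difference of both sides has degree below \<open>n\<close> and values in \<open>J\<close> at every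
  \<open>y_i\<close>, and the differences of the \<open>y_i\<close> can be cancelled modulo
  \<open>J\<close>.\<close>

lemma root_prod_yy_coeff:
  "coeff (root_prod (map yy [0..<n])) k - coeff (map_poly cnst MK + [:mvar (2 * n):]) k \<in> J"
proof -
  let ?R = "root_prod (map yy [0..<n]) - (map_poly cnst MK + [:mvar (2 * n):])"
  have "coeff ?R k \<in> J"
  proof (rule coeffs_from_values[OF PN_subring yy_ring, where n = n])
    show "yy i * q \<in> J" if "i < n" "q \<in> J" for i q using that yy_ring by (intro J_intros)
    show "q \<in> J" if "i < n" "j < n" "i \<noteq> j" "q \<in> PN" "(yy i - yy j) * q \<in> J" for i j q
      using cancel_difference that by blast
    fix k
    have "coeff [:mvar (2 * n):] k \<in> PN" by (cases k) (auto simp: N_def mvar_in_poly_ring subring_zero[OF subring_poly_ring])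
    thus "coeff ?R k \<in> PN" unfolding coeff_diff coeff_add
      using yy_ring by (intro PN_intros root_prod_coeffs_in_subring[OF PN_subring]) (auto simp: cnst_in_poly_ring)
    assume k: "n \<le> k"
    have "coeff (root_prod (map yy [0..<n])) k = (if k = n then 1 else 0)"
      using k coeff_root_prod_length[of "map yy [0..<n]"] degree_root_prod_eq[of "map yy [0..<n]"]
      by (auto intro!: coeff_eq_0)
    moreover have "coeff MK k = (if k = n then 1 else 0)"
      using k monic_M coeff_eq_0[of MK k] unfolding degree_M by auto
    moreover have "coeff [:mvar (2 * n) :: 'k alg_closure mpoly:] k = 0" using k n_pos by (cases k) auto
    ultimately show "coeff ?R k = 0" by (simp add: cnst_hom)
  next
    fix i assume "i < n"
    hence "poly (root_prod (map yy [0..<n])) (yy i) = 0" by (intro poly_root_prod_eq_0) auto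
    hence "poly ?R (yy i) = - value_eqn n a MK i" by (simp add: value_eqn_def)
    thus "poly ?R (yy i) \<in> J" using value_eqn_J[OF \<open>i < n\<close>] by (simp only:) (intro J_intros)
  qed (use J_intros in auto)
  thus ?thesis by simp
qed

text \<open>Polynomials in the conjugates \<open>y_i\<close> alone; they can be read as functions on
  \<open>C\<close>.\<close>

abbreviation "YS \<equiv> rgen (range cnst \<union> yy ` {..<n})"

lemma YS_subset: "YS \<subseteq> PN"
  using yy_ring cnst_in_poly_ring by (intro rgen_least[OF PN_subring]) blast

text \<open>Modulo \<open>J\<close> every coordinate is a rational function of the conjugates: the
  \<open>X_j\<close> are linear in them, by inverting the constant Vandermonde matrix of the
  \<open>a i\<close>; \<open>T\<close> is \<open>- M(y_0)\<close>; and the \<open>U_j\<close> solve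
  a Vandermonde system in the \<open>y_i\<close>, which costs powers of \<open>Disc\<close>.\<close>

lemma clear_denominators:
  assumes "q \<in> PN"
  shows "\<exists>e. \<exists>g\<in>YS. Disc ^ e * q - g \<in> J"
proof -
  define G where "G = {q \<in> PN. \<exists>e. \<exists>g\<in>YS. Disc ^ e * q - g \<in> J}"
  have D: "Disc \<in> YS" unfolding Disc_def
    by (rule rgen_intros(9)) (auto simp: off_diagonal_def intro!: rgen_intros(3)[OF rgen.base rgen.base])
  hence DP: "Disc \<in> PN" using YS_subset by blast
  have GI: "q \<in> G" if "q \<in> PN" "g \<in> YS" "Disc ^ e * q - g \<in> J" for q g e
    using that unfolding G_def by blast
  have YG: "g \<in> G" if "g \<in> YS" for g
    using that YS_subset J_intros(1) by (intro GI[of g g 0]) auto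
  have JG: "q \<in> G" if "q \<in> J" for q
    using that J_subset by (intro GI[of q 0 0]) (auto intro: rgen_intros)
  have Gdiff: "q - q' \<in> G" if qG: "q \<in> G" and q'G: "q' \<in> G" for q q'
  proof -
    obtain e g where 1: "q \<in> PN" "g \<in> YS" "Disc ^ e * q - g \<in> J" using qG unfolding G_def by blast
    obtain e' g' where 2: "q' \<in> PN" "g' \<in> YS" "Disc ^ e' * q' - g' \<in> J" using q'G unfolding G_def by blast
    have "Disc ^ e' * (Disc ^ e * q - g) - Disc ^ e * (Disc ^ e' * q' - g') \<in> J"
      using ideal_diff[OF PN_subring J_ideal ideal_mult[OF PN_subring J_ideal _ 1(3)] ideal_mult[OF PN_subring J_ideal _ 2(3)]]
        subring_power[OF PN_subring DP] by blast
    hence "Disc ^ (e + e') * (q - q') - (Disc ^ e' * g - Disc ^ e * g') \<in> J"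
      by (simp add: algebra_simps power_add)
    thus ?thesis using 1 2 D by (intro GI) (auto intro!: PN_intros rgen_intros)
  qed
  have Gmult: "q * q' \<in> G" if qG: "q \<in> G" and q'G: "q' \<in> G" for q q'
  proof -
    obtain e g where 1: "q \<in> PN" "g \<in> YS" "Disc ^ e * q - g \<in> J" using qG unfolding G_def by blast
    obtain e' g' where 2: "q' \<in> PN" "g' \<in> YS" "Disc ^ e' * q' - g' \<in> J" using q'G unfolding G_def by blast
    have "(Disc ^ e * q) * (Disc ^ e' * q') - g * g' \<in> J"
      using 1 2 DP YS_subset by (intro ideal_cong_mult[OF PN_subring J_ideal] PN_intros) auto
    hence "Disc ^ (e + e') * (q * q') - g * g' \<in> J" by (simp add: mult_ac power_add)
    thus ?thesis using 1 2 by (intro GI) (auto intro!: PN_intros rgen_intros)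
  qed
  have Gsub: "is_subring G" using Gdiff Gmult YG[OF rgen.one] by (auto simp: is_subring_def)
  have cstG: "cnst c \<in> G" for c by (intro YG rgen.base) simp
  have yG: "yy i \<in> G" if "i < n" for i using that by (intro YG rgen.base) simp
  have X: "mvar l \<in> G" if l: "l < n" for l
  proof -
    let ?R = "\<Sum>l<n. monom (mvar l :: 'k alg_closure mpoly) l"
    have "coeff ?R l \<in> G"
    proof (rule coeffs_from_values[OF PN_subring cnst_in_poly_ring, where n = n])
      show "0 \<in> G" by (rule subring_zero[OF Gsub])
      show "q \<in> G" if "i < n" "j < n" "i \<noteq> j" "q \<in> PN" "(cnst (a i) - cnst (a j)) * q \<in> G" for i j q
      proof -
        have "a i - a j \<noteq> 0" using inj_a that by (auto simp: inj_on_def)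
        hence one: "cnst (inverse (a i - a j)) * (cnst (a i) - cnst (a j)) = 1"
          by (simp flip: cnst.hom_minus cnst_hom(4) add: cnst_hom(2))
        have "cnst (inverse (a i - a j)) * ((cnst (a i) - cnst (a j)) * q) \<in> G"
          by (intro Gmult cstG that)
        thus ?thesis by (simp only: mult.assoc[symmetric] one mult_1_left)
      qed
      show "poly ?R (cnst (a i)) \<in> G" if "i < n" for i
        using yG[OF that] by (simp add: poly_sum poly_monom twist_coord_def cnst.hom_power)
      show "coeff ?R k \<in> PN" for k unfolding coeff_sum coeff_monom
        by (intro PN_intros) (auto simp: N_def mvar_in_poly_ring subring_zero[OF subring_poly_ring])
    qed (use Gdiff Gmult cstG in \<open>auto simp: coeff_sum\<close>)
    thus ?thesis using l by (simp add: coeff_sum)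
  qed
  have U: "mvar (n + l) \<in> G" if l: "l < n" for l
  proof -
    let ?R = "\<Sum>l<n. monom (mvar (n + l) :: 'k alg_closure mpoly) l"
    have "coeff ?R l \<in> G"
    proof (rule coeffs_from_values[OF PN_subring yy_ring, where n = n])
      show "0 \<in> G" by (rule subring_zero[OF Gsub])
      show "q \<in> G" if ij: "i < n" "j < n" "i \<noteq> j" and q: "q \<in> PN" "(yy i - yy j) * q \<in> G" for i j q
      proof -
        obtain e g where g: "g \<in> YS" "Disc ^ e * ((yy i - yy j) * q) - g \<in> J" using q(2) unfolding G_def by blast
        \<comment> \<open>The cofactor of \<open>yy i - yy j\<close> in \<open>Disc\<close>: one
          more power of \<open>Disc\<close> pays for the division.\<close>
        define O' where "O' = (\<Prod>(k, l)\<in>off_diagonal n - {(i, j)}. yy k - yy l)"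
        have O': "O' \<in> YS" unfolding O'_def
          by (rule rgen_intros(9)) (auto simp: off_diagonal_def intro!: rgen_intros(3)[OF rgen.base rgen.base])
        have "(i, j) \<in> off_diagonal n" using ij by (simp add: off_diagonal_def)
        hence "Disc = (yy i - yy j) * O'"
          unfolding Disc_def O'_def by (subst prod.remove[OF finite_off_diagonal]) auto
        hence "Disc ^ Suc e * q - O' * g = O' * (Disc ^ e * ((yy i - yy j) * q) - g)"
          by (simp add: right_diff_distrib mult_ac)
        also have "\<dots> \<in> J" using ideal_mult[OF PN_subring J_ideal _ g(2), of O'] O' YS_subset by blast
        finally show ?thesis by (rule GI[OF q(1) rgen_intros(4)[OF O' g(1)]])
      qed
      show "poly ?R (yy i) \<in> G" if "i < n" for i
      proof -
        have "poly ?R (yy i) = inverse_eqn n a i + cnst (a i)"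
          by (simp add: poly_sum poly_monom inverse_eqn_def)
        thus ?thesis using subring_add[OF Gsub JG[OF inverse_eqn_J[OF that]] cstG] by simp
      qed
      show "coeff ?R k \<in> PN" for k unfolding coeff_sum coeff_monom
        by (intro PN_intros) (auto simp: N_def mvar_in_poly_ring subring_zero[OF subring_poly_ring])
    qed (use Gdiff Gmult yG in \<open>auto simp: coeff_sum\<close>)
    thus ?thesis using l by (simp add: coeff_sum)
  qed
  have T: "mvar (2 * n) \<in> G"
  proof -
    have "poly (map_poly cnst MK) (yy 0) \<in> G"
      unfolding poly_altdef using yG[of 0] n_pos by (intro subring_intros[OF Gsub]) (auto simp: cstG)
    hence "value_eqn n a MK 0 - poly (map_poly cnst MK) (yy 0) \<in> G"
      using JG[OF value_eqn_J[OF n_pos]] Gdiff by blast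
    thus ?thesis by (simp add: value_eqn_def)
  qed
  have "mvar i \<in> G" if "i < N" for i
  proof -
    have "i < n \<or> (i - n < n \<and> i = n + (i - n)) \<or> i = 2 * n" using that by (auto simp: N_def)
    thus ?thesis using X U[of "i - n"] T by auto
  qed
  hence "rgen (range cnst \<union> mvar ` {..<N}) \<subseteq> G" using cstG by (intro rgen_least[OF Gsub]) auto
  hence "q \<in> G" using poly_ring_generators assms by blast
  thus ?thesis unfolding G_def by blast
qed

lemma V_point_fib:
  assumes w: "w \<in> V"
  shows "(\<lambda>i. eval_mpoly (yy i) w) \<in> fib (- w (2 * n))"
    and "i < n \<Longrightarrow> j < n \<Longrightarrow> i \<noteq> j \<Longrightarrow> eval_mpoly (yy i) w \<noteq> eval_mpoly (yy j) w"
proof -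
  have "root_prod (map (\<lambda>i. eval_mpoly (yy i) w) [0..<n]) = MK - [:- w (2 * n):]"
  proof (rule poly_eqI)
    fix k
    have "eval_mpoly (coeff (root_prod (map yy [0..<n])) k) w = eval_mpoly (coeff (map_poly cnst MK + [:mvar (2 * n):]) k) w"
      using J_vanishes[OF root_prod_yy_coeff w, of k] by (simp add: eval_mpoly_diff)
    also have "\<dots> = coeff (MK - [:- w (2 * n):]) k"
      by (cases k) (simp_all add: eval_mpoly_add)
    finally show "coeff (root_prod (map (\<lambda>i. eval_mpoly (yy i) w) [0..<n])) k = coeff (MK - [:- w (2 * n):]) k"
      by (simp add: hom_coeff_root_prod[OF eval_hom] o_def)
  qed
  thus "(\<lambda>i. eval_mpoly (yy i) w) \<in> fib (- w (2 * n))" by (simp add: fib_def)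
  assume ij: "i < n" "j < n" "i \<noteq> j"
  show "eval_mpoly (yy i) w \<noteq> eval_mpoly (yy j) w"
  proof
    assume eq: "eval_mpoly (yy i) w = eval_mpoly (yy j) w"
    have "a l = (\<Sum>m<n. w (n + m) * eval_mpoly (yy l) w ^ m)" if "l < n" for l
      using V_iff[of w] w that by (simp add: eval_inverse_eqn)
    hence "a i = a j" using ij eq by simp
    thus False using inj_a ij by (auto simp: inj_on_def)
  qed
qed

text \<open>With \<open>V_point_fib\<close> this shows that \<open>V\<close> maps onto the points of
  \<open>C\<close> with distinct coordinates: \<open>X\<close> interpolates
  \<open>a i \<mapsto> y i\<close>, and \<open>U\<close> interpolates
  \<open>y i \<mapsto> a i\<close>.\<close>

lemma V_point_lift:
  assumes y: "y \<in> fib s" and inj: "inj_on y {..<n}"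
  obtains w where "w \<in> V" "\<And>i. i < n \<Longrightarrow> eval_mpoly (yy i) w = y i" "w (2 * n) = - s"
proof -
  obtain p where p: "\<And>k. k \<ge> n \<Longrightarrow> coeff p k = 0" "\<And>i. i < n \<Longrightarrow> poly p (a i) = y i"
    using interpolation_exists[OF inj_a, of y] by blast
  obtain u where u: "\<And>k. k \<ge> n \<Longrightarrow> coeff u k = 0" "\<And>i. i < n \<Longrightarrow> poly u (y i) = a i"
    using interpolation_exists[OF inj, of a] by blast
  have expand: "poly q x = (\<Sum>j<n. coeff q j * x ^ j)" if "\<And>k. k \<ge> n \<Longrightarrow> coeff q k = 0" for q and x :: "'k alg_closure"
  proof -
    have "poly q x = (\<Sum>j\<in>{..degree q} \<union> {..<n}. coeff q j * x ^ j)"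
      unfolding poly_altdef by (intro sum.mono_neutral_left) (auto simp: coeff_eq_0)
    also have "\<dots> = (\<Sum>j<n. coeff q j * x ^ j)" using that by (intro sum.mono_neutral_right) auto
    finally show ?thesis .
  qed
  define w where "w = (\<lambda>j. if j < n then coeff p j else if j < 2 * n then coeff u (j - n) else if j = 2 * n then - s else 0)"
  have yw: "eval_mpoly (yy i) w = y i" if "i < n" for i
    using p(2)[OF that] expand[OF p(1)] by (simp add: eval_yy w_def)
  have "w \<in> V" unfolding V_iff
  proof (intro conjI allI impI)
    show "w \<in> affine_space N" by (simp add: affine_space_def w_def N_def)
    fix i assume i: "i < n"
    show "eval_mpoly (value_eqn n a MK i) w = 0"
      using fib_coord[OF y i] by (simp add: eval_value_eqn yw[OF i]) (simp add: w_def)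
    show "eval_mpoly (inverse_eqn n a i) w = 0"
      using u(2)[OF i] expand[OF u(1)] by (simp add: eval_inverse_eqn yw[OF i]) (simp add: w_def)
  qed
  moreover have "w (2 * n) = - s" by (simp add: w_def)
  ultimately show ?thesis using that yw by blast
qed

lemma noncritical_inj:
  assumes "y \<in> fib s" "s \<notin> critical_values"
  shows "inj_on y {..<n}"
  using fib_noncritical_neq[OF assms] by (auto simp: inj_on_def)

lemma exists_noncritical: "\<exists>s. s \<notin> critical_values"
  using finite_critical_values infinite_UNIV_alg_closed ex_new_if_finite by blast

lemma V_nonempty: "V \<noteq> {}"
  using exists_noncritical fib_nonempty noncritical_inj V_point_lift by (metis empty_iff)

lemma YS_as_function:
  assumes "g \<in> YS"
  shows "\<exists>F\<in>polyfuns n. \<forall>s w. eval_mpoly g w = F (s, \<lambda>i. eval_mpoly (yy i) w)"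
  using assms
proof induction
  case (base x)
  then consider c where "x = cnst c" | i where "i < n" "x = yy i" by auto
  thus ?case
  proof cases
    case 1
    thus ?thesis by (intro bexI[of _ "\<lambda>_. c"]) (auto intro: polyfuns_const)
  next
    case 2
    thus ?thesis by (intro bexI[of _ "\<lambda>w. snd w i"]) (auto intro: polyfuns_coord)
  qed
next
  case one
  have "eval_mpoly (cnst 1) w = 1" for w :: "nat \<Rightarrow> 'k alg_closure" by (rule eval_mpoly_cnst)
  thus ?case by (intro bexI[of _ "\<lambda>_. 1"]) (auto intro: polyfuns_const)
next
  case (diff x y)
  then obtain F G where "F \<in> polyfuns n" "G \<in> polyfuns n" "\<forall>s w. eval_mpoly x w = F (s, \<lambda>i. eval_mpoly (yy i) w)"
    "\<forall>s w. eval_mpoly y w = G (s, \<lambda>i. eval_mpoly (yy i) w)" by blast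
  thus ?case by (intro bexI[of _ "\<lambda>w. F w - G w"]) (auto intro: polyfuns_diff_fun simp: eval_mpoly_diff)
next
  case (mult x y)
  then obtain F G where "F \<in> polyfuns n" "G \<in> polyfuns n" "\<forall>s w. eval_mpoly x w = F (s, \<lambda>i. eval_mpoly (yy i) w)"
    "\<forall>s w. eval_mpoly y w = G (s, \<lambda>i. eval_mpoly (yy i) w)" by blast
  thus ?case by (intro bexI[of _ "\<lambda>w. F w * G w"]) (auto intro: polyfuns_mult_fun simp: eval_mpoly_mult)
qed

lemma poly_in_last_variable:
  assumes "c \<in> rgen (range cnst \<union> {mvar (2 * n)})"
  shows "\<exists>q. c = poly (map_poly cnst q) (mvar (2 * n) :: 'k alg_closure mpoly)"
  using assms
proof induction
  case (base x)
  then consider b where "x = cnst b" | "x = mvar (2 * n)" by auto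
  thus ?case
  proof cases
    case 1
    have "map_poly cnst [:b:] = [:cnst b:]" by (rule poly_eqI) (simp add: coeff_pCons split: nat.split)
    thus ?thesis using 1 by (intro exI[of _ "[:b:]"]) simp
  next
    case 2
    have "map_poly cnst [:0, 1 :: 'k alg_closure:] = [:0, 1:]"
      by (rule poly_eqI) (simp add: coeff_pCons cnst_hom split: nat.split)
    thus ?thesis using 2 by (intro exI[of _ "[:0, 1:]"]) simp
  qed
next
  case one
  show ?case by (intro exI[of _ 1]) simp
next
  case (diff x y)
  interpret c: map_poly_comm_ring_hom "cnst :: 'k alg_closure \<Rightarrow> _" ..
  from diff obtain p q where "x = poly (map_poly cnst p) (mvar (2 * n))" "y = poly (map_poly cnst q) (mvar (2 * n))" by blast
  thus ?case by (intro exI[of _ "p - q"]) (simp add: c.hom_minus)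
next
  case (mult x y)
  interpret c: map_poly_comm_ring_hom "cnst :: 'k alg_closure \<Rightarrow> _" ..
  from mult obtain p q where "x = poly (map_poly cnst p) (mvar (2 * n))" "y = poly (map_poly cnst q) (mvar (2 * n))" by blast
  thus ?case by (intro exI[of _ "p * q"]) (simp add: c.hom_mult)
qed

text \<open>Modulo \<open>J\<close> such a \<open>g\<close> has an Artin normal form with
  coefficients polynomial in \<open>T\<close>. Over a noncritical value all orderings of the roots
  lift to \<open>V\<close>, so the coefficients vanish there, hence identically.\<close>

lemma vanishing_YS_in_J:
  assumes g: "g \<in> YS" and van: "\<And>w. w \<in> V \<Longrightarrow> eval_mpoly g w = 0"
  shows "g \<in> J"
proof -
  let ?R = "rgen (range cnst \<union> {mvar (2 * n)}) :: 'k alg_closure mpoly set"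
  have T: "mvar (2 * n) \<in> PN" by (auto intro: mvar_in_poly_ring simp: N_def)
  have "\<exists>c. (\<forall>ms. c ms \<in> ?R) \<and> g - (\<Sum>ms\<in>artin (length (map yy [0..<n])). c ms * monval ms (map yy [0..<n])) \<in> J"
  proof (rule artin_reduction[OF PN_subring J_ideal subring_rgen])
    show "?R \<subseteq> PN" using T cnst_in_poly_ring by (intro rgen_least[OF PN_subring]) auto
    show "set (map yy [0..<n]) \<subseteq> PN" using yy_ring by auto
    have "range cnst \<union> yy ` {..<n} \<subseteq> ?R \<union> set (map yy [0..<n])" by (auto intro: rgen.base)
    thus "g \<in> rgen (?R \<union> set (map yy [0..<n]))" using rgen_mono g by blast
    fix k
    have "coeff (map_poly cnst MK + [:mvar (2 * n):]) k \<in> ?R"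
    proof -
      have "coeff (map_poly cnst MK) k \<in> ?R" by (auto intro: rgen.base)
      moreover have "coeff [:mvar (2 * n):] k \<in> ?R" by (cases k) (auto intro: rgen.base rgen_intros)
      ultimately show ?thesis unfolding coeff_add by (rule rgen_intros(6))
    qed
    thus "\<exists>c\<in>?R. coeff (root_prod (map yy [0..<n])) k - c \<in> J" using root_prod_yy_coeff by blast
  qed
  then obtain c where c: "\<And>ms. c ms \<in> ?R" "g - (\<Sum>ms\<in>artin n. c ms * monval ms (map yy [0..<n])) \<in> J" by auto
  have "\<forall>ms. \<exists>q. c ms = poly (map_poly cnst q) (mvar (2 * n))" using poly_in_last_variable c(1) by blast
  then obtain q where q: "\<And>ms. c ms = poly (map_poly cnst (q ms)) (mvar (2 * n))" by metis
  have eval_monval: "eval_mpoly (monval ms (map yy is)) w = monval ms (map (\<lambda>i. eval_mpoly (yy i) w) is)" for ms w and "is" :: "nat list"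
  proof (induction ms arbitrary: "is")
    case Nil
    show ?case using eval_mpoly_cnst[of 1 w] by simp
  next
    case (Cons k ms)
    show ?case using eval_mpoly_cnst[of 1 w] Cons by (cases "is") (simp_all add: eval_mpoly_mult eval_mpoly_power)
  qed
  have "q ms = 0" if ms: "ms \<in> artin n" for ms
  proof (rule poly_eq_0_if_cofinite_roots)
    show "finite (uminus ` critical_values)" using finite_critical_values by simp
    fix t assume "t \<notin> uminus ` critical_values"
    hence s: "- t \<notin> critical_values" by force
    show "poly (q ms) t = 0"
    proof (rule normal_form_unique[where s = "- t" and c = "\<lambda>ms. poly (q ms) t", OF _ _ ms])
      show "distinct ys" if "root_prod ys = MK - [:- t:]" for ys using noncritical_distinct[OF that s] .
      fix y assume y: "y \<in> fib (- t)"
      obtain w where w: "w \<in> V" "\<And>i. i < n \<Longrightarrow> eval_mpoly (yy i) w = y i" "w (2 * n) = t"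
        using V_point_lift[OF y noncritical_inj[OF y s]] by auto
      have mapeq: "map (\<lambda>i. eval_mpoly (yy i) w) [0..<n] = map y [0..<n]" using w(2) by simp
      have "eval_mpoly (\<Sum>ms\<in>artin n. c ms * monval ms (map yy [0..<n])) w = 0"
        using J_vanishes[OF c(2) w(1)] van[OF w(1)] by (simp add: eval_mpoly_diff)
      thus "(\<Sum>ms\<in>artin n. poly (q ms) t * monval ms (map y [0..<n])) = 0"
        unfolding mapeq[symmetric] by (simp add: eval_mpoly_sum eval_mpoly_mult eval_monval q eval_poly_map_cnst w(3))
    qed
  qed
  hence "(\<Sum>ms\<in>artin n. c ms * monval ms (map yy [0..<n])) = 0" by (intro sum.neutral) (simp add: q)
  thus ?thesis using c(2) by simp
qed

text \<open>A power of \<open>Disc\<close> moves \<open>q\<close> into \<open>YS\<close> modulo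
  \<open>J\<close>, where \<open>vanishing_YS_in_J\<close> applies; afterwards the power is
  cancelled, its factors being units modulo \<open>J\<close>.\<close>

lemma vanishing_ideal_V: "vanishing_ideal N V = J"
proof
  show "J \<subseteq> vanishing_ideal N V" using J_subset J_vanishes by (auto simp: vanishing_ideal_def)
  show "vanishing_ideal N V \<subseteq> J"
  proof
    fix q assume "q \<in> vanishing_ideal N V"
    hence q: "q \<in> PN" "\<And>w. w \<in> V \<Longrightarrow> eval_mpoly q w = 0" by (auto simp: vanishing_ideal_def)
    obtain e g where g: "g \<in> YS" "Disc ^ e * q - g \<in> J" using clear_denominators[OF q(1)] by blast
    have "eval_mpoly g w = 0" if "w \<in> V" for w
      using J_vanishes[OF g(2) that] q(2)[OF that] by (simp add: eval_mpoly_diff eval_mpoly_mult)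
    hence "g \<in> J" by (rule vanishing_YS_in_J[OF g(1)])
    hence "Disc ^ e * q - g + g \<in> J" using g(2) ideal_add[OF PN_subring J_ideal] by blast
    thus "q \<in> J" using cancel_Disc[OF q(1)] by simp
  qed
qed

lemma V_affine_variety: "affine_variety N V"
  unfolding affine_variety_def
proof
  show "zariski_closed N V" unfolding zariski_closed_def V_def using eqns_ring by blast
  show "\<exists>B\<subseteq>poly_ring N. vanishing_ideal N V = ideal_generated N (Poly_Mapping.map to_ac ` B)"
    using vanishing_ideal_V r_ring h_ring by (intro exI[of _ eqns]) (auto simp: J_def eqns_def N_def)
qed

text \<open>After denominators are cleared both factors become functions \<open>F\<close> and
  \<open>G\<close> on \<open>C\<close>. Their product vanishes at the points that lift to
  \<open>V\<close>, among them all points over noncritical values, hence on all of \<open>C\<close>;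
  and \<open>Disc\<close> has no zero on \<open>V\<close>.\<close>

lemma vanishing_product:
  assumes p: "p \<in> PN" and q: "q \<in> PN" and pq: "\<And>w. w \<in> V \<Longrightarrow> eval_mpoly p w * eval_mpoly q w = 0"
  shows "(\<forall>w\<in>V. eval_mpoly p w = 0) \<or> (\<forall>w\<in>V. eval_mpoly q w = 0)"
proof -
  obtain e g where g: "g \<in> YS" "Disc ^ e * p - g \<in> J" using clear_denominators[OF p] by blast
  obtain e' g' where g': "g' \<in> YS" "Disc ^ e' * q - g' \<in> J" using clear_denominators[OF q] by blast
  obtain F where F: "F \<in> polyfuns n" "\<And>s w. eval_mpoly g w = F (s, \<lambda>i. eval_mpoly (yy i) w)"
    using YS_as_function[OF g(1)] by blast
  obtain G where G: "G \<in> polyfuns n" "\<And>s w. eval_mpoly g' w = G (s, \<lambda>i. eval_mpoly (yy i) w)"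
    using YS_as_function[OF g'(1)] by blast
  have gv: "eval_mpoly g w = eval_mpoly Disc w ^ e * eval_mpoly p w"
    and gv': "eval_mpoly g' w = eval_mpoly Disc w ^ e' * eval_mpoly q w" if "w \<in> V" for w
    using J_vanishes[OF g(2) that] J_vanishes[OF g'(2) that]
    by (simp_all add: eval_mpoly_diff eval_mpoly_mult eval_mpoly_power)
  have depends: "H (s, y) = H (s, y')" if "H \<in> polyfuns n" "\<And>i. i < n \<Longrightarrow> y i = y' i" for H s y and y' :: "nat \<Rightarrow> 'k alg_closure"
    using that by (induction rule: polyfuns_induct) auto
  have "F (s, y) * G (s, y) = 0" if y: "y \<in> fib s" for s y
  proof -
    have "(\<lambda>w. F w * G w) (s, y) = 0"
    proof (rule vanish_if_cofinite[OF _ finite_critical_values _ y])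
      show "(\<lambda>w. F w * G w) \<in> polyfuns n" using F G by (intro polyfuns_intros)
      fix s y assume s: "s \<notin> critical_values" and y: "y \<in> fib s"
      obtain w where w: "w \<in> V" "\<And>i. i < n \<Longrightarrow> eval_mpoly (yy i) w = y i"
        using V_point_lift[OF y noncritical_inj[OF y s]] by blast
      have "F (s, y) = eval_mpoly g w" "G (s, y) = eval_mpoly g' w"
        unfolding F(2)[of w s] G(2)[of w s] using w(2) by (auto intro!: depends F G)
      thus "F (s, y) * G (s, y) = 0" using gv[OF w(1)] gv'[OF w(1)] pq[OF w(1)] by auto
    qed
    thus ?thesis by simp
  qed
  from curve_of_ordered_roots_irreducible[OF F(1) G(1) this]
  have "(\<forall>w\<in>V. eval_mpoly g w = 0) \<or> (\<forall>w\<in>V. eval_mpoly g' w = 0)"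
    using V_point_fib(1) F(2) G(2) by metis
  moreover have "eval_mpoly Disc w \<noteq> 0" if "w \<in> V" for w
  proof -
    have "eval_mpoly Disc w = (\<Prod>(i, j)\<in>off_diagonal n. eval_mpoly (yy i) w - eval_mpoly (yy j) w)"
      by (simp add: Disc_def eval_mpoly_prod case_prod_unfold eval_mpoly_diff)
    thus ?thesis using V_point_fib(2)[OF that] finite_off_diagonal by (auto simp: off_diagonal_def)
  qed
  ultimately show ?thesis using gv gv' by auto
qed

lemma V_irreducible: "zariski_irreducible N V"
  by (rule zariski_irreducibleI[OF _ vanishing_product]) (auto simp: V_def zero_locus_def)

theorem rational_point:
  assumes "pac_field TYPE('k)"
  obtains w where "w \<in> V" "\<And>i. w i \<in> range to_ac"
proof -
  \<comment> \<open>Were there no rational points, their closure would be empty, since the empty set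
    is closed, and could not be the nonempty \<open>V\<close>.\<close>
  have empty_closed: "zariski_closed N ({} :: (nat \<Rightarrow> 'k alg_closure) set)"
    unfolding zariski_closed_def
  proof (intro exI conjI)
    show "{cnst 1} \<subseteq> PN" using cnst_in_poly_ring by blast
    show "{} = zero_locus N {cnst 1 :: 'k alg_closure mpoly}" by (auto simp: zero_locus_def simp del: cnst.hom_one)
  qed
  have "zariski_closed N hull rational_points V = V"
    using assms V_affine_variety V_nonempty V_irreducible
    unfolding pac_field_def geometrically_irreducible_def by blast
  hence "rational_points V \<noteq> {}"
    using V_nonempty hull_same[of "zariski_closed N", OF empty_closed] by auto
  thus ?thesis using that by (auto simp: rational_points_def)
qed

end

section \<open>Rational points\<close>

lemma affine_line_eval:
  fixes P :: "'a::comm_ring_1 mpoly"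
  assumes "P \<in> poly_ring 1"
  shows "\<exists>p. (\<forall>x. eval_mpoly P x = poly p (x 0)) \<and> (p = 0 \<longrightarrow> P = 0)"
proof -
  have keys: "Poly_Mapping.keys m \<subseteq> {0}" if "m \<in> Poly_Mapping.keys P" for m
    using assms that by (auto simp: poly_ring_def)
  define p where "p = (\<Sum>m\<in>Poly_Mapping.keys P. monom (Poly_Mapping.lookup P m) (Poly_Mapping.lookup m 0))"
  have "eval_mpoly P x = poly p (x 0)" for x
  proof -
    have "power_product x m = x 0 ^ Poly_Mapping.lookup m 0" if "m \<in> Poly_Mapping.keys P" for m
      using power_product_superset[of "{0}" m x] keys[OF that] by simp
    thus ?thesis by (simp add: eval_mpoly_def power_product_def[symmetric] p_def poly_sum poly_monom)
  qed
  moreover have "P = 0" if "p = 0"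
  proof (rule poly_mapping_eqI)
    fix m
    show "Poly_Mapping.lookup P m = Poly_Mapping.lookup 0 m"
    proof (cases "m \<in> Poly_Mapping.keys P")
      case True
      have "m' = m" if "m' \<in> Poly_Mapping.keys P" "Poly_Mapping.lookup m' 0 = Poly_Mapping.lookup m 0" for m'
      proof (rule poly_mapping_eqI)
        fix i
        show "Poly_Mapping.lookup m' i = Poly_Mapping.lookup m i"
        proof (cases "i = 0")
          case False
          hence "i \<notin> Poly_Mapping.keys m'" "i \<notin> Poly_Mapping.keys m"
            using keys[OF that(1)] keys[OF True] by auto
          thus ?thesis by (simp add: in_keys_iff)
        qed (use that in simp)
      qed
      hence "coeff p (Poly_Mapping.lookup m 0) = (\<Sum>m'\<in>Poly_Mapping.keys P. if m' = m then Poly_Mapping.lookup P m else 0)"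
        unfolding p_def coeff_sum coeff_monom by (intro sum.cong) auto
      thus ?thesis using True that by simp
    qed (simp add: in_keys_iff)
  qed
  ultimately show ?thesis by blast
qed

text \<open>Over a finite field the affine line has only finitely many rational points.\<close>

lemma pac_field_infinite:
  assumes pac: "pac_field TYPE('k::field)"
  shows "infinite (UNIV :: 'k set)"
proof
  assume fin: "finite (UNIV :: 'k set)"
  define L where "L = (affine_space 1 :: (nat \<Rightarrow> 'k alg_closure) set)"
  define pt where "pt = (\<lambda>(c :: 'k alg_closure) (i :: nat). if i = 0 then c else 0)"
  have pt: "pt c \<in> L" "pt c 0 = c" for c by (auto simp: L_def pt_def affine_space_def)
  have L_pt: "x = pt (x 0)" if "x \<in> L" for x
    using that by (auto simp: L_def pt_def affine_space_def fun_eq_iff)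
  have locus: "L = zero_locus 1 {}" by (auto simp: L_def zero_locus_def)
  have zero: "P = 0" if P: "P \<in> poly_ring 1" and van: "\<And>x. x \<in> L \<Longrightarrow> eval_mpoly P x = 0" for P :: "'k alg_closure mpoly"
  proof -
    obtain p where p: "\<And>x. eval_mpoly P x = poly p (x 0)" "p = 0 \<Longrightarrow> P = 0" using affine_line_eval[OF P] by blast
    have "poly p c = 0" for c using van[OF pt(1)[of c]] p(1)[of "pt c"] pt(2)[of c] by simp
    hence "p = 0" by (intro poly_eq_0_if_cofinite_roots[of "{}"]) auto
    thus ?thesis by (rule p(2))
  qed
  have "vanishing_ideal 1 L = ideal_generated 1 (Poly_Mapping.map to_ac ` ({} :: 'k mpoly set))"
    using zero by (auto simp: vanishing_ideal_def ideal_generated_def intro: subring_zero[OF subring_poly_ring])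
  moreover have "zariski_closed 1 L" unfolding zariski_closed_def locus by (intro exI[of _ "{}"]) simp
  ultimately have "affine_variety 1 L" unfolding affine_variety_def by blast
  moreover have "L \<noteq> {}" using pt(1) by blast
  moreover have "zariski_irreducible 1 L"
  proof (rule zariski_irreducibleI)
    show "L \<subseteq> affine_space 1" by (simp add: L_def)
    fix P Q :: "'k alg_closure mpoly"
    assume PQ: "P \<in> poly_ring 1" "Q \<in> poly_ring 1" "\<And>x. x \<in> L \<Longrightarrow> eval_mpoly P x * eval_mpoly Q x = 0"
    obtain p where p: "\<And>x. eval_mpoly P x = poly p (x 0)" using affine_line_eval[OF PQ(1)] by blast
    obtain q where q: "\<And>x. eval_mpoly Q x = poly q (x 0)" using affine_line_eval[OF PQ(2)] by blast
    have "poly (p * q) c = 0" for c using PQ(3)[OF pt(1)[of c]] p[of "pt c"] q[of "pt c"] pt(2)[of c] by simp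
    hence "p * q = 0" by (intro poly_eq_0_if_cofinite_roots[of "{}"]) auto
    thus "(\<forall>x\<in>L. eval_mpoly P x = 0) \<or> (\<forall>x\<in>L. eval_mpoly Q x = 0)" using p q by auto
  qed
  ultimately have dense: "zariski_closed 1 hull rational_points L = L"
    using pac unfolding pac_field_def geometrically_irreducible_def by blast
  \<comment> \<open>For finite \<open>k\<close> this polynomial vanishes at all rational points of
    the line; density would then put every element of the algebraic closure into
    \<open>k\<close>.\<close>
  define C where "C = (\<Prod>c\<in>(UNIV :: 'k set). mvar 0 - cnst (to_ac c :: 'k alg_closure))"
  have C: "C \<in> poly_ring 1" unfolding C_def
    by (intro subring_intros[OF subring_poly_ring] mvar_in_poly_ring cnst_in_poly_ring) simp
  have evC: "eval_mpoly C x = (\<Prod>c\<in>(UNIV :: 'k set). x 0 - to_ac c)" for x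
    by (simp add: C_def eval_mpoly_prod eval_mpoly_diff)
  have "rational_points L \<subseteq> zero_locus 1 {C}"
    using fin by (auto simp: rational_points_def zero_locus_def L_def evC)
  moreover have "zariski_closed 1 (zero_locus 1 {C})" using C unfolding zariski_closed_def by blast
  ultimately have "zariski_closed 1 hull rational_points L \<subseteq> zero_locus 1 {C}" by (rule hull_minimal)
  hence "L \<subseteq> zero_locus 1 {C}" by (simp only: dense)
  have "c \<in> range to_ac" for c :: "'k alg_closure"
  proof -
    have "eval_mpoly C (pt c) = 0" using pt(1)[of c] \<open>L \<subseteq> _\<close> by (auto simp: zero_locus_def)
    thus ?thesis using fin by (auto simp: evC pt(2))
  qed
  hence "range (to_ac :: 'k \<Rightarrow> _) = UNIV" by blast
  hence "finite (UNIV :: 'k alg_closure set)" using fin by (metis finite_imageI)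
  thus False using infinite_UNIV_alg_closed by blast
qed

lemma monic_morse_smult:
  fixes M :: "'k::field poly"
  assumes "morse_poly M" "degree M = n" "n > 0" "\<not> CHAR('k) dvd n"
  shows "monic_morse (map_poly to_ac (Polynomial.smult (inverse (lead_coeff M)) M)) n"
proof -
  interpret T: field_hom "to_ac :: 'k \<Rightarrow> 'k alg_closure" by (rule to_ac_hom)
  define c where "c = to_ac (inverse (lead_coeff M))"
  have "M \<noteq> 0" using assms by auto
  hence c: "c \<noteq> 0" by (simp add: c_def)
  have eq: "map_poly to_ac (Polynomial.smult (inverse (lead_coeff M)) M) = Polynomial.smult c (map_poly to_ac M)"
    unfolding c_def by (rule poly_eqI) (simp add: coeff_map_poly)
  have pd: "pderiv (Polynomial.smult c (map_poly to_ac M)) = Polynomial.smult c (map_poly to_ac (pderiv M))"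
    by (simp add: pderiv_smult T.map_poly_pderiv)
  have zeros: "{\<beta>. poly (Polynomial.smult c (map_poly to_ac (pderiv M))) \<beta> = 0} = {\<beta>. poly (map_poly to_ac (pderiv M)) \<beta> = 0}"
    using c by simp
  show ?thesis unfolding eq
  proof
    show "degree (Polynomial.smult c (map_poly to_ac M)) = n" using c assms by simp
    show "n > 0" by fact
    have "lead_coeff (Polynomial.smult c (map_poly to_ac M)) = c * to_ac (lead_coeff M)"
      using c by (simp add: lead_coeff_smult)
    thus "lead_coeff (Polynomial.smult c (map_poly to_ac M)) = 1" using \<open>M \<noteq> 0\<close> by (simp add: c_def)
    show "(of_nat n :: 'k alg_closure) \<noteq> 0"
      using assms(4) by (simp add: of_nat_eq_0_iff_char_dvd)
    show "order \<beta> (pderiv (Polynomial.smult c (map_poly to_ac M))) = 1"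
      if "poly (pderiv (Polynomial.smult c (map_poly to_ac M))) \<beta> = 0" for \<beta>
      using that assms(1) c unfolding pd by (simp add: morse_poly_def Let_def order_smult)
    have "inj_on (poly (map_poly to_ac M)) {\<beta>. poly (map_poly to_ac (pderiv M)) \<beta> = 0}"
      using assms(1) by (simp add: morse_poly_def Let_def)
    thus "inj_on (poly (Polynomial.smult c (map_poly to_ac M)))
        {\<beta>. poly (pderiv (Polynomial.smult c (map_poly to_ac M))) \<beta> = 0}"
      unfolding pd zeros using c by (auto simp: inj_on_def)
  qed
qed

section \<open>From a rational point to a primitive element\<close>

context finite_extension
begin

lemma subfield_poly_closed:
  assumes "is_subfield F" "range \<iota> \<subseteq> F" "x \<in> F"
  shows "ev g x \<in> F"
proof (induction g)
  case 0
  have "1 - 1 \<in> F" using assms(1) unfolding is_subfield_def by blast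
  thus ?case by simp
next
  case (pCons c g)
  have diff: "u - v \<in> F" and mult: "u * v \<in> F" if "u \<in> F" "v \<in> F" for u v
    using assms(1) that unfolding is_subfield_def by blast+
  have "\<iota> c - (0 - x * ev g x) \<in> F"
    using diff[of 1 1] assms pCons.IH by (intro diff mult) (auto simp: is_subfield_def)
  thus ?case by (simp add: hom_distribs)
qed

lemma primitive_element_if_generates:
  assumes "adj \<theta> = UNIV" "\<theta> \<in> adj \<eta>"
  shows "primitive_element \<iota> \<eta>"
  unfolding primitive_element_def hull_def
proof (intro equalityI subset_UNIV subsetI InterI)
  fix x F assume F: "F \<in> {t. is_subfield t \<and> insert \<eta> (range \<iota>) \<subseteq> t}"
  have "x \<in> adj \<eta>" using assms adj_subset by blast
  then obtain g where "x = ev g \<eta>" by (auto simp: adj_def)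
  thus "x \<in> F" using F subfield_poly_closed[of F \<eta> g] by auto
qed

text \<open>The minimal polynomial of \<open>\<eta>\<close> also has degree \<open>n\<close> and
  divides \<open>Q\<close>, so the two differ by a unit.\<close>

lemma irreducible_if_root_generates:
  assumes Q: "degree Q = n" "ev Q \<eta> = 0" and gen: "adj \<eta> = UNIV"
  shows "irreducible Q"
proof -
  obtain f where f: "lead_coeff f = 1" "irreducible f" "ev f \<eta> = 0"
    "\<And>g. ev g \<eta> = 0 \<Longrightarrow> g \<noteq> 0 \<Longrightarrow> degree f \<le> degree g"
    using minimal_polynomial by metis
  have df: "degree f = n" using dim_adj(2)[OF f(1,3,2,4)] gen dim_UNIV by simp
  have "f dvd Q" by (rule dvd_if_common_root[OF hom f(2,3) Q(2)])
  then obtain q where q: "Q = f * q" by blast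
  have "Q \<noteq> 0" using Q n_pos by auto
  hence "f \<noteq> 0" "q \<noteq> 0" using q by auto
  hence "degree q = 0" using q Q df by (simp add: degree_mult_eq)
  hence "is_unit q" using \<open>q \<noteq> 0\<close> is_unit_iff_degree by blast
  thus ?thesis unfolding q using f(2) irreducible_mult_unit_right by blast
qed

end

theorem corollary4p4:
  fixes M :: "'k::field poly" and \<iota> :: "'k \<Rightarrow> 'e::field" and n :: nat
  assumes "n \<ge> 2"
    and "pac_field TYPE('k)"
    and "\<not> CHAR('k) dvd n"
    and "Polynomial.degree M = n"
    and "morse_poly M"
    and "field_hom \<iota>"
    and "ext_degree \<iota> = n"
  shows "\<exists>b. realized_by \<iota> (M + [:b:])"
proof -
  interpret T: field_hom "to_ac :: 'k \<Rightarrow> 'k alg_closure" by (rule to_ac_hom)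
  interpret E: finite_extension \<iota> n using assms by (intro finite_extension.intro) auto
  have n: "n > 0" using assms(1) by simp
  define c where "c = lead_coeff M"
  have c: "c \<noteq> 0" using assms(4) n by (auto simp: c_def)
  \<comment> \<open>The curve is set up for monic polynomials; the leading coefficient is restored
    in \<open>b\<close>.\<close>
  define M' where "M' = Polynomial.smult (inverse c) M"
  have MM': "M = Polynomial.smult c M'" using c by (simp add: M'_def)
  have morse: "monic_morse (map_poly to_ac M') n"
    unfolding M'_def c_def by (rule monic_morse_smult) (use assms n in auto)
  obtain \<theta> f where f: "irreducible f" "lead_coeff f = 1" "degree f = n"
    and \<theta>: "poly (map_poly \<iota> f) \<theta> = 0" "E.adj \<theta> = UNIV"
    using E.primitive_element_exists[OF pac_field_infinite[OF assms(2)] assms(3)] by metis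
  obtain as where as: "length as = n" "root_prod as = map_poly to_ac f"
    using root_prod_exists[of "map_poly to_ac f" n] f by auto
  have "distinct as"
  proof (rule ccontr)
    assume "\<not> distinct as"
    then obtain b where b: "[:- b, 1:] ^ 2 dvd map_poly to_ac f" using not_distinct_double_root as(2) by metis
    have "\<not> CHAR('k) dvd degree f" using assms(3) f(3) by simp
    from separable_root_simple[OF to_ac_hom f(1) this] double_root_deriv[OF b] show False by blast
  qed
  define a where "a = (\<lambda>i. as ! i)"
  have inj: "inj_on a {..<n}"
    unfolding a_def using \<open>distinct as\<close> as(1) by (auto simp: inj_on_def nth_eq_iff_index_eq)
  have root: "poly (map_poly to_ac f) (a i) = 0" if "i < n" for i
    using poly_root_prod_eq_0[of "a i" as] as that by (simp add: a_def)
  obtain r h where rh: "\<And>l. r l \<in> poly_ring (2 * n + 1)" "\<And>l. h l \<in> poly_ring (2 * n + 1)"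
    "\<And>i. i < n \<Longrightarrow> value_eqn n a (map_poly to_ac M') i = (\<Sum>l<n. Poly_Mapping.map to_ac (r l) * cnst (a i ^ l))"
    "\<And>i. i < n \<Longrightarrow> inverse_eqn n a i = (\<Sum>l<n. Poly_Mapping.map to_ac (h l) * cnst (a i ^ l))"
    using equations_over_base_field[OF f(2,3), where a = a and M = M'] root by blast
  interpret C: twisted_curve M' n a r h
    by (rule twisted_curve.intro[OF morse inj rh])
  obtain w where w: "w \<in> C.V" "\<And>i. w i \<in> range to_ac" using C.rational_point[OF assms(2)] by blast
  have "\<forall>i. \<exists>x. w i = to_ac x" using w(2) by blast
  then obtain x where x: "\<And>i. w i = to_ac (x i)" by metis
  \<comment> \<open>The rational coordinates give polynomials over \<open>k\<close>:
    \<open>g\<close> defines \<open>\<eta> = g(\<theta>)\<close>, and \<open>u\<close> recovers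
    \<open>\<theta>\<close> from \<open>\<eta>\<close>.\<close>
  define g where "g = (\<Sum>j<n. monom (x j) j)"
  define u where "u = (\<Sum>j<n. monom (x (n + j)) j)"
  have mono: "poly (map_poly to_ac (\<Sum>j<n. monom (y j) j)) z = (\<Sum>j<n. to_ac (y j) * z ^ j)" for y :: "nat \<Rightarrow> 'k" and z
  proof -
    have "map_poly to_ac (\<Sum>j<n. monom (y j) j) = (\<Sum>j<n. monom (to_ac (y j)) j)"
      by (rule poly_eqI) (simp add: coeff_map_poly coeff_sum)
    thus ?thesis by (simp add: poly_sum poly_monom)
  qed
  have yg: "eval_mpoly (twist_coord n a 0) w = poly (map_poly to_ac g) (a 0)"
    unfolding g_def mono by (simp add: C.eval_yy x)
  have pc: "poly (map_poly to_ac (p \<circ>\<^sub>p g)) (a 0) = poly (map_poly to_ac p) (eval_mpoly (twist_coord n a 0) w)" for p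
    unfolding T.map_poly_pcompose yg by (simp add: poly_pcompose)
  have cst: "map_poly to_ac [:y:] = [:to_ac y:]" for y :: 'k
    by (rule poly_eqI) (simp add: coeff_map_poly coeff_pCons split: nat.split)
  have eX: "map_poly to_ac [:0, 1:] = [:0, 1 :: 'k alg_closure:]"
    by (rule poly_eqI) (simp add: coeff_map_poly coeff_pCons split: nat.split)
  interpret TP: map_poly_comm_ring_hom "to_ac :: 'k \<Rightarrow> 'k alg_closure" ..
  \<comment> \<open>The equations of one conjugate suffice: \<open>f\<close> is irreducible, so a
    polynomial over \<open>k\<close> vanishing at the root \<open>a 0\<close> is divisible by
    \<open>f\<close> and vanishes at \<open>\<theta>\<close> too.\<close>
  have "eval_mpoly (value_eqn n a (map_poly to_ac M') 0) w = 0" "eval_mpoly (inverse_eqn n a 0) w = 0"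
    using w(1) C.V_iff n by blast+
  hence "poly (map_poly to_ac (M' \<circ>\<^sub>p g + [:x (2 * n):])) (a 0) = 0"
    "poly (map_poly to_ac (u \<circ>\<^sub>p g - [:0, 1:])) (a 0) = 0"
    unfolding TP.hom_add TP.hom_minus cst eX poly_add poly_diff pc C.eval_value_eqn C.eval_inverse_eqn
    by (simp_all add: x u_def mono)
  hence "f dvd M' \<circ>\<^sub>p g + [:x (2 * n):]" "f dvd u \<circ>\<^sub>p g - [:0, 1:]"
    using dvd_if_common_root[OF to_ac_hom f(1) root[OF n]] by blast+
  hence z: "E.ev (M' \<circ>\<^sub>p g + [:x (2 * n):]) \<theta> = 0" "E.ev (u \<circ>\<^sub>p g - [:0, 1:]) \<theta> = 0"
    using \<theta>(1) by (auto elim!: dvdE simp: E.ev_mult)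
  define \<eta> where "\<eta> = E.ev g \<theta>"
  have comp: "E.ev (p \<circ>\<^sub>p g) \<theta> = E.ev p \<eta>" for p
    by (simp add: E.map_poly_pcompose poly_pcompose \<eta>_def)
  have "map_poly \<iota> [:0, 1:] = [:0, 1:]"
    by (rule poly_eqI) (simp add: coeff_map_poly coeff_pCons split: nat.split)
  hence "\<theta> = E.ev u \<eta>" using z(2) unfolding E.ev_diff comp by simp
  hence \<theta>\<eta>: "\<theta> \<in> E.adj \<eta>" by (auto simp: E.adj_def)
  hence gen: "E.adj \<eta> = UNIV" using E.adj_subset \<theta>(2) by blast
  \<comment> \<open>The last coordinate \<open>T\<close> satisfies
    \<open>M'(\<eta>) + T = 0\<close>, and \<open>M = c M'\<close>.\<close>
  define b where "b = c * x (2 * n)"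
  have Q: "M + [:b:] = Polynomial.smult c (M' + [:x (2 * n):])" unfolding MM' b_def by (simp add: smult_add_right)
  have "E.ev (M + [:b:]) \<eta> = \<iota> c * E.ev (M' + [:x (2 * n):]) \<eta>"
    unfolding Q by (simp add: E.map_poly_hom_smult)
  hence root\<eta>: "E.ev (M + [:b:]) \<eta> = 0" using z(1) unfolding E.ev_add comp by (simp add: E.ev_add E.ev_const)
  have "degree (M + [:b:]) = n" using degree_add_eq_left[of "[:b:]" M] assms(4) n by simp
  hence "irreducible (M + [:b:])" using E.irreducible_if_root_generates root\<eta> gen by blast
  thus ?thesis
    using root\<eta> E.primitive_element_if_generates[OF \<theta>(2) \<theta>\<eta>] unfolding realized_by_def by blast
qed

end
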